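(* Let $k\ge 1$ be an integer and let $\phi=\phi(z)\,dz^k$ be a holomorphic differential of order $k$ on $\mathbb{C}$ with $\phi(z)$ a polynomial that is not identically zero. Then there exists a unique complete and nonpositively curved (smooth) conformal metric $\sigma$ on $\mathbb{C}$ whose Gaussian curvature function $K$ satisfies $$K=-1+|\phi|_\sigma^2.$$
   Context: A conformal metric is $\sigma=\sigma(z)|dz|^2$ with $\sigma(z)>0$ smooth. Its Gaussian curvature is $K(z)=-(2\sigma(z))^{-1}\Delta\log\sigma(z)$ with $\Delta=4\,\partial^2/\partial z\partial\bar z$. The pointwise norm of $\phi$ is $|\phi|_\sigma(z)=\sigma(z)^{-k/2}|\phi(z)|$. Nonpositively curved means $K\le 0$ everywhere. *)

theory Defs
  imports "HOL-Analysis.Analysis" "HOL-Computational_Algebra.Polynomial"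
begin

section \<open>Smooth functions\<close>

primrec times_continuously_differentiable ::
    "nat \<Rightarrow> ('a::euclidean_space \<Rightarrow> 'b::real_normed_vector) \<Rightarrow> bool"
  where
    "times_continuously_differentiable 0 f \<longleftrightarrow> continuous_on UNIV f"
  | "times_continuously_differentiable (Suc n) f \<longleftrightarrow>
       (\<forall>x. f differentiable (at x)) \<and>
       (\<forall>v. times_continuously_differentiable n (\<lambda>x. frechet_derivative f (at x) v))"

definition smooth :: "('a::euclidean_space \<Rightarrow> 'b::real_normed_vector) \<Rightarrow> bool"
  where "smooth f \<longleftrightarrow> (\<forall>n. times_continuously_differentiable n f)"

section \<open>Conformal metrics on the complex plane\<close>

text \<open>The metric \<open>\<sigma>(z) |dz|\<^sup>2\<close> is represented by its density \<open>\<sigma>\<close>.\<close>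

definition conformal_metric :: "(complex \<Rightarrow> real) \<Rightarrow> bool"
  where "conformal_metric \<sigma> \<longleftrightarrow> (\<forall>z. 0 < \<sigma> z) \<and> smooth \<sigma>"

definition wirtinger_z :: "(complex \<Rightarrow> complex) \<Rightarrow> complex \<Rightarrow> complex"
  where "wirtinger_z f z =
    (frechet_derivative f (at z) 1 - \<i> * frechet_derivative f (at z) \<i>) / 2"

definition wirtinger_zbar :: "(complex \<Rightarrow> complex) \<Rightarrow> complex \<Rightarrow> complex"
  where "wirtinger_zbar f z =
    (frechet_derivative f (at z) 1 + \<i> * frechet_derivative f (at z) \<i>) / 2"

definition laplacian :: "(complex \<Rightarrow> complex) \<Rightarrow> complex \<Rightarrow> complex"
  where "laplacian f z = 4 * wirtinger_z (wirtinger_zbar f) z"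

text \<open>The Laplacian of a smooth real-valued function is real; \<open>Re\<close> only changes the type.\<close>

definition gauss_curvature :: "(complex \<Rightarrow> real) \<Rightarrow> complex \<Rightarrow> real"
  where "gauss_curvature \<sigma> z =
    - (1 / (2 * \<sigma> z)) * Re (laplacian (\<lambda>w. complex_of_real (ln (\<sigma> w))) z)"

definition nonpositively_curved :: "(complex \<Rightarrow> real) \<Rightarrow> bool"
  where "nonpositively_curved \<sigma> \<longleftrightarrow> (\<forall>z. gauss_curvature \<sigma> z \<le> 0)"

text \<open>The pointwise norm of the differential \<open>\<phi>(z) dz\<^sup>k\<close>, represented by its coefficient.\<close>

definition differential_norm ::
    "nat \<Rightarrow> (complex \<Rightarrow> complex) \<Rightarrow> (complex \<Rightarrow> real) \<Rightarrow> complex \<Rightarrow> real"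
  where "differential_norm k \<phi> \<sigma> z = \<sigma> z powr (- real k / 2) * cmod (\<phi> z)"

section \<open>The induced distance and completeness\<close>

definition speed :: "(complex \<Rightarrow> real) \<Rightarrow> (real \<Rightarrow> complex) \<Rightarrow> real \<Rightarrow> real"
  where "speed \<sigma> \<gamma> t = sqrt (\<sigma> (\<gamma> t)) * cmod (vector_derivative \<gamma> (at t))"

definition curve_length :: "(complex \<Rightarrow> real) \<Rightarrow> (real \<Rightarrow> complex) \<Rightarrow> real"
  where "curve_length \<sigma> \<gamma> = integral {0..1} (speed \<sigma> \<gamma>)"

text \<open>
  The derivative of a \<^const>\<open>valid_path\<close> may be unbounded near the finitely many exceptional
  parameters, so a valid path can have infinite length, in which case \<^const>\<open>integral\<close> returns 0.
  Such paths are excluded by demanding that the speed be integrable.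
\<close>

definition connecting_curves ::
    "(complex \<Rightarrow> real) \<Rightarrow> complex \<Rightarrow> complex \<Rightarrow> (real \<Rightarrow> complex) set"
  where "connecting_curves \<sigma> z w =
    {\<gamma>. valid_path \<gamma> \<and> pathstart \<gamma> = z \<and> pathfinish \<gamma> = w \<and> speed \<sigma> \<gamma> integrable_on {0..1}}"

definition conformal_dist :: "(complex \<Rightarrow> real) \<Rightarrow> complex \<Rightarrow> complex \<Rightarrow> real"
  where "conformal_dist \<sigma> z w = (INF \<gamma>\<in>connecting_curves \<sigma> z w. curve_length \<sigma> \<gamma>)"

definition complete_metric :: "(complex \<Rightarrow> real) \<Rightarrow> bool"
  where "complete_metric \<sigma> \<longleftrightarrow> Metric_space.mcomplete UNIV (conformal_dist \<sigma>)"

text \<open>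
  \<^const>\<open>Metric_space.mcomplete\<close> is meaningful only for genuine metrics, so the rest of this
  theory checks that the induced distance is one.
\<close>

lemma conformal_metric_pos: "conformal_metric \<sigma> \<Longrightarrow> 0 < \<sigma> z"
  by (simp add: conformal_metric_def)

lemma conformal_metric_continuous: "conformal_metric \<sigma> \<Longrightarrow> continuous_on S \<sigma>"
  by (metis conformal_metric_def continuous_on_subset smooth_def subset_UNIV
      times_continuously_differentiable.simps(1))

lemma speed_nonneg: "conformal_metric \<sigma> \<Longrightarrow> 0 \<le> speed \<sigma> \<gamma> t"
  by (simp add: speed_def conformal_metric_def less_imp_le)

lemma curve_length_nonneg:
  "\<lbrakk>conformal_metric \<sigma>; \<gamma> \<in> connecting_curves \<sigma> z w\<rbrakk> \<Longrightarrow> 0 \<le> curve_length \<sigma> \<gamma>"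
  by (simp add: curve_length_def connecting_curves_def integral_nonneg speed_nonneg)

lemma conformal_dist_le:
  assumes "conformal_metric \<sigma>" "\<gamma> \<in> connecting_curves \<sigma> z w"
  shows "conformal_dist \<sigma> z w \<le> curve_length \<sigma> \<gamma>"
  unfolding conformal_dist_def using assms
  by (intro cINF_lower bdd_belowI2[where m = 0] curve_length_nonneg)

lemma linepath_in_connecting_curves:
  assumes "conformal_metric \<sigma>"
  shows "linepath z w \<in> connecting_curves \<sigma> z w"
proof -
  have "continuous_on {0..1} (\<lambda>t. sqrt (\<sigma> (linepath z w t)) * cmod (w - z))"
    by (intro continuous_intros continuous_on_compose2[OF conformal_metric_continuous[OF assms]])
      (auto simp: continuous_on_linepath)
  then have "speed \<sigma> (linepath z w) integrable_on {0..1}"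
    by (simp add: speed_def[abs_def] integrable_continuous_real)
  then show ?thesis
    by (simp add: connecting_curves_def)
qed

lemma connecting_curves_nonempty: "conformal_metric \<sigma> \<Longrightarrow> connecting_curves \<sigma> z w \<noteq> {}"
  using linepath_in_connecting_curves by blast

lemma reversepath_in_connecting_curves:
  assumes "\<gamma> \<in> connecting_curves \<sigma> z w"
  shows "reversepath \<gamma> \<in> connecting_curves \<sigma> w z"
    and "curve_length \<sigma> (reversepath \<gamma>) = curve_length \<sigma> \<gamma>"
proof -
  have vp: "valid_path \<gamma>" and int: "speed \<sigma> \<gamma> integrable_on {0..1}"
    using assms by (auto simp: connecting_curves_def)
  obtain S where S: "finite S" "\<gamma> C1_differentiable_on {0..1} - S"
    using vp by (auto simp: valid_path_def piecewise_C1_differentiable_on_def)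
  have rev: "speed \<sigma> (reversepath \<gamma>) x = speed \<sigma> \<gamma> (1 - x)"
    if x: "x \<in> {0..1} - (\<lambda>x. 1 - x) ` S" for x
  proof -
    have "1 - x \<in> {0..1} - S"
      using x by force
    then obtain D where D: "(\<gamma> has_vector_derivative D) (at (1 - x))"
      using S(2) by (metis C1_differentiable_on_def)
    have "(\<gamma> \<circ> (\<lambda>x. 1 - x) has_vector_derivative -1 *\<^sub>R D) (at x)"
      by (intro vector_diff_chain_within has_vector_derivative_at_within[OF D]
          derivative_eq_intros | simp)+
    then have "(reversepath \<gamma> has_vector_derivative -D) (at x)"
      by (simp add: reversepath_def o_def)
    then show ?thesis
      using D by (simp add: speed_def reversepath_def vector_derivative_at)
  qed
  have "((\<lambda>x. speed \<sigma> \<gamma> (1 - x)) has_integral curve_length \<sigma> \<gamma>) {0..1}"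
    using has_integral_affinity[of "speed \<sigma> \<gamma>" "curve_length \<sigma> \<gamma>" 0 1 "-1" 1] int
    by (simp add: curve_length_def has_integral_integral)
  then have "(speed \<sigma> (reversepath \<gamma>) has_integral curve_length \<sigma> \<gamma>) {0..1}"
    by (rule has_integral_spike_finite[rotated 2, where S = "(\<lambda>x. 1 - x) ` S"])
      (use S rev in auto)
  then show "reversepath \<gamma> \<in> connecting_curves \<sigma> w z"
    and "curve_length \<sigma> (reversepath \<gamma>) = curve_length \<sigma> \<gamma>"
    using assms by (auto simp: connecting_curves_def curve_length_def)
qed

lemma joinpaths_in_connecting_curves:
  assumes "\<gamma>1 \<in> connecting_curves \<sigma> x y" "\<gamma>2 \<in> connecting_curves \<sigma> y z"
  shows "\<gamma>1 +++ \<gamma>2 \<in> connecting_curves \<sigma> x z"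
    and "curve_length \<sigma> (\<gamma>1 +++ \<gamma>2) = curve_length \<sigma> \<gamma>1 + curve_length \<sigma> \<gamma>2"
proof -
  have vp: "valid_path \<gamma>1" "valid_path \<gamma>2"
    and int: "speed \<sigma> \<gamma>1 integrable_on {0..1}" "speed \<sigma> \<gamma>2 integrable_on {0..1}"
    and ends: "pathfinish \<gamma>1 = pathstart \<gamma>2"
    using assms by (auto simp: connecting_curves_def)
  obtain S1 S2 where S1: "finite S1" "\<gamma>1 C1_differentiable_on {0..1} - S1"
    and S2: "finite S2" "\<gamma>2 C1_differentiable_on {0..1} - S2"
    using vp by (auto simp: valid_path_def piecewise_C1_differentiable_on_def)
  have 1: "speed \<sigma> (\<gamma>1 +++ \<gamma>2) t = 2 * speed \<sigma> \<gamma>1 (2 * t)"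
    if t: "t \<in> {0..1/2} - insert (1/2) ((*) 2 -` S1)" for t
  proof -
    have "2 * t \<in> {0..1} - S1"
      using t by auto
    then obtain D where D: "(\<gamma>1 has_vector_derivative D) (at (2 * t))"
      using S1(2) by (metis C1_differentiable_on_def)
    have "(\<gamma>1 \<circ> (\<lambda>x. 2 * x) has_vector_derivative 2 *\<^sub>R D) (at t)"
      by (intro vector_diff_chain_within has_vector_derivative_at_within[OF D]
          derivative_eq_intros | simp)+
    then have "((\<gamma>1 +++ \<gamma>2) has_vector_derivative 2 *\<^sub>R D) (at t)"
      by (rule has_vector_derivative_transform_within_open[where S = "{..<1/2}"])
        (use t in \<open>auto simp: joinpaths_def\<close>)
    then show ?thesis
      using D t by (simp add: speed_def joinpaths_def vector_derivative_at)
  qed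
  have 2: "speed \<sigma> (\<gamma>1 +++ \<gamma>2) t = 2 * speed \<sigma> \<gamma>2 (2 * t - 1)"
    if t: "t \<in> {1/2..1} - insert (1/2) ((\<lambda>x. 2 * x - 1) -` S2)" for t
  proof -
    have "2 * t - 1 \<in> {0..1} - S2"
      using t by auto
    then obtain D where D: "(\<gamma>2 has_vector_derivative D) (at (2 * t - 1))"
      using S2(2) by (metis C1_differentiable_on_def)
    have "(\<gamma>2 \<circ> (\<lambda>x. 2 * x - 1) has_vector_derivative 2 *\<^sub>R D) (at t)"
      by (intro vector_diff_chain_within has_vector_derivative_at_within[OF D]
          derivative_eq_intros | simp)+
    then have "((\<gamma>1 +++ \<gamma>2) has_vector_derivative 2 *\<^sub>R D) (at t)"
      by (rule has_vector_derivative_transform_within_open[where S = "{1/2<..}"])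
        (use t in \<open>auto simp: joinpaths_def\<close>)
    then show ?thesis
      using D t by (simp add: speed_def joinpaths_def vector_derivative_at)
  qed
  have i1: "((\<lambda>t. 2 * speed \<sigma> \<gamma>1 (2 * t)) has_integral curve_length \<sigma> \<gamma>1) {0..1/2}"
    using has_integral_mult_right[where c = 2,
        OF has_integral_affinity[of "speed \<sigma> \<gamma>1" "curve_length \<sigma> \<gamma>1" 0 1 2 0]] int
    by (simp add: curve_length_def has_integral_integral image_affinity_atLeastAtMost_div)
  have img: "(\<lambda>x::real. x / 2 + 1 / 2) ` {0..1} = {1/2..1}"
    using image_affinity_atLeastAtMost[of "1/2" "1/2::real" 0 1] by simp
  have i2: "((\<lambda>t. 2 * speed \<sigma> \<gamma>2 (2 * t - 1)) has_integral curve_length \<sigma> \<gamma>2) {1/2..1}"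
    using has_integral_mult_right[where c = 2,
        OF has_integral_affinity[of "speed \<sigma> \<gamma>2" "curve_length \<sigma> \<gamma>2" 0 1 2 "-1"]] int
    by (simp add: curve_length_def has_integral_integral img)
  have "(speed \<sigma> (\<gamma>1 +++ \<gamma>2) has_integral curve_length \<sigma> \<gamma>1) {0..1/2}"
    by (rule has_integral_spike_finite[where S = "insert (1/2) ((*) 2 -` S1)", OF _ 1 i1])
      (use S1 in \<open>auto intro!: finite_vimageI inj_onI\<close>)
  moreover have "(speed \<sigma> (\<gamma>1 +++ \<gamma>2) has_integral curve_length \<sigma> \<gamma>2) {1/2..1}"
    by (rule has_integral_spike_finite[where S = "insert (1/2) ((\<lambda>x. 2 * x - 1) -` S2)", OF _ 2 i2])
      (use S2 in \<open>auto intro!: finite_vimageI inj_onI\<close>)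
  ultimately have "(speed \<sigma> (\<gamma>1 +++ \<gamma>2) has_integral
      curve_length \<sigma> \<gamma>1 + curve_length \<sigma> \<gamma>2) {0..1}"
    by (rule has_integral_combine[rotated 2]) auto
  then show "\<gamma>1 +++ \<gamma>2 \<in> connecting_curves \<sigma> x z"
    and "curve_length \<sigma> (\<gamma>1 +++ \<gamma>2) = curve_length \<sigma> \<gamma>1 + curve_length \<sigma> \<gamma>2"
    using assms by (auto simp: connecting_curves_def curve_length_def valid_path_join)
qed

lemma curve_length_lower_bound:
  assumes \<sigma>: "conformal_metric \<sigma>" and \<gamma>: "\<gamma> \<in> connecting_curves \<sigma> x y"
    and m: "0 < m" "\<And>z. z \<in> cball x (dist x y) \<Longrightarrow> m \<le> \<sigma> z"
  shows "sqrt m * dist x y \<le> curve_length \<sigma> \<gamma>"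
proof -
  define r where "r = dist x y"
  have ends: "\<gamma> 0 = x" "\<gamma> 1 = y" and int: "speed \<sigma> \<gamma> integrable_on {0..1}"
    and vp: "valid_path \<gamma>"
    using \<gamma> by (auto simp: connecting_curves_def pathstart_def pathfinish_def)
  obtain S where cont: "continuous_on {0..1} \<gamma>" and S: "finite S"
      "\<gamma> C1_differentiable_on {0..1} - S"
    using vp by (auto simp: valid_path_def piecewise_C1_differentiable_on_def)
  have contd: "continuous_on {0..1} (\<lambda>t. dist x (\<gamma> t))"
    by (intro continuous_intros cont)
  define T where "T = {t \<in> {0..1}. dist x (\<gamma> t) \<in> {r..}}"
  have "compact T"
    unfolding T_def
    using continuous_closed_preimage[OF contd closed_atLeastAtMost closed_atLeast, of r]
    by (auto simp: compact_eq_bounded_closed vimage_def Int_def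
        intro: bounded_subset[OF bounded_closed_interval])
  moreover have "1 \<in> T"
    by (simp add: T_def r_def ends)
  ultimately obtain u where u: "u \<in> T" "\<And>t. t \<in> T \<Longrightarrow> u \<le> t"
    using compact_attains_inf[of T] by blast
  have u01: "0 \<le> u" "u \<le> 1" "r \<le> dist x (\<gamma> u)"
    using u(1) by (auto simp: T_def)
  obtain v where v: "0 \<le> v" "v \<le> u" "dist x (\<gamma> v) = r"
    using IVT'[of "\<lambda>t. dist x (\<gamma> t)" 0 r u] u01 ends continuous_on_subset[OF contd]
    by (auto simp: r_def)
  have "v = u"
    using u(2)[of v] v u01 by (auto simp: T_def)
  have le: "dist x (\<gamma> t) \<le> r" if "t \<in> {0..u}" for t
  proof (rule ccontr)
    assume "\<not> dist x (\<gamma> t) \<le> r"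
    then have "t \<in> T"
      using that u01 by (auto simp: T_def)
    then have "t = u"
      using u(2)[of t] that by auto
    then show False
      using \<open>\<not> dist x (\<gamma> t) \<le> r\<close> v \<open>v = u\<close> by simp
  qed
  have "((\<lambda>t. vector_derivative \<gamma> (at t)) has_integral \<gamma> u - \<gamma> 0) {0..u}"
  proof (rule fundamental_theorem_of_calculus_interior_strong[OF S(1) u01(1)])
    show "(\<gamma> has_vector_derivative vector_derivative \<gamma> (at t)) (at t)"
      if "t \<in> {0<..<u} - S" for t
      using S(2) that u01
      by (auto simp: C1_differentiable_on_eq vector_derivative_works)
    show "continuous_on {0..u} \<gamma>"
      using cont u01 by (auto intro: continuous_on_subset)
  qed
  then have ftc: "((\<lambda>t. sqrt m *\<^sub>R vector_derivative \<gamma> (at t)) has_integral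
      sqrt m *\<^sub>R (\<gamma> u - x)) {0..u}"
    using has_integral_cmul ends by blast
  have intu: "speed \<sigma> \<gamma> integrable_on {0..u}"
    using int u01 by (auto intro: integrable_on_subinterval)
  have "norm (integral {0..u} (\<lambda>t. sqrt m *\<^sub>R vector_derivative \<gamma> (at t)))
      \<le> integral {0..u} (speed \<sigma> \<gamma>)"
  proof (rule integral_norm_bound_integral)
    show "norm (sqrt m *\<^sub>R vector_derivative \<gamma> (at t)) \<le> speed \<sigma> \<gamma> t"
      if "t \<in> {0..u}" for t
      using m le[OF that] by (simp add: speed_def r_def mult_right_mono)
  qed (use ftc intu in auto)
  also have "\<dots> \<le> curve_length \<sigma> \<gamma>"
    unfolding curve_length_def using u01 int intu
    by (intro integral_subset_le) (auto simp: speed_nonneg[OF \<sigma>])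
  finally show ?thesis
    using v \<open>v = u\<close> m(1)
    by (simp add: integral_unique[OF ftc] r_def dist_norm norm_minus_commute del: integral_cmul)
qed

lemma Metric_space_conformal_dist:
  assumes \<sigma>: "conformal_metric \<sigma>"
  shows "Metric_space UNIV (conformal_dist \<sigma>)"
proof
  fix x y z
  show nonneg: "0 \<le> conformal_dist \<sigma> x y" for x y
    unfolding conformal_dist_def
    by (intro cINF_greatest connecting_curves_nonempty \<sigma> curve_length_nonneg)
  have comm: "conformal_dist \<sigma> x y \<le> conformal_dist \<sigma> y x" for x y
    unfolding conformal_dist_def[of \<sigma> y x]
    by (intro cINF_greatest connecting_curves_nonempty \<sigma>)
      (metis \<sigma> conformal_dist_le reversepath_in_connecting_curves)
  then show "conformal_dist \<sigma> x y = conformal_dist \<sigma> y x"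
    by (simp add: antisym)
  show "conformal_dist \<sigma> x y = 0 \<longleftrightarrow> x = y"
  proof
    assume "x = y"
    have "curve_length \<sigma> (linepath x x) = 0"
      by (simp add: curve_length_def speed_def[abs_def])
    then show "conformal_dist \<sigma> x y = 0"
      using conformal_dist_le[OF \<sigma> linepath_in_connecting_curves[OF \<sigma>], of x x]
        nonneg[of x x] \<open>x = y\<close> by simp
  next
    assume 0: "conformal_dist \<sigma> x y = 0"
    obtain c where c: "\<And>z. z \<in> cball x (dist x y) \<Longrightarrow> \<sigma> c \<le> \<sigma> z"
      using continuous_attains_inf[of "cball x (dist x y)" \<sigma>]
        conformal_metric_continuous[OF \<sigma>]
      by (metis centre_in_cball compact_cball empty_iff zero_le_dist)
    have "sqrt (\<sigma> c) * dist x y \<le> conformal_dist \<sigma> x y"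
      unfolding conformal_dist_def
      by (intro cINF_greatest connecting_curves_nonempty \<sigma>
          curve_length_lower_bound conformal_metric_pos c)
    then show "x = y"
      using 0 conformal_metric_pos[OF \<sigma>, of c] by (simp add: mult_le_0_iff)
  qed
  have "conformal_dist \<sigma> x z - conformal_dist \<sigma> x y \<le> conformal_dist \<sigma> y z"
    unfolding conformal_dist_def[of \<sigma> y z]
  proof (intro cINF_greatest connecting_curves_nonempty \<sigma>)
    fix \<gamma>2 assume 2: "\<gamma>2 \<in> connecting_curves \<sigma> y z"
    have "conformal_dist \<sigma> x z - curve_length \<sigma> \<gamma>2 \<le> conformal_dist \<sigma> x y"
      unfolding conformal_dist_def[of \<sigma> x y]
    proof (intro cINF_greatest connecting_curves_nonempty \<sigma>)
      fix \<gamma>1 assume 1: "\<gamma>1 \<in> connecting_curves \<sigma> x y"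
      show "conformal_dist \<sigma> x z - curve_length \<sigma> \<gamma>2 \<le> curve_length \<sigma> \<gamma>1"
        using conformal_dist_le[OF \<sigma> joinpaths_in_connecting_curves(1)[OF 1 2]]
          joinpaths_in_connecting_curves(2)[OF 1 2] by simp
    qed
    then show "conformal_dist \<sigma> x z - conformal_dist \<sigma> x y \<le> curve_length \<sigma> \<gamma>2"
      by simp
  qed
  then show "conformal_dist \<sigma> x z \<le> conformal_dist \<sigma> x y + conformal_dist \<sigma> y z"
    by simp
qed

end

theory Submission
  imports Defs "HOL-Computational_Algebra.Fundamental_Theorem_Algebra"
begin

text \<open>
  Writing \<open>\<sigma> = exp u\<close>, the curvature equation becomes the vortex equation
  \<open>\<Delta>u = 2 exp u - 2 |\<phi>|\<^sup>2 exp (-(k - 1) u)\<close>, whose right-hand side \<open>F(u)\<close> increases in \<open>u\<close>.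
  Nonpositive curvature means \<open>|\<phi>|\<^sup>2 \<le> exp (k u)\<close>, which bounds \<open>u\<close> from below because \<open>\<phi>\<close> is a
  nonzero polynomial. This lower bound makes \<open>\<sigma>\<close> complete, and it turns the difference \<open>w\<close> of two solutions
  into a function with \<open>\<Delta>w \<ge> c w\<^sup>2\<close> wherever \<open>w > 0\<close>, so that \<open>w \<le> 0\<close> by the Keller-Osserman barrier
  \<open>A / (R\<^sup>2 - |z|\<^sup>2)\<^sup>2\<close>.

  For existence, \<open>|\<phi>|\<^sup>2\<close> is first replaced by a bounded function \<open>a\<close>. An identity
  \<open>u = \<eta> * u + K * (\<lambda>u - \<Delta>u)\<close> with compactly supported nonnegative kernels then turns the equation into
  a monotone contraction \<open>u \<mapsto> \<eta> * u + K * (\<lambda>u - F(u))\<close>; along its iterates the residual \<open>\<Delta>u - F(u)\<close>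
  decays geometrically. Letting \<open>a\<close> increase to \<open>|\<phi>|\<^sup>2\<close> gives an increasing sequence of solutions,
  locally bounded above by Keller-Osserman. The same identity at all scales passes to pointwise limits
  and gains one derivative at a time, so limits are smooth solutions.
\<close>

section \<open>Directional derivatives and the Laplacian\<close>

text \<open>The obstacle is regularity: solutions arise as pointwise limits, with nothing known in
  advance about the derivatives of the limit. The identity replaces a Green function. Integrating
  the t-derivative of \<open>g (z + T t w)\<close> against \<open>1 - t^2\<close> over
  \<open>[0,1]\<close> gives \<open>- g z\<close> plus an average of \<open>g\<close> with weight
  \<open>2 t\<close>. Averaging over \<open>w\<close> against \<open>eta\<close>, and using that the
  gradient of \<open>theta\<close> is \<open>- w eta\<close>, an integration by parts in
  \<open>w\<close> turns the radial derivative into \<open>lap g\<close>. In the variable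
  \<open>t w\<close> both kernels have a logarithmic singularity at 0, but over pairs
  \<open>(t, w)\<close> every integrand is continuous on a compact box. A derivative moved onto a
  kernel costs a factor \<open>1 / (T t)\<close>; the weights \<open>2 t\<close> and
  \<open>t (1 - t^2)\<close> pay for exactly one, hence one derivative is gained at a time. The
  scale \<open>T\<close> is kept free for two reasons: \<open>T^2 * lam = 12\<close> makes the
  iteration monotone, and a small \<open>T\<close> recovers the Laplacian of a limit from its
  averages. The square in the Keller-Osserman inequality is the quadratic Taylor term of the
  exponential; the lower bound on one solution keeps its coefficient away from 0.\<close>

abbreviation "tcd \<equiv> times_continuously_differentiable"

definition dird :: "complex \<Rightarrow> (complex \<Rightarrow> real) \<Rightarrow> complex \<Rightarrow> real"
  where "dird v f z = frechet_derivative f (at z) v"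

definition lap :: "(complex \<Rightarrow> real) \<Rightarrow> complex \<Rightarrow> real"
  where "lap f z = dird 1 (dird 1 f) z + dird \<i> (dird \<i> f) z"

lemma tcd_Suc:
  "tcd (Suc n) f \<longleftrightarrow> (\<forall>z. f differentiable (at z)) \<and> (\<forall>v. tcd n (dird v f))"
  by (simp add: dird_def[abs_def])

declare times_continuously_differentiable.simps(2) [simp del]

text \<open>Continuity is demanded only at level 0 of the recursion. It comes there from
  differentiability, and the induction carries the inclusion up through the directional
  derivatives.\<close>

lemma tcd_Suc_imp: "tcd (Suc n) f \<Longrightarrow> tcd n f" for f :: "complex \<Rightarrow> real"
proof (induction n arbitrary: f)
  case 0
  then show ?case
    by (auto simp: tcd_Suc intro!: differentiable_imp_continuous_on simp: differentiable_on_def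
        intro: differentiable_at_withinI)
next
  case (Suc n)
  then show ?case by (meson tcd_Suc)
qed

lemma tcd_le: "tcd n f \<Longrightarrow> m \<le> n \<Longrightarrow> tcd m f" for f :: "complex \<Rightarrow> real"
  by (induction n) (auto simp: le_Suc_eq dest: tcd_Suc_imp)

lemma smooth_tcd: "smooth f \<Longrightarrow> tcd n f"
  by (simp add: smooth_def)

lemma smoothI: "(\<And>n. tcd n f) \<Longrightarrow> smooth f"
  by (simp add: smooth_def)

lemma tcd_differentiable: "tcd (Suc n) f \<Longrightarrow> f differentiable (at z)" for f :: "complex \<Rightarrow> real"
  by (simp add: tcd_Suc)

lemma tcd_dird: "tcd (Suc n) f \<Longrightarrow> tcd n (dird v f)"
  by (simp add: tcd_Suc)

lemma tcd_continuous: "tcd n f \<Longrightarrow> continuous_on S f" for f :: "complex \<Rightarrow> real"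
  using tcd_le[of n f 0] by (auto intro: continuous_on_subset)

lemma smooth_dird: "smooth f \<Longrightarrow> smooth (dird v f)"
  by (meson smooth_def tcd_dird)

lemma smooth_differentiable: "smooth f \<Longrightarrow> f differentiable (at z)" for f :: "complex \<Rightarrow> real"
  by (meson smooth_def tcd_differentiable)

lemma smooth_continuous: "smooth f \<Longrightarrow> continuous_on S f" for f :: "complex \<Rightarrow> real"
  by (meson smooth_def tcd_continuous)

lemma has_derivative_dird:
  "f differentiable (at z) \<Longrightarrow> (f has_derivative (\<lambda>h. dird h f z)) (at z)"
  unfolding dird_def by (simp add: frechet_derivative_works)

lemma dird_eq: "(f has_derivative f') (at z) \<Longrightarrow> dird v f z = f' v"
  unfolding dird_def by (metis frechet_derivative_at)

lemma dird_linear: "f differentiable (at z) \<Longrightarrow> dird h f z = Re h * dird 1 f z + Im h * dird \<i> f z"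
proof -
  assume "f differentiable (at z)"
  then interpret linear "\<lambda>h. dird h f z"
    using has_derivative_dird has_derivative_linear by blast
  have "dird (Re h *\<^sub>R 1 + Im h *\<^sub>R \<i>) f z = Re h * dird 1 f z + Im h * dird \<i> f z"
    by (simp only: add scaleR real_scaleR_def)
  moreover have "Re h *\<^sub>R 1 + Im h *\<^sub>R \<i> = h"
    by (simp add: complex_eq_iff)
  ultimately show ?thesis by simp
qed

text \<open>Restriction to lines brings in the one-variable tools: the mean value theorem, the
  fundamental theorem and differentiation under the integral.\<close>

lemma line_derivative:
  fixes f :: "complex \<Rightarrow> real"
  assumes "f differentiable (at (z + t *\<^sub>R v))"
  shows "((\<lambda>t. f (z + t *\<^sub>R v)) has_real_derivative dird v f (z + t *\<^sub>R v)) (at t within S)"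
proof -
  let ?x = "z + t *\<^sub>R v"
  have "((\<lambda>t. f (z + t *\<^sub>R v)) has_derivative (\<lambda>s. dird (s *\<^sub>R v) f ?x)) (at t)"
    by (rule has_derivative_compose[where f = "\<lambda>t. z + t *\<^sub>R v" and g = f, OF _ has_derivative_dird[OF assms]])
      (auto intro!: derivative_eq_intros)
  moreover have "dird (s *\<^sub>R v) f ?x = dird v f ?x * s" for s
    using dird_linear[OF assms, of "s *\<^sub>R v"] dird_linear[OF assms, of v]
    by (simp add: algebra_simps)
  ultimately show ?thesis
    by (simp add: has_field_derivative_def has_derivative_at_withinI mult_commute_abs)
qed

lemma dird_const [simp]: "dird v (\<lambda>_. c) = (\<lambda>_. 0)"
  by (rule ext, rule dird_eq[OF has_derivative_const])

lemma tcd_const [simp]: "tcd n (\<lambda>_ :: complex. c :: real)"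
  by (induction n arbitrary: c) (auto simp: tcd_Suc)

lemma dird_add:
  "f differentiable (at z) \<Longrightarrow> g differentiable (at z) \<Longrightarrow>
    dird v (\<lambda>z. f z + g z) z = dird v f z + dird v g z"
  by (rule dird_eq) (intro derivative_intros has_derivative_dird)

lemma dird_mult:
  "f differentiable (at z) \<Longrightarrow> g differentiable (at z) \<Longrightarrow>
    dird v (\<lambda>z. f z * g z) z = f z * dird v g z + dird v f z * g z"
  by (rule dird_eq) (intro derivative_intros has_derivative_dird)

lemma dird_cmult:
  "f differentiable (at z) \<Longrightarrow> dird v (\<lambda>z. c * f z) z = c * dird v f z"
  by (rule dird_eq) (intro derivative_intros has_derivative_dird)

lemma dird_diff:
  "f differentiable (at z) \<Longrightarrow> g differentiable (at z) \<Longrightarrow>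
    dird v (\<lambda>z. f z - g z) z = dird v f z - dird v g z"
  by (rule dird_eq) (intro derivative_intros has_derivative_dird)

lemma dird_real_compose:
  assumes "f differentiable (at z)" "(h has_real_derivative h') (at (f z))"
  shows "dird v (\<lambda>z. h (f z)) z = h' * dird v f z"
    and "(\<lambda>z. h (f z)) differentiable (at z)"
proof -
  have "((\<lambda>z. h (f z)) has_derivative (\<lambda>v. h' * dird v f z)) (at z)"
    using has_derivative_compose[OF has_derivative_dird[OF assms(1)]
        assms(2)[unfolded has_field_derivative_def]] .
  then show "dird v (\<lambda>z. h (f z)) z = h' * dird v f z"
    and "(\<lambda>z. h (f z)) differentiable (at z)"
    by (auto simp: dird_eq differentiable_def)
qed

lemma tcd_add: "tcd n f \<Longrightarrow> tcd n g \<Longrightarrow> tcd n (\<lambda>z. f z + g z)" for f g :: "complex \<Rightarrow> real"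
proof (induction n arbitrary: f g)
  case 0 then show ?case by (auto intro!: continuous_intros)
next
  case (Suc n)
  then have "dird v (\<lambda>z. f z + g z) = (\<lambda>z. dird v f z + dird v g z)" for v
    by (auto simp: tcd_Suc dird_add)
  with Suc show ?case by (auto simp: tcd_Suc)
qed

lemma tcd_mult: "tcd n f \<Longrightarrow> tcd n g \<Longrightarrow> tcd n (\<lambda>z. f z * g z)" for f g :: "complex \<Rightarrow> real"
proof (induction n arbitrary: f g)
  case 0 then show ?case by (auto intro!: continuous_intros)
next
  case (Suc n)
  have "tcd n f" "tcd n g" using Suc.prems tcd_Suc_imp by auto
  moreover have "dird v (\<lambda>z. f z * g z) = (\<lambda>z. f z * dird v g z + dird v f z * g z)" for v
    using Suc.prems by (auto simp: tcd_Suc dird_mult)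
  ultimately show ?case using Suc
    by (auto simp: tcd_Suc intro!: tcd_add)
qed

lemma tcd_diff: "tcd n f \<Longrightarrow> tcd n g \<Longrightarrow> tcd n (\<lambda>z. f z - g z)" for f g :: "complex \<Rightarrow> real"
  using tcd_add[of n f "\<lambda>z. (-1) * g z"] tcd_mult[of n "\<lambda>_. -1" g] by simp

lemma tcd_minus: "tcd n f \<Longrightarrow> tcd n (\<lambda>z. - f z)" for f :: "complex \<Rightarrow> real"
  using tcd_mult[of n "\<lambda>_. -1" f] by simp

lemma tcd_power: "tcd n f \<Longrightarrow> tcd n (\<lambda>z. f z ^ k)" for f :: "complex \<Rightarrow> real"
  by (induction k) (auto intro: tcd_mult)

lemma tcd_exp: "tcd n f \<Longrightarrow> tcd n (\<lambda>z. exp (f z))" for f :: "complex \<Rightarrow> real"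
proof (induction n arbitrary: f)
  case 0 then show ?case by (auto intro!: continuous_intros)
next
  case (Suc n)
  have d: "f differentiable (at z)" for z using Suc.prems tcd_Suc by blast
  have "dird v (\<lambda>z. exp (f z)) = (\<lambda>z. exp (f z) * dird v f z)" for v
    by (rule ext, rule dird_real_compose[OF d]) (auto intro: derivative_eq_intros)
  moreover have "(\<lambda>z. exp (f z)) differentiable (at z)" for z
    by (rule dird_real_compose[OF d]) (rule DERIV_exp)
  ultimately show ?case
    using Suc by (auto simp: tcd_Suc intro!: tcd_mult Suc.IH tcd_Suc_imp[of n f])
qed

lemma tcd_inverse:
  "(\<And>z. f z \<noteq> 0) \<Longrightarrow> tcd n f \<Longrightarrow> tcd n (\<lambda>z. inverse (f z))" for f :: "complex \<Rightarrow> real"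
proof (induction n)
  case 0 then show ?case by (auto intro!: continuous_intros)
next
  case (Suc n)
  have d: "f differentiable (at z)" for z using Suc.prems tcd_Suc by blast
  have der: "(inverse has_real_derivative - (inverse (f z) * inverse (f z))) (at (f z))" for z
    using DERIV_inverse[OF Suc.prems(1)[of z]] by (simp add: power2_eq_square)
  have "dird v (\<lambda>z. inverse (f z)) = (\<lambda>z. - (inverse (f z) * inverse (f z)) * dird v f z)" for v
    by (rule ext, rule dird_real_compose(1)[OF d der])
  moreover have "(\<lambda>z. inverse (f z)) differentiable (at z)" for z
    by (rule dird_real_compose(2)[OF d der])
  ultimately show ?case
    using Suc.prems Suc.IH[OF Suc.prems(1) tcd_Suc_imp[OF Suc.prems(2)]]
    by (auto simp: tcd_Suc intro!: tcd_mult tcd_minus)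
qed

lemma tcd_ln:
  fixes f :: "complex \<Rightarrow> real"
  assumes "\<And>z. f z > 0" "tcd n f"
  shows "tcd n (\<lambda>z. ln (f z))"
proof (cases n)
  case 0
  have "f z \<noteq> 0" for z using assms(1)[of z] by simp
  then show ?thesis using assms 0 by (auto intro!: continuous_on_ln)
next
  case (Suc n)
  have d: "f differentiable (at z)" for z using assms Suc tcd_Suc by blast
  have der: "(ln has_real_derivative inverse (f z)) (at (f z))" for z
    using DERIV_ln[of "f z"] assms by (simp add: inverse_eq_divide)
  have "dird v (\<lambda>z. ln (f z)) = (\<lambda>z. inverse (f z) * dird v f z)" for v
    by (rule ext, rule dird_real_compose(1)[OF d der])
  moreover have "(\<lambda>z. ln (f z)) differentiable (at z)" for z
    by (rule dird_real_compose(2)[OF d der])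
  moreover have "f z \<noteq> 0" for z using assms(1)[of z] by simp
  ultimately show ?thesis
    using assms Suc by (auto simp: tcd_Suc intro!: tcd_mult tcd_inverse tcd_Suc_imp[of n f])
qed

lemmas tcd_intros = tcd_const tcd_add tcd_mult tcd_diff tcd_minus tcd_power tcd_exp

section \<open>Real and imaginary parts of complex polynomials\<close>

lemma dird_poly:
  "((\<lambda>z. Re (poly p z)) has_derivative (\<lambda>v. Re (v * poly (pderiv p) z))) (at z)"
  "((\<lambda>z. Im (poly p z)) has_derivative (\<lambda>v. Im (v * poly (pderiv p) z))) (at z)"
proof -
  have "(poly p has_derivative (\<lambda>v. v * poly (pderiv p) z)) (at z)"
    using poly_DERIV[of p z] by (simp add: has_field_derivative_def mult_commute_abs)
  then show "((\<lambda>z. Re (poly p z)) has_derivative (\<lambda>v. Re (v * poly (pderiv p) z))) (at z)"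
    "((\<lambda>z. Im (poly p z)) has_derivative (\<lambda>v. Im (v * poly (pderiv p) z))) (at z)"
    by (rule has_derivative_Re has_derivative_Im)+
qed

text \<open>The direction \<open>v\<close> is absorbed into the polynomial by \<open>smult\<close>,
  so the class is closed under \<open>dird\<close>. Smoothness follows by induction, and harmonicity
  later from \<open>\<i>\<close> squared being -1.\<close>

lemma dird_Re_poly: "dird v (\<lambda>z. Re (poly p z)) = (\<lambda>z. Re (poly (smult v (pderiv p)) z))"
  and dird_Im_poly: "dird v (\<lambda>z. Im (poly p z)) = (\<lambda>z. Im (poly (smult v (pderiv p)) z))"
  by (auto simp: fun_eq_iff dird_eq[OF dird_poly(1)] dird_eq[OF dird_poly(2)])

lemma tcd_poly: "tcd n (\<lambda>z. Re (poly p z))" "tcd n (\<lambda>z. Im (poly p z))"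
proof (induction n arbitrary: p)
  case 0
  { case 1 show ?case by (auto intro!: continuous_intros) }
  { case 2 show ?case by (auto intro!: continuous_intros) }
next
  case (Suc n)
  { case 1 show ?case using Suc dird_poly(1) unfolding tcd_Suc dird_Re_poly differentiable_def by blast }
  { case 2 show ?case using Suc dird_poly(2) unfolding tcd_Suc dird_Im_poly differentiable_def by blast }
qed

lemma tcd_cmod_poly: "tcd n (\<lambda>z. (cmod (poly p z))\<^sup>2)"
  unfolding cmod_power2 by (intro tcd_intros tcd_poly)

section \<open>The Laplacian\<close>

lemma lap_smooth: "smooth f \<Longrightarrow> smooth (lap f)"
  unfolding lap_def[abs_def] by (rule smoothI) (intro tcd_add smooth_tcd smooth_dird)

lemma lap_continuous:
  assumes "tcd 2 f" shows "continuous_on S (lap f)"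
proof -
  have "tcd (Suc (Suc 0)) f" using assms by (simp add: numeral_2_eq_2)
  then have "tcd 0 (dird v (dird v f))" for v by (blast intro: tcd_dird)
  then have "tcd 0 (lap f)" unfolding lap_def[abs_def] by (intro tcd_add)
  then show ?thesis by (rule tcd_continuous)
qed

lemma lap_add:
  assumes "tcd 2 f" "tcd 2 g" shows "lap (\<lambda>z. f z + g z) z = lap f z + lap g z"
proof -
  have t: "tcd (Suc (Suc 0)) f" "tcd (Suc (Suc 0)) g" using assms by (simp_all add: numeral_2_eq_2)
  have "dird v (\<lambda>z. f z + g z) = (\<lambda>z. dird v f z + dird v g z)" for v
    using t by (auto simp: dird_add tcd_differentiable)
  then show ?thesis unfolding lap_def
    by (simp add: dird_add tcd_differentiable[OF tcd_dird[OF t(1)]] tcd_differentiable[OF tcd_dird[OF t(2)]])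
qed

lemma lap_cmult:
  assumes "tcd 2 f" shows "lap (\<lambda>z. c * f z) z = c * lap f z"
proof -
  have t: "tcd (Suc (Suc 0)) f" using assms by (simp_all add: numeral_2_eq_2)
  have "dird v (\<lambda>z. c * f z) = (\<lambda>z. c * dird v f z)" for v
    using t by (auto simp: dird_cmult tcd_differentiable)
  then show ?thesis unfolding lap_def
    by (simp add: dird_cmult tcd_differentiable[OF tcd_dird[OF t]] algebra_simps)
qed

lemma lap_diff:
  assumes "tcd 2 f" "tcd 2 g" shows "lap (\<lambda>z. f z - g z) z = lap f z - lap g z"
  using lap_add[OF assms(1) tcd_mult[OF tcd_const assms(2)], of "-1"] lap_cmult[OF assms(2), of "-1"]
  by simp

lemma lap_const [simp]: "lap (\<lambda>_. c) = (\<lambda>_. 0)"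
  by (simp add: lap_def fun_eq_iff)

text \<open>Expanding the two Wirtinger operators, the pure second derivatives form the real part
  and the mixed ones only the imaginary part.\<close>

lemma Re_laplacian:
  assumes "tcd 2 u"
  shows "Re (laplacian (\<lambda>w. complex_of_real (u w)) z) = lap u z"
proof -
  have t: "tcd (Suc (Suc 0)) u" using assms by (simp add: numeral_2_eq_2)
  have fr: "frechet_derivative (\<lambda>w. complex_of_real (u w)) (at z) v = complex_of_real (dird v u z)" for z v
    using fun_cong[OF frechet_derivative_at[OF has_derivative_of_real[OF
        has_derivative_dird[OF tcd_differentiable[OF t]]]], symmetric] .
  have 1: "wirtinger_zbar (\<lambda>w. complex_of_real (u w)) =
      (\<lambda>z. (complex_of_real (dird 1 u z) + \<i> * complex_of_real (dird \<i> u z)) / 2)"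
    by (simp add: wirtinger_zbar_def fr fun_eq_iff)
  have 2: "((\<lambda>z. (complex_of_real (dird 1 u z) + \<i> * complex_of_real (dird \<i> u z)) / 2)
     has_derivative (\<lambda>v. (complex_of_real (dird v (dird 1 u) z)
         + \<i> * complex_of_real (dird v (dird \<i> u) z)) / 2)) (at z)"
    by (auto intro!: derivative_eq_intros has_derivative_dird tcd_differentiable[OF tcd_dird[OF t]])
  have "frechet_derivative (wirtinger_zbar (\<lambda>w. complex_of_real (u w))) (at z) =
      (\<lambda>v. (complex_of_real (dird v (dird 1 u) z)
         + \<i> * complex_of_real (dird v (dird \<i> u) z)) / 2)"
    unfolding 1 by (rule frechet_derivative_at[OF 2, symmetric])
  then show ?thesis
    by (simp add: laplacian_def wirtinger_z_def lap_def)
qed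

text \<open>The mean value theorem on the segment from \<open>z\<close> to \<open>y\<close> gives
  the increment as \<open>G h\<close> at an intermediate point; continuity of the two coefficients
  makes the error small relative to \<open>norm h\<close>. Derivatives of averages and of limits are
  computed along lines only, and this turns them into Frechet derivatives.\<close>

lemma has_derivative_from_line:
  fixes u :: "complex \<Rightarrow> real"
  assumes line: "\<And>h t. ((\<lambda>t. u (z + t *\<^sub>R h)) has_real_derivative G h (z + t *\<^sub>R h)) (at t)"
    and lin: "\<And>h x. G h x = Re h * G 1 x + Im h * G \<i> x"
    and cont: "continuous_on UNIV (G 1)" "continuous_on UNIV (G \<i>)"
  shows "(u has_derivative (\<lambda>h. G h z)) (at z)"
  unfolding has_derivative_at_alt
proof (intro conjI allI impI)
  have "(\<lambda>h. G h z) = (\<lambda>h. Re h * G 1 z + Im h * G \<i> z)"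
    by (rule ext, rule lin)
  then show "bounded_linear (\<lambda>h. G h z)"
    by (rule ssubst) (rule bounded_linear_add[OF bounded_linear_mult_const[OF bounded_linear_Re, of "G 1 z"]
       bounded_linear_mult_const[OF bounded_linear_Im, of "G \<i> z"]])
  fix e :: real assume "e > 0"
  obtain d1 where d1: "d1 > 0" "\<And>x. dist x z < d1 \<Longrightarrow> dist (G 1 x) (G 1 z) < e/2"
    using cont(1) \<open>e > 0\<close> unfolding continuous_on_iff by (metis UNIV_I half_gt_zero)
  obtain d2 where d2: "d2 > 0" "\<And>x. dist x z < d2 \<Longrightarrow> dist (G \<i> x) (G \<i> z) < e/2"
    using cont(2) \<open>e > 0\<close> unfolding continuous_on_iff by (metis UNIV_I half_gt_zero)
  show "\<exists>d>0. \<forall>y. norm (y - z) < d \<longrightarrow> norm (u y - u z - G (y - z) z) \<le> e * norm (y - z)"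
  proof (intro exI[of _ "min d1 d2"] conjI allI impI)
    fix y assume y: "norm (y - z) < min d1 d2"
    define h where "h = y - z"
    obtain t where t: "0 < t" "t < 1" "u (z + 1 *\<^sub>R h) - u (z + 0 *\<^sub>R h) = (1 - 0) * G h (z + t *\<^sub>R h)"
      using MVT2[of 0 1 "\<lambda>t. u (z + t *\<^sub>R h)" "\<lambda>t. G h (z + t *\<^sub>R h)", OF zero_less_one line] by blast
    let ?x = "z + t *\<^sub>R h"
    have "dist ?x z = t * norm h" using t by (simp add: dist_norm)
    also have "\<dots> \<le> norm h" using t by (simp add: mult_left_le_one_le)
    finally have "dist ?x z < d1" "dist ?x z < d2" using y by (auto simp: h_def)
    then have b: "\<bar>G 1 ?x - G 1 z\<bar> < e/2" "\<bar>G \<i> ?x - G \<i> z\<bar> < e/2"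
      using d1 d2 by (auto simp: dist_real_def)
    have "u y - u z - G (y - z) z = G h ?x - G h z" using t(3) by (simp add: h_def)
    also have "\<dots> = Re h * (G 1 ?x - G 1 z) + Im h * (G \<i> ?x - G \<i> z)"
      unfolding lin[of h] by (simp add: algebra_simps)
    finally have "norm (u y - u z - G (y - z) z) \<le> \<bar>Re h\<bar> * \<bar>G 1 ?x - G 1 z\<bar> + \<bar>Im h\<bar> * \<bar>G \<i> ?x - G \<i> z\<bar>"
      by (simp add: abs_mult[symmetric])
    also have "\<dots> \<le> norm h * (e/2) + norm h * (e/2)"
      using b abs_Re_le_cmod[of h] abs_Im_le_cmod[of h] \<open>e > 0\<close> by (intro add_mono mult_mono) auto
    finally show "norm (u y - u z - G (y - z) z) \<le> e * norm (y - z)" by (simp add: h_def)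
  qed (use d1 d2 in auto)
qed

section \<open>Averaging operators\<close>

text \<open>Exponent at least 2 smooths the corner at 0: there the difference quotient is at most
  \<open>\<bar>h\<bar> ^ Suc n\<close>.\<close>

lemma max_power_derivative:
  "((\<lambda>x::real. max 0 x ^ Suc (Suc n)) has_real_derivative real (Suc (Suc n)) * max 0 x ^ Suc n) (at x)"
proof -
  consider "x > 0" | "x < 0" | "x = 0" by linarith
  then show ?thesis
  proof cases
    case 1
    have "((\<lambda>x::real. x ^ Suc (Suc n)) has_real_derivative real (Suc (Suc n)) * x ^ Suc n) (at x)"
      by (rule DERIV_pow[THEN DERIV_cong]) simp
    then have "((\<lambda>x::real. max 0 x ^ Suc (Suc n)) has_real_derivative real (Suc (Suc n)) * x ^ Suc n) (at x)"
      by (rule has_field_derivative_transform_within_open[of _ _ _ "{0<..}"]) (use 1 in auto)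
    with 1 show ?thesis by (simp add: max_def)
  next
    case 2
    have "((\<lambda>x::real. max 0 x ^ Suc (Suc n)) has_real_derivative 0) (at x)"
      by (rule has_field_derivative_transform_within_open[of "\<lambda>_. 0" _ _ "{..<0}"]) (use 2 in \<open>auto simp: max_def\<close>)
    with 2 show ?thesis by (simp add: max_def)
  next
    case 3
    have "(\<lambda>h::real. (max 0 (0 + h) ^ Suc (Suc n) - max 0 0 ^ Suc (Suc n)) / h) \<midarrow>0\<rightarrow> 0"
    proof (rule Lim_null_comparison)
      show "\<forall>\<^sub>F h::real in at 0. norm ((max 0 (0 + h) ^ Suc (Suc n) - max 0 0 ^ Suc (Suc n)) / h) \<le> \<bar>h\<bar> ^ Suc n"
        by (rule always_eventually) (auto simp: max_def abs_mult power_abs intro: mult_nonpos_nonneg)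
      have "(\<lambda>h::real. \<bar>h\<bar> ^ Suc n) \<midarrow>0\<rightarrow> \<bar>0\<bar> ^ Suc n" by (intro tendsto_intros)
      then show "(\<lambda>h::real. \<bar>h\<bar> ^ Suc n) \<midarrow>0\<rightarrow> 0" by simp
    qed
    with 3 show ?thesis by (simp add: DERIV_def)
  qed
qed

text \<open>Powers of one truncated paraboloid are used because the gradient of
  \<open>bump (n+1)\<close> is \<open>- 2 (n+1) w\<close> times \<open>bump n\<close> for
  \<open>n\<close> at least 1, which links the kernels \<open>theta\<close> and
  \<open>eta\<close>.\<close>

definition bump :: "nat \<Rightarrow> complex \<Rightarrow> real"
  where "bump n w = max 0 (1 - (cmod w)\<^sup>2) ^ n"

text \<open>The unit disc carrying the bumps is enclosed in a square, so that all integrals run over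
  closed boxes.\<close>

abbreviation unit_box :: "complex set" where "unit_box \<equiv> cbox (- 1 - \<i>) (1 + \<i>)"
abbreviation prism :: "(real \<times> complex) set" where "prism \<equiv> cbox (0, - 1 - \<i>) (1, 1 + \<i>)"

lemma bump_continuous: "continuous_on S (bump n)"
  unfolding bump_def[abs_def] by (intro continuous_intros)

lemma bump_nonneg: "0 \<le> bump n w"
  by (simp add: bump_def)

lemma bump_outside: "w \<notin> unit_box \<Longrightarrow> bump (Suc n) w = 0"
proof -
  assume "w \<notin> unit_box"
  then have "\<bar>Re w\<bar> > 1 \<or> \<bar>Im w\<bar> > 1" by (auto simp: in_cbox_complex_iff)
  then have "cmod w \<ge> 1" using abs_Re_le_cmod[of w] abs_Im_le_cmod[of w] by linarith
  then have "(cmod w)\<^sup>2 \<ge> 1" by simp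
  then show ?thesis by (simp add: bump_def)
qed

lemma bump_line:
  "((\<lambda>t. bump (Suc (Suc n)) (w + t *\<^sub>R v)) has_real_derivative
     - (2 * real (Suc (Suc n))) * ((w + t *\<^sub>R v) \<bullet> v) * bump (Suc n) (w + t *\<^sub>R v)) (at t)"
proof -
  have "((\<lambda>t. 1 - (cmod (w + t *\<^sub>R v))\<^sup>2) has_real_derivative - (2 * ((w + t *\<^sub>R v) \<bullet> v))) (at t)"
    unfolding cmod_power2
    by (auto intro!: derivative_eq_intros simp: inner_complex_def algebra_simps power2_eq_square)
  from DERIV_chain2[OF max_power_derivative this] show ?thesis
    unfolding bump_def by (rule DERIV_cong) (simp add: algebra_simps)
qed

text \<open>The integral of a compactly supported function is unchanged by translation;
  differentiating the translated integral at \<open>s = 0\<close> gives the claim.\<close>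

lemma integral_line_derivative_eq_0:
  fixes G G' :: "complex \<Rightarrow> real"
  assumes line: "\<And>w t. ((\<lambda>t. G (w + t *\<^sub>R v)) has_real_derivative G' (w + t *\<^sub>R v)) (at t)"
    and cont: "continuous_on UNIV G" "continuous_on UNIV G'"
    and zero: "\<And>w. w \<notin> unit_box \<Longrightarrow> G w = 0" and v: "norm v \<le> 1"
  shows "integral unit_box G' = 0"
proof -
  \<comment> \<open>Shifts by \<open>s *\<^sub>R v\<close> with \<open>\<bar>s\<bar> < 1\<close>
    move the unit box inside this doubled box, so the integral over it is constant in
    \<open>s\<close>.\<close>
  let ?big = "cbox (- 2 - 2 * \<i>) (2 + 2 * \<i>)"
  have J: "integral ?big (\<lambda>w. G (w + s *\<^sub>R v)) = integral unit_box G" if s: "s \<in> {-1<..<1}" for s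
  proof -
    have "(G has_integral integral unit_box G) unit_box"
      using cont(1) by (meson continuous_on_subset integrable_continuous integrable_integral subset_UNIV)
    from has_integral_affinity[OF this, of 1 "s *\<^sub>R v"]
    have *: "((\<lambda>x. G (x + s *\<^sub>R v)) has_integral integral unit_box G) ((\<lambda>x. x - s *\<^sub>R v) ` unit_box)"
      by simp
    have "\<bar>s\<bar> * cmod v \<le> 1 * 1" using s v by (intro mult_mono) auto
    then have sv: "\<bar>Re (s *\<^sub>R v)\<bar> \<le> 1" "\<bar>Im (s *\<^sub>R v)\<bar> \<le> 1"
      using abs_Re_le_cmod[of "s *\<^sub>R v"] abs_Im_le_cmod[of "s *\<^sub>R v"] by auto
    have "((\<lambda>x. G (x + s *\<^sub>R v)) has_integral integral unit_box G) ?big"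
    proof (rule has_integral_on_superset[OF *])
      show "(\<lambda>x. x - s *\<^sub>R v) ` unit_box \<subseteq> ?big"
        using sv by (auto simp: in_cbox_complex_iff)
      fix x assume "x \<notin> (\<lambda>x. x - s *\<^sub>R v) ` unit_box"
      then have "x + s *\<^sub>R v \<notin> unit_box"
        using image_eqI[of x "\<lambda>x. x - s *\<^sub>R v" "x + s *\<^sub>R v" unit_box] by auto
      then show "G (x + s *\<^sub>R v) = 0" by (rule zero)
    qed
    then show ?thesis by blast
  qed
  have "((\<lambda>s. integral ?big (\<lambda>w. G (w + s *\<^sub>R v))) has_field_derivative
      integral ?big (\<lambda>w. G' (w + 0 *\<^sub>R v))) (at 0 within {-1<..<1})"
  proof (rule leibniz_rule_field_derivative)
    show "((\<lambda>s. G (w + s *\<^sub>R v)) has_field_derivative G' (w + s *\<^sub>R v)) (at s within {-1<..<1})" for s w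
      using line has_field_derivative_at_within by blast
    show "(\<lambda>w. G (w + s *\<^sub>R v)) integrable_on ?big" for s
      by (intro integrable_continuous continuous_on_compose2[OF cont(1)] continuous_intros) auto
    show "continuous_on ({-1<..<1} \<times> ?big) (\<lambda>(s, w). G' (w + s *\<^sub>R v))"
      unfolding split_beta
      by (intro continuous_on_compose2[OF cont(2)] continuous_intros) auto
  qed auto
  then have "((\<lambda>s. integral ?big (\<lambda>w. G (w + s *\<^sub>R v))) has_field_derivative integral ?big G') (at 0)"
    using at_within_open[of "0::real" "{-1<..<1}"] by simp
  moreover have "((\<lambda>s. integral ?big (\<lambda>w. G (w + s *\<^sub>R v))) has_field_derivative 0) (at 0)"
    by (rule has_field_derivative_transform_within_open[of "\<lambda>_. integral unit_box G" _ _ "{-1<..<1}"])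
      (simp, simp, simp, rule J[symmetric])
  ultimately have "integral ?big G' = 0" by (rule DERIV_unique)
  moreover have "integral ?big G' = integral unit_box G'"
  proof -
    have "(G' has_integral integral unit_box G') unit_box"
      using cont(2) by (meson continuous_on_subset integrable_continuous integrable_integral subset_UNIV)
    then have "(G' has_integral integral unit_box G') ?big"
    proof (rule has_integral_on_superset)
      fix w assume w: "w \<notin> unit_box"
      \<comment> \<open>The complement of the box is open, so \<open>G\<close> vanishes along a
        short piece of the line through \<open>w\<close> and its derivative there is 0.\<close>
      have "open ((\<lambda>t. w + t *\<^sub>R v) -` (- unit_box))"
        by (intro open_vimage continuous_intros open_Compl closed_cbox)
      then have "((\<lambda>t. G (w + t *\<^sub>R v)) has_real_derivative 0) (at 0)"
        by (rule has_field_derivative_transform_within_open[OF DERIV_const, of _ _ 0]) (use w zero in auto)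
      moreover have "((\<lambda>t. G (w + t *\<^sub>R v)) has_real_derivative G' w) (at 0)"
        using line[of w 0] by simp
      ultimately show "G' w = 0" using DERIV_unique by blast
    qed (auto simp: in_cbox_complex_iff)
    then show ?thesis by blast
  qed
  ultimately show ?thesis by simp
qed

text \<open>This is convolution with a kernel that may be singular at the centre, unfolded as a
  superposition over \<open>t\<close> of copies of \<open>\<kappa>\<close> shrunk by
  \<open>T t\<close>. Unfolded, the integrand is continuous on the prism.\<close>

definition avg :: "real \<Rightarrow> (real \<Rightarrow> real) \<Rightarrow> (complex \<Rightarrow> real) \<Rightarrow> (complex \<Rightarrow> real) \<Rightarrow> complex \<Rightarrow> real"
  where "avg T p \<kappa> g z =
    integral prism (\<lambda>q. p (fst q) * \<kappa> (snd q) * g (z + (T * fst q) *\<^sub>R snd q))"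

lemma continuous_on_compose_UNIV:
  "continuous_on UNIV f \<Longrightarrow> continuous_on S h \<Longrightarrow> continuous_on S (\<lambda>x. f (h x))"
  by (rule continuous_on_compose2) auto

lemma avg_integrand_continuous:
  fixes \<kappa> g :: "complex \<Rightarrow> real"
  assumes "continuous_on UNIV p" "continuous_on UNIV \<kappa>" "continuous_on UNIV g"
  shows "continuous_on S (\<lambda>q. p (fst q) * \<kappa> (snd q) * g (z + (T * fst q) *\<^sub>R snd q))"
  by (intro continuous_intros assms[THEN continuous_on_compose_UNIV])

lemma avg_integrable:
  fixes \<kappa> g :: "complex \<Rightarrow> real"
  assumes "continuous_on UNIV p" "continuous_on UNIV \<kappa>" "continuous_on UNIV g"
  shows "(\<lambda>q. p (fst q) * \<kappa> (snd q) * g (z + (T * fst q) *\<^sub>R snd q)) integrable_on prism"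
  by (rule integrable_continuous[OF avg_integrand_continuous[OF assms]])

lemma avg_continuous:
  assumes "continuous_on UNIV p" "continuous_on UNIV \<kappa>" "continuous_on UNIV g"
  shows "continuous_on S (avg T p \<kappa> g)"
  unfolding avg_def[abs_def]
  apply (rule integral_continuous_on_param)
  unfolding split_beta
  by (intro continuous_intros assms[THEN continuous_on_compose_UNIV])

lemma avg_add:
  assumes "continuous_on UNIV p" "continuous_on UNIV \<kappa>" "continuous_on UNIV g" "continuous_on UNIV h"
  shows "avg T p \<kappa> (\<lambda>z. g z + h z) z = avg T p \<kappa> g z + avg T p \<kappa> h z"
  unfolding avg_def
  by (subst integral_add[symmetric], (rule avg_integrable assms)+) (simp add: algebra_simps)

lemma avg_cmult: "avg T p \<kappa> (\<lambda>z. c * g z) z = c * avg T p \<kappa> g z"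
  unfolding avg_def by (subst integral_mult_right[symmetric]) (auto simp: algebra_simps)

lemma avg_diff:
  assumes "continuous_on UNIV p" "continuous_on UNIV \<kappa>" "continuous_on UNIV g" "continuous_on UNIV h"
  shows "avg T p \<kappa> (\<lambda>z. g z - h z) z = avg T p \<kappa> g z - avg T p \<kappa> h z"
  unfolding avg_def
  by (subst integral_diff[symmetric], (rule avg_integrable assms)+) (simp add: algebra_simps)

lemma tcd_1_continuous:
  assumes "tcd (Suc 0) g" shows "continuous_on S g" "continuous_on S (dird v g)"
  using tcd_continuous[OF assms] tcd_continuous[OF tcd_dird[OF assms]] by auto

lemma avg_line:
  assumes c: "continuous_on UNIV p" "continuous_on UNIV \<kappa>" and g: "tcd (Suc 0) g"
  shows "((\<lambda>t. avg T p \<kappa> g (z + t *\<^sub>R v)) has_real_derivative avg T p \<kappa> (dird v g) (z + t *\<^sub>R v)) (at t)"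
proof -
  have cg: "continuous_on UNIV g" "continuous_on UNIV (dird v g)"
    by (rule tcd_1_continuous[OF g])+
  have "((\<lambda>t. integral prism (\<lambda>q. p (fst q) * \<kappa> (snd q) * g (z + t *\<^sub>R v + (T * fst q) *\<^sub>R snd q)))
     has_field_derivative integral prism (\<lambda>q. p (fst q) * \<kappa> (snd q) * dird v g (z + t *\<^sub>R v + (T * fst q) *\<^sub>R snd q)))
     (at t within UNIV)"
  proof (rule leibniz_rule_field_derivative)
    fix t q
    have "((\<lambda>t. g ((z + (T * fst q) *\<^sub>R snd q) + t *\<^sub>R v)) has_real_derivative
          dird v g ((z + (T * fst q) *\<^sub>R snd q) + t *\<^sub>R v)) (at t)"
      by (rule line_derivative[OF tcd_differentiable[OF g]])
    from DERIV_cmult[OF this, of "p (fst q) * \<kappa> (snd q)"]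
    show "((\<lambda>t. p (fst q) * \<kappa> (snd q) * g (z + t *\<^sub>R v + (T * fst q) *\<^sub>R snd q)) has_real_derivative
         p (fst q) * \<kappa> (snd q) * dird v g (z + t *\<^sub>R v + (T * fst q) *\<^sub>R snd q)) (at t)"
      by (simp add: algebra_simps)
  next
    show "(\<lambda>q. p (fst q) * \<kappa> (snd q) * g (z + t *\<^sub>R v + (T * fst q) *\<^sub>R snd q)) integrable_on prism" for t
      by (intro avg_integrable c cg)
    show "continuous_on (UNIV \<times> prism) (\<lambda>(t, q). p (fst q) * \<kappa> (snd q) * dird v g (z + t *\<^sub>R v + (T * fst q) *\<^sub>R snd q))"
      unfolding split_beta
      by (intro continuous_intros c[THEN continuous_on_compose_UNIV] cg(2)[THEN continuous_on_compose_UNIV])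
  qed auto
  then show ?thesis by (simp add: avg_def)
qed

lemma avg_dird_linear:
  assumes c: "continuous_on UNIV p" "continuous_on UNIV \<kappa>" and g: "tcd (Suc 0) g"
  shows "avg T p \<kappa> (dird h g) z = Re h * avg T p \<kappa> (dird 1 g) z + Im h * avg T p \<kappa> (dird \<i> g) z"
proof -
  have cg: "continuous_on UNIV (\<lambda>z. c * dird v g z)" for v c
    by (intro continuous_intros tcd_1_continuous g)
  have "dird h g = (\<lambda>z. Re h * dird 1 g z + Im h * dird \<i> g z)"
    by (rule ext, rule dird_linear[OF tcd_differentiable[OF g]])
  then show ?thesis using c cg by (simp add: avg_add avg_cmult)
qed

lemma avg_has_derivative:
  assumes c: "continuous_on UNIV p" "continuous_on UNIV \<kappa>" and g: "tcd (Suc 0) g"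
  shows "(avg T p \<kappa> g has_derivative (\<lambda>h. avg T p \<kappa> (dird h g) z)) (at z)"
proof -
  have "continuous_on UNIV (dird v g)" for v
    by (rule tcd_1_continuous[OF g])
  then show ?thesis
    by (intro has_derivative_from_line[of _ _ "\<lambda>h. avg T p \<kappa> (dird h g)"] avg_line avg_dird_linear avg_continuous assms)
qed

lemma dird_avg:
  assumes "continuous_on UNIV p" "continuous_on UNIV \<kappa>" "tcd (Suc 0) g"
  shows "dird v (avg T p \<kappa> g) = avg T p \<kappa> (dird v g)"
  by (rule ext, rule dird_eq[OF avg_has_derivative[OF assms]])

lemma tcd_avg:
  assumes c: "continuous_on UNIV p" "continuous_on UNIV \<kappa>"
  shows "tcd n g \<Longrightarrow> tcd n (avg T p \<kappa> g)"
proof (induction n arbitrary: g)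
  case 0 then show ?case by (auto intro: avg_continuous c)
next
  case (Suc n)
  have "tcd (Suc 0) g" using tcd_le[OF Suc.prems] by simp
  note avg_has_derivative[OF c this] dird_avg[OF c this]
  with Suc show ?case by (auto simp: tcd_Suc differentiable_def)
qed

lemma lap_avg:
  assumes c: "continuous_on UNIV p" "continuous_on UNIV \<kappa>" and g: "tcd 2 g"
  shows "lap (avg T p \<kappa> g) z = avg T p \<kappa> (lap g) z"
proof -
  have g2: "tcd (Suc (Suc 0)) g" using g by (simp add: numeral_2_eq_2)
  have g1: "tcd (Suc 0) g" "tcd (Suc 0) (dird v g)" for v
    using tcd_Suc_imp[OF g2] tcd_dird[OF g2] by auto
  have "continuous_on UNIV (dird v (dird v g))" for v
    by (rule tcd_1_continuous[OF g1(2)])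
  then show ?thesis
    unfolding lap_def[abs_def] using c
    by (simp add: dird_avg[OF c g1(1)] dird_avg[OF c g1(2)] avg_add)
qed

text \<open>For each fixed \<open>t\<close>, integrate by parts in \<open>w\<close>. The chain rule
  for \<open>g (z + T t w)\<close> produces the factor \<open>T t\<close>, so the left side must
  carry the weight \<open>t * p t\<close> for the right side to have \<open>p t\<close>.\<close>

lemma avg_parts:
  assumes p: "continuous_on UNIV p" and k: "continuous_on UNIV \<kappa>" "continuous_on UNIV \<kappa>'"
    and g: "tcd (Suc 0) g"
    and line: "\<And>w t. ((\<lambda>t. \<kappa> (w + t *\<^sub>R v)) has_real_derivative \<kappa>' (w + t *\<^sub>R v)) (at t)"
    and zero: "\<And>w. w \<notin> unit_box \<Longrightarrow> \<kappa> w = 0" and v: "norm v \<le> 1"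
  shows "T * avg T (\<lambda>t. t * p t) \<kappa> (dird v g) z = - avg T p \<kappa>' g z"
proof -
  have cg: "continuous_on UNIV g" "continuous_on UNIV (dird v g)"
    by (rule tcd_1_continuous[OF g])+
  \<comment> \<open>\<open>H t\<close> is the derivative in direction \<open>v\<close> of
    \<open>\<kappa> w\<close> times \<open>g (z + T t w)\<close> as a function of
    \<open>w\<close>.\<close>
  define H where "H t w = \<kappa> w * (T * t * dird v g (z + (T * t) *\<^sub>R w)) + \<kappa>' w * g (z + (T * t) *\<^sub>R w)" for t w
  have 0: "integral unit_box (H t) = 0" for t
  proof (rule integral_line_derivative_eq_0[of "\<lambda>w. \<kappa> w * g (z + (T * t) *\<^sub>R w)" v])
    fix w s
    have "((\<lambda>s. g ((z + (T * t) *\<^sub>R w) + s *\<^sub>R ((T * t) *\<^sub>R v))) has_real_derivative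
          dird ((T * t) *\<^sub>R v) g ((z + (T * t) *\<^sub>R w) + s *\<^sub>R ((T * t) *\<^sub>R v))) (at s)"
      by (rule line_derivative[OF tcd_differentiable[OF g]])
    moreover have "(z + (T * t) *\<^sub>R w) + s *\<^sub>R ((T * t) *\<^sub>R v) = z + (T * t) *\<^sub>R (w + s *\<^sub>R v)" for s
      by (simp add: algebra_simps)
    moreover have "dird ((T * t) *\<^sub>R v) g x = T * t * dird v g x" for x
      using dird_linear[OF tcd_differentiable[OF g], of "(T * t) *\<^sub>R v" x]
        dird_linear[OF tcd_differentiable[OF g], of v x] by (simp add: algebra_simps)
    ultimately have "((\<lambda>s. g (z + (T * t) *\<^sub>R (w + s *\<^sub>R v))) has_real_derivative
          T * t * dird v g (z + (T * t) *\<^sub>R (w + s *\<^sub>R v))) (at s)"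
      by (simp only:)
    from DERIV_mult[OF line[of w s] this]
    show "((\<lambda>s. \<kappa> (w + s *\<^sub>R v) * g (z + (T * t) *\<^sub>R (w + s *\<^sub>R v))) has_real_derivative
         H t (w + s *\<^sub>R v)) (at s)"
      by (simp add: H_def algebra_simps)
  next
    show "continuous_on UNIV (\<lambda>w. \<kappa> w * g (z + (T * t) *\<^sub>R w))"
      by (intro continuous_intros k(1) cg(1)[THEN continuous_on_compose_UNIV])
    show "continuous_on UNIV (H t)"
      unfolding H_def
      by (intro continuous_intros k cg[THEN continuous_on_compose_UNIV])
  qed (use zero v in auto)
  have "T * avg T (\<lambda>t. t * p t) \<kappa> (dird v g) z + avg T p \<kappa>' g z
     = integral prism (\<lambda>q. T * (fst q * p (fst q) * \<kappa> (snd q) * dird v g (z + (T * fst q) *\<^sub>R snd q)))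
       + integral prism (\<lambda>q. p (fst q) * \<kappa>' (snd q) * g (z + (T * fst q) *\<^sub>R snd q))"
    by (simp add: avg_def)
  also have "\<dots> = integral prism (\<lambda>q. p (fst q) * H (fst q) (snd q))"
  proof (subst integral_add[symmetric])
    show "(\<lambda>q. T * (fst q * p (fst q) * \<kappa> (snd q) * dird v g (z + (T * fst q) *\<^sub>R snd q))) integrable_on prism"
      by (intro integrable_continuous continuous_intros p[THEN continuous_on_compose_UNIV]
           k[THEN continuous_on_compose_UNIV] cg[THEN continuous_on_compose_UNIV])
    show "(\<lambda>q. p (fst q) * \<kappa>' (snd q) * g (z + (T * fst q) *\<^sub>R snd q)) integrable_on prism"
      by (rule avg_integrable[OF p k(2) cg(1)])
  qed (simp add: H_def algebra_simps)
  also have "\<dots> = integral {0..1} (\<lambda>t. integral unit_box (\<lambda>w. p t * H t w))"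
  proof (subst integral_prod_continuous)
    show "continuous_on prism (\<lambda>q. p (fst q) * H (fst q) (snd q))"
      unfolding H_def
      by (intro continuous_intros p[THEN continuous_on_compose_UNIV] k[THEN continuous_on_compose_UNIV]
           cg[THEN continuous_on_compose_UNIV])
  qed simp
  also have "\<dots> = 0" by (simp add: 0)
  finally show ?thesis by simp
qed

lemma prism_iff: "q \<in> prism \<longleftrightarrow> fst q \<in> {0..1} \<and> snd q \<in> unit_box"
  by (cases q) (auto simp: cbox_Pair_eq)

text \<open>Averages at scale \<open>T\<close> are local; 2 is a crude bound for \<open>cmod\<close>
  on the square.\<close>

lemma prism_point:
  assumes "q \<in> prism" shows "z + (T * fst q) *\<^sub>R snd q \<in> cball z (2 * \<bar>T\<bar>)"
proof -
  have q: "0 \<le> fst q" "fst q \<le> 1" "\<bar>Re (snd q)\<bar> \<le> 1" "\<bar>Im (snd q)\<bar> \<le> 1"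
    using assms by (auto simp: prism_iff in_cbox_complex_iff)
  have "cmod (snd q) \<le> 2" using cmod_le[of "snd q"] q by linarith
  with q have "fst q * cmod (snd q) \<le> 1 * 2" by (intro mult_mono) auto
  then have "\<bar>T\<bar> * (fst q * cmod (snd q)) \<le> \<bar>T\<bar> * 2" by (intro mult_left_mono) auto
  then show ?thesis using q by (simp add: dist_norm abs_mult mult.assoc)
qed

lemma avg_bound:
  assumes c: "continuous_on UNIV p" "continuous_on UNIV \<kappa>" "continuous_on UNIV g"
    and b: "\<And>x. x \<in> cball z (2 * \<bar>T\<bar>) \<Longrightarrow> \<bar>g x\<bar> \<le> B"
  shows "\<bar>avg T p \<kappa> g z\<bar> \<le> integral prism (\<lambda>q. \<bar>p (fst q) * \<kappa> (snd q)\<bar>) * B"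
proof -
  have "norm (avg T p \<kappa> g z) \<le> integral prism (\<lambda>q. \<bar>p (fst q) * \<kappa> (snd q)\<bar> * B)"
    unfolding avg_def
  proof (rule Henstock_Kurzweil_Integration.integral_norm_bound_integral)
    show "(\<lambda>q. \<bar>p (fst q) * \<kappa> (snd q)\<bar> * B) integrable_on prism"
      by (intro integrable_continuous continuous_intros c(1,2)[THEN continuous_on_compose_UNIV])
  qed (use b[OF prism_point] avg_integrable[OF c] in \<open>auto simp: abs_mult intro!: mult_left_mono\<close>)
  then show ?thesis by simp
qed

text \<open>Dominated convergence on the prism; it lets the representation identity survive
  pointwise limits.\<close>

lemma avg_tendsto:
  assumes c: "continuous_on UNIV p" "continuous_on UNIV \<kappa>" "\<And>n. continuous_on UNIV (f n)"
    and b: "\<And>n x. x \<in> cball z (2 * \<bar>T\<bar>) \<Longrightarrow> \<bar>f n x\<bar> \<le> B"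
    and lim: "\<And>x. x \<in> cball z (2 * \<bar>T\<bar>) \<Longrightarrow> (\<lambda>n. f n x) \<longlonglongrightarrow> g x"
  shows "(\<lambda>n. avg T p \<kappa> (f n) z) \<longlonglongrightarrow> avg T p \<kappa> g z"
  unfolding avg_def
proof (rule dominated_convergence(2))
  show "(\<lambda>q. p (fst q) * \<kappa> (snd q) * f n (z + (T * fst q) *\<^sub>R snd q)) integrable_on prism" for n
    by (rule avg_integrable[OF c])
  show "(\<lambda>q. \<bar>p (fst q) * \<kappa> (snd q)\<bar> * B) integrable_on prism"
    by (intro integrable_continuous continuous_intros c(1,2)[THEN continuous_on_compose_UNIV])
  show "norm (p (fst q) * \<kappa> (snd q) * f n (z + (T * fst q) *\<^sub>R snd q)) \<le> \<bar>p (fst q) * \<kappa> (snd q)\<bar> * B"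
    if "q \<in> prism" for n q
    using b[OF prism_point[OF that]] by (auto simp: abs_mult intro!: mult_left_mono)
  show "(\<lambda>n. p (fst q) * \<kappa> (snd q) * f n (z + (T * fst q) *\<^sub>R snd q))
     \<longlonglongrightarrow> p (fst q) * \<kappa> (snd q) * g (z + (T * fst q) *\<^sub>R snd q)" if "q \<in> prism" for q
    by (intro tendsto_intros lim prism_point that)
qed

text \<open>Integration by parts spends the factor \<open>t\<close> of the weight: a derivative of
  the average is an average of \<open>g\<close> itself with the kernel \<open>\<kappa>'\<close>,
  hence as smooth as \<open>g\<close>. The parts formula differentiates \<open>g\<close>, so one
  derivative must already be available.\<close>

lemma tcd_avg_gain:
  assumes T: "T \<noteq> 0" and p: "continuous_on UNIV p" and k: "continuous_on UNIV \<kappa>" "\<And>v. continuous_on UNIV (\<kappa>' v)"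
    and line: "\<And>v w t. ((\<lambda>t. \<kappa> (w + t *\<^sub>R v)) has_real_derivative \<kappa>' v (w + t *\<^sub>R v)) (at t)"
    and zero: "\<And>w. w \<notin> unit_box \<Longrightarrow> \<kappa> w = 0"
    and g: "tcd (Suc n) g"
  shows "tcd (Suc (Suc n)) (avg T (\<lambda>t. t * p t) \<kappa> g)"
proof -
  have g1: "tcd (Suc 0) g" using tcd_le[OF g] by simp
  have tp: "continuous_on UNIV (\<lambda>t. t * p t)" by (intro continuous_intros p)
  have eq: "avg T (\<lambda>t. t * p t) \<kappa> (dird v g) z = (- 1 / T) * avg T p (\<kappa>' v) g z" if "norm v \<le> 1" for v z
    using avg_parts[OF p k(1) k(2) g1 line zero that, of T z] T by (simp add: field_simps)
  \<comment> \<open>\<open>eq\<close> covers directions of norm at most 1; a general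
    \<open>v\<close> is resolved into \<open>1\<close> and \<open>\<i>\<close>.\<close>
  have "dird v (avg T (\<lambda>t. t * p t) \<kappa> g) = (\<lambda>z. Re v * ((- 1 / T) * avg T p (\<kappa>' 1) g z) + Im v * ((- 1 / T) * avg T p (\<kappa>' \<i>) g z))" for v
    unfolding dird_avg[OF tp k(1) g1]
    by (rule ext, subst avg_dird_linear[OF tp k(1) g1]) (simp add: eq)
  moreover have "tcd (Suc n) (\<lambda>z. Re v * ((- 1 / T) * avg T p (\<kappa>' 1) g z) + Im v * ((- 1 / T) * avg T p (\<kappa>' \<i>) g z))" for v
    by (intro tcd_add tcd_mult tcd_const tcd_avg p k(2) g)
  ultimately show ?thesis
    using avg_has_derivative[OF tp k(1) g1, of T] unfolding tcd_Suc[of "Suc n"] differentiable_def by metis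
qed

section \<open>The two kernels and the representation identity\<close>

definition bump_mass :: real where "bump_mass = integral unit_box (bump 2)"

lemma bump_mass_pos: "bump_mass > 0"
proof -
  have "integral unit_box (bump 2) \<noteq> 0"
  proof
    assume "integral unit_box (bump 2) = 0"
    moreover have "box (- 1 - \<i>) (1 + \<i>) \<noteq> {}"
      unfolding box_ne_empty by (auto simp: Basis_complex_def)
    ultimately have "\<forall>w\<in>unit_box. bump 2 w = 0"
      by (subst (asm) integral_cbox_eq_0_iff) (auto simp: bump_continuous bump_nonneg)
    moreover have "0 \<in> unit_box" by (simp add: in_cbox_complex_iff)
    ultimately have "bump 2 0 = 0" by blast
    then show False by (simp add: bump_def)
  qed
  moreover have "integral unit_box (bump 2) \<ge> 0"
    by (rule integral_nonneg) (auto intro!: integrable_continuous bump_continuous bump_nonneg)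
  ultimately show ?thesis by (simp add: bump_mass_def)
qed

text \<open>\<open>eta\<close> has integral 1. The 6 in \<open>theta\<close> is the factor produced
  by differentiating the cube of \<open>1 - |w|^2\<close>, so the gradient of \<open>theta\<close>
  is exactly \<open>- w eta\<close>. The primed versions are the derivatives in direction
  \<open>v\<close>.\<close>

definition eta :: "complex \<Rightarrow> real" where "eta w = bump 2 w / bump_mass"
definition theta :: "complex \<Rightarrow> real" where "theta w = bump 3 w / (6 * bump_mass)"
definition eta' :: "complex \<Rightarrow> complex \<Rightarrow> real" where "eta' v w = - 4 * (w \<bullet> v) * bump 1 w / bump_mass"
definition theta' :: "complex \<Rightarrow> complex \<Rightarrow> real" where "theta' v w = - (w \<bullet> v) * eta w"

lemma eta_line: "((\<lambda>t. eta (w + t *\<^sub>R v)) has_real_derivative eta' v (w + t *\<^sub>R v)) (at t)"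
  using DERIV_cdivide[OF bump_line[of 0 w v t], of bump_mass]
  by (simp add: eta_def eta'_def numeral_2_eq_2)

lemma theta_line: "((\<lambda>t. theta (w + t *\<^sub>R v)) has_real_derivative theta' v (w + t *\<^sub>R v)) (at t)"
  using DERIV_cdivide[OF bump_line[of 1 w v t], of "6 * bump_mass"]
  by (simp add: theta_def theta'_def eta_def numeral_2_eq_2 numeral_3_eq_3)

lemma kernel_continuous:
  "continuous_on S eta" "continuous_on S theta" "continuous_on S (eta' v)" "continuous_on S (theta' v)"
  unfolding eta_def[abs_def] theta_def[abs_def] eta'_def[abs_def] theta'_def[abs_def]
  using bump_mass_pos by (auto intro!: continuous_intros bump_continuous)

lemma kernel_outside: "w \<notin> unit_box \<Longrightarrow> eta w = 0" "w \<notin> unit_box \<Longrightarrow> theta w = 0"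
  using bump_outside[of w 1] bump_outside[of w 2] by (auto simp: eta_def theta_def numeral_2_eq_2 numeral_3_eq_3)

lemma theta_nonneg: "0 \<le> theta w"
  using bump_mass_pos by (simp add: theta_def bump_nonneg)

text \<open>The base of the powers lies in \<open>[0,1]\<close>. This inequality is what makes the
  kernel of \<open>smear\<close> nonnegative.\<close>

lemma theta_le_eta: "6 * theta w \<le> eta w"
proof -
  have "bump 3 w \<le> bump 2 w" unfolding bump_def by (rule power_decreasing) auto
  then show ?thesis using bump_mass_pos by (simp add: eta_def theta_def divide_right_mono)
qed

lemma eta_integral: "integral unit_box eta = 1"
  using bump_mass_pos unfolding eta_def[abs_def] by (simp add: bump_mass_def[symmetric])

text \<open>The weight is minus the derivative of \<open>1 - t^2\<close>, written as
  \<open>t * 2\<close> to fit the shape \<open>t * p t\<close> of the parts formula.\<close>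

definition mollify :: "real \<Rightarrow> (complex \<Rightarrow> real) \<Rightarrow> complex \<Rightarrow> real"
  where "mollify T = avg T (\<lambda>t. t * 2) eta"

text \<open>A truncated logarithmic potential. The weight \<open>1 - t^2\<close> vanishes at
  \<open>t = 1\<close>, so that only \<open>t = 0\<close> leaves a boundary term; the extra
  \<open>t\<close> is the one required by integration by parts.\<close>

definition potential :: "real \<Rightarrow> (complex \<Rightarrow> real) \<Rightarrow> complex \<Rightarrow> real"
  where "potential T = avg T (\<lambda>t. t * (1 - t\<^sup>2)) theta"

lemma weight_continuous:
  "continuous_on S (\<lambda>t::real. t * 2)" "continuous_on S (\<lambda>t::real. t * (1 - t\<^sup>2))" "continuous_on S (\<lambda>t::real. 1 - t\<^sup>2)"
  "continuous_on S (\<lambda>t::real. 2::real)"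
  by (intro continuous_intros)+

text \<open>Since \<open>theta'\<close> is \<open>- (w \<bullet> v) * eta\<close>, the left side
  averages minus the radial derivative of \<open>g\<close>, that is, its t-derivative along
  \<open>z + T t w\<close>. Integrating by parts in \<open>t\<close> leaves the value at
  \<open>t = 0\<close>, which is \<open>g z\<close>, and the average with weight
  \<open>2 t\<close>.\<close>

lemma avg_weight_inner:
  assumes g: "tcd (Suc 0) g"
  shows "T * (avg T (\<lambda>t. 1 - t\<^sup>2) (theta' 1) (dird 1 g) z + avg T (\<lambda>t. 1 - t\<^sup>2) (theta' \<i>) (dird \<i> g) z)
       = g z - mollify T g z"
proof -
  note c = weight_continuous kernel_continuous tcd_1_continuous[OF g]
  let ?P = "\<lambda>w t. z + (T * t) *\<^sub>R w"
  \<comment> \<open>\<open>?f w t\<close> is the t-derivative of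
    \<open>(1 - t^2) * g (z + T t w)\<close>.\<close>
  let ?f = "\<lambda>w t. (1 - t\<^sup>2) * dird (T *\<^sub>R w) g (?P w t) - 2 * t * g (?P w t)"
  have dird_w: "dird (T *\<^sub>R w) g x = T * (Re w * dird 1 g x + Im w * dird \<i> g x)" for w x
    using dird_linear[OF tcd_differentiable[OF g], of "T *\<^sub>R w" x] by (simp add: algebra_simps)
  have cf: "continuous_on S (\<lambda>q. eta (snd q) * ?f (snd q) (fst q))" for S
    unfolding dird_w by (intro continuous_intros c[THEN continuous_on_compose_UNIV])
  have inner: "integral {0..1} (\<lambda>t. eta w * ?f w t) = - eta w * g z" for w
  proof -
    have "((\<lambda>t. (1 - t\<^sup>2) * g (?P w t)) has_real_derivative ?f w t) (at t within {0..1})" for t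
    proof -
      have "((\<lambda>t. g (z + t *\<^sub>R (T *\<^sub>R w))) has_real_derivative dird (T *\<^sub>R w) g (z + t *\<^sub>R (T *\<^sub>R w))) (at t within {0..1})"
        by (rule line_derivative[OF tcd_differentiable[OF g]])
      then have "((\<lambda>t. g (?P w t)) has_real_derivative dird (T *\<^sub>R w) g (?P w t)) (at t within {0..1})"
        by (simp add: mult.commute)
      then show ?thesis by (auto intro!: derivative_eq_intros)
    qed
    then have "(?f w has_integral (1 - 1\<^sup>2) * g (?P w 1) - (1 - 0\<^sup>2) * g (?P w 0)) {0..1}"
      by (intro fundamental_theorem_of_calculus) (auto simp: has_real_derivative_iff_has_vector_derivative)
    then have "((\<lambda>t. eta w * ?f w t) has_integral eta w * (- g z)) {0..1}"
      by (intro has_integral_mult_right) simp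
    from integral_unique[OF this] show ?thesis by (simp only: mult_minus_left mult_minus_right)
  qed
  \<comment> \<open>Fubini: swapping the order puts the t-integral inside, where
    \<open>inner\<close> evaluates it.\<close>
  have "integral prism (\<lambda>q. eta (snd q) * ?f (snd q) (fst q)) = integral {0..1} (\<lambda>t. integral unit_box (\<lambda>w. eta w * ?f w t))"
    using integral_prod_continuous[OF cf, of 0 "- 1 - \<i>" 1 "1 + \<i>"] by simp
  also have "\<dots> = integral unit_box (\<lambda>w. integral {0..1} (\<lambda>t. eta w * ?f w t))"
    using integral_swap_continuous[of 0 "- 1 - \<i>" 1 "1 + \<i>" "\<lambda>t w. eta w * ?f w t"] cf[of prism]
    by (simp add: split_beta)
  also have "\<dots> = - g z"
    unfolding inner by (simp add: eta_integral)
  finally have 1: "integral prism (\<lambda>q. eta (snd q) * ?f (snd q) (fst q)) = - g z" .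
  have i: "(\<lambda>q. T * ((1 - (fst q)\<^sup>2) * theta' v (snd q) * dird v g (?P (snd q) (fst q)))) integrable_on prism"
    "(\<lambda>q. fst q * 2 * eta (snd q) * g (?P (snd q) (fst q))) integrable_on prism" for v
    by (intro integrable_continuous continuous_intros c[THEN continuous_on_compose_UNIV])+
  have "T * (avg T (\<lambda>t. 1 - t\<^sup>2) (theta' 1) (dird 1 g) z + avg T (\<lambda>t. 1 - t\<^sup>2) (theta' \<i>) (dird \<i> g) z) + mollify T g z
    = integral prism (\<lambda>q. T * ((1 - (fst q)\<^sup>2) * theta' 1 (snd q) * dird 1 g (?P (snd q) (fst q))))
    + integral prism (\<lambda>q. T * ((1 - (fst q)\<^sup>2) * theta' \<i> (snd q) * dird \<i> g (?P (snd q) (fst q))))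
    + integral prism (\<lambda>q. fst q * 2 * eta (snd q) * g (?P (snd q) (fst q)))"
    by (simp add: avg_def mollify_def distrib_left)
  also have "\<dots> = integral prism (\<lambda>q. T * ((1 - (fst q)\<^sup>2) * theta' 1 (snd q) * dird 1 g (?P (snd q) (fst q)))
       + T * ((1 - (fst q)\<^sup>2) * theta' \<i> (snd q) * dird \<i> g (?P (snd q) (fst q)))
       + fst q * 2 * eta (snd q) * g (?P (snd q) (fst q)))"
    using i by (simp only: integral_add integrable_add)
  also have "\<dots> = integral prism (\<lambda>q. - (eta (snd q) * ?f (snd q) (fst q)))"
    by (simp only: dird_w theta'_def inner_complex_def) (simp add: algebra_simps)
  also have "\<dots> = g z" using 1 by simp
  finally show ?thesis by simp
qed

text \<open>One integration by parts in \<open>w\<close> for each pure second derivative reduces the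
  potential of \<open>lap g\<close> to the first-order averages of
  \<open>avg_weight_inner\<close>.\<close>

lemma representation:
  assumes g: "tcd 2 g"
  shows "g z = mollify T g z - T\<^sup>2 * potential T (lap g) z"
proof -
  have g2: "tcd (Suc (Suc 0)) g" using g by (simp add: numeral_2_eq_2)
  note g1 = tcd_Suc_imp[OF g2] tcd_dird[OF g2]
  note c = weight_continuous kernel_continuous tcd_1_continuous[OF g1(2)]
  have "T * (T * potential T (lap g) z) =
     T * (T * potential T (dird 1 (dird 1 g)) z + T * potential T (dird \<i> (dird \<i> g)) z)"
    unfolding lap_def[abs_def] potential_def by (subst avg_add, (rule c)+) (simp add: algebra_simps)
  also have "\<dots> = T * (- avg T (\<lambda>t. 1 - t\<^sup>2) (theta' 1) (dird 1 g) z - avg T (\<lambda>t. 1 - t\<^sup>2) (theta' \<i>) (dird \<i> g) z)"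
    unfolding potential_def
    by (subst (1 2) avg_parts[OF c(3) c(6) c(8) g1(2) theta_line kernel_outside(2)]) auto
  also have "\<dots> = - (g z - mollify T g z)"
    using avg_weight_inner[OF g1(1), of T z] by (simp add: algebra_simps)
  finally show ?thesis by (simp add: power2_eq_square)
qed

section \<open>Regularity of limits\<close>

lemma tcd_mollify: "tcd n g \<Longrightarrow> tcd n (mollify T g)"
  and tcd_potential: "tcd n g \<Longrightarrow> tcd n (potential T g)"
  unfolding mollify_def potential_def by (auto intro: tcd_avg weight_continuous kernel_continuous)

lemma tcd_mollify_gain: "T \<noteq> 0 \<Longrightarrow> tcd (Suc n) g \<Longrightarrow> tcd (Suc (Suc n)) (mollify T g)"
  and tcd_potential_gain: "T \<noteq> 0 \<Longrightarrow> tcd (Suc n) g \<Longrightarrow> tcd (Suc (Suc n)) (potential T g)"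
  unfolding mollify_def potential_def
  by (auto intro!: tcd_avg_gain[OF _ _ _ _ eta_line] tcd_avg_gain[OF _ _ _ _ theta_line]
      weight_continuous kernel_continuous kernel_outside)

text \<open>The gradient of a function at scale 1, expressed through undifferentiated values of the
  function \<open>f\<close> and of its Laplacian \<open>\<rho>\<close>. It also makes sense for
  pairs of continuous functions not yet known to be so related.\<close>

definition grad_kernel :: "complex \<Rightarrow> (complex \<Rightarrow> real) \<Rightarrow> (complex \<Rightarrow> real) \<Rightarrow> complex \<Rightarrow> real"
  where "grad_kernel v f \<rho> z =
    avg 1 (\<lambda>t. 1 - t\<^sup>2) (theta' v) \<rho> z - avg 1 (\<lambda>_. 2) (eta' v) f z"

lemma dird_representation:
  assumes g: "smooth g" and v: "norm v \<le> 1"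
  shows "dird v g z = grad_kernel v g (lap g) z"
proof -
  have g1: "tcd (Suc 0) g" "tcd (Suc 0) (lap g)"
    using g lap_smooth[OF g] by (auto intro: smooth_tcd)
  note c = weight_continuous kernel_continuous
  have "dird v (\<lambda>z. mollify 1 g z - potential 1 (lap g) z) z = dird v (mollify 1 g) z - dird v (potential 1 (lap g)) z"
    by (intro dird_diff tcd_differentiable[of 0] tcd_mollify tcd_potential g1)
  moreover have "(\<lambda>z. mollify 1 g z - potential 1 (lap g) z) = g"
    using representation[OF smooth_tcd[OF g], of _ 1] by (simp add: fun_eq_iff)
  moreover have "dird v (mollify 1 g) z = - avg 1 (\<lambda>_. 2) (eta' v) g z"
    unfolding mollify_def dird_avg[OF c(1) c(5) g1(1)]
    using avg_parts[OF c(4) c(5) c(7) g1(1) eta_line kernel_outside(1) v, of 1 z] by simp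
  moreover have "dird v (potential 1 (lap g)) z = - avg 1 (\<lambda>t. 1 - t\<^sup>2) (theta' v) (lap g) z"
    unfolding potential_def dird_avg[OF c(2) c(6) g1(2)]
    using avg_parts[OF c(3) c(6) c(8) g1(2) theta_line kernel_outside(2) v, of 1 z] by simp
  ultimately show ?thesis by (simp add: grad_kernel_def)
qed

lemma grad_kernel_continuous:
  "continuous_on UNIV f \<Longrightarrow> continuous_on UNIV \<rho> \<Longrightarrow> continuous_on S (grad_kernel v f \<rho>)"
  unfolding grad_kernel_def[abs_def]
  by (intro continuous_intros avg_continuous weight_continuous kernel_continuous)

text \<open>An interior gradient estimate: \<open>C\<close> depends on the direction only, so one
  constant serves a whole sequence and all centres.\<close>

lemma grad_kernel_bound:
  obtains C where "C \<ge> 0"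
    "\<And>f \<rho> z B. continuous_on UNIV f \<Longrightarrow> continuous_on UNIV \<rho> \<Longrightarrow>
      (\<And>x. x \<in> cball z 2 \<Longrightarrow> \<bar>f x\<bar> \<le> B \<and> \<bar>\<rho> x\<bar> \<le> B) \<Longrightarrow> \<bar>grad_kernel v f \<rho> z\<bar> \<le> C * B"
proof
  let ?C1 = "integral prism (\<lambda>q. \<bar>(1 - (fst q)\<^sup>2) * theta' v (snd q)\<bar>)"
  let ?C2 = "integral prism (\<lambda>q. \<bar>2 * eta' v (snd q)\<bar>)"
  show "0 \<le> ?C1 + ?C2"
    by (intro add_nonneg_nonneg integral_nonneg integrable_continuous continuous_intros
        kernel_continuous[THEN continuous_on_compose_UNIV]) auto
  fix f \<rho> :: "complex \<Rightarrow> real" and z B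
  assume c: "continuous_on UNIV f" "continuous_on UNIV \<rho>"
    and b: "\<And>x. x \<in> cball z 2 \<Longrightarrow> \<bar>f x\<bar> \<le> B \<and> \<bar>\<rho> x\<bar> \<le> B"
  have "\<bar>avg 1 (\<lambda>t. 1 - t\<^sup>2) (theta' v) \<rho> z\<bar> \<le> ?C1 * B"
    using b by (intro avg_bound weight_continuous kernel_continuous c) auto
  moreover have "\<bar>avg 1 (\<lambda>_. 2) (eta' v) f z\<bar> \<le> ?C2 * B"
    using b by (intro avg_bound weight_continuous kernel_continuous c) auto
  ultimately show "\<bar>grad_kernel v f \<rho> z\<bar> \<le> (?C1 + ?C2) * B"
    by (simp add: grad_kernel_def distrib_right)
qed

text \<open>Near \<open>z\<close> the function is positive and the kernel is nonnegative, so a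
  vanishing potential at small scale would force a continuous nonnegative integrand to vanish at
  \<open>(1/2, 0)\<close>, where it is positive.\<close>

lemma potential_detects_positive:
  assumes d: "continuous_on UNIV d" and pos: "d z > 0"
  obtains T where "T > 0" "potential T d z \<noteq> 0"
proof -
  obtain e where e: "e > 0" "\<And>x. dist x z < e \<Longrightarrow> dist (d x) (d z) < d z"
    using d pos unfolding continuous_on_iff by (metis UNIV_I)
  \<comment> \<open>The average reaches at most distance \<open>2 * T = e / 2\<close>, inside the
    region of positivity.\<close>
  define T where "T = e / 4"
  have T: "T > 0" using e by (simp add: T_def)
  have dpos: "d (z + (T * fst q) *\<^sub>R snd q) > 0" if "q \<in> prism" for q
  proof -
    have "dist (z + (T * fst q) *\<^sub>R snd q) z < e"
      using prism_point[OF that, of z T] T e(1) by (simp add: dist_commute T_def)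
    from e(2)[OF this] show ?thesis by (simp add: dist_real_def abs_if split: if_splits)
  qed
  have "potential T d z \<noteq> 0"
  proof
    assume "potential T d z = 0"
    moreover have "box (0, - 1 - \<i>) (1::real, 1 + \<i>) \<noteq> {}"
      unfolding box_ne_empty by (auto simp: Basis_prod_def Basis_complex_def)
    ultimately have "\<forall>q\<in>prism. fst q * (1 - (fst q)\<^sup>2) * theta (snd q) * d (z + (T * fst q) *\<^sub>R snd q) = 0"
      unfolding potential_def avg_def
    proof (subst (asm) integral_cbox_eq_0_iff)
      show "0 \<le> fst q * (1 - (fst q)\<^sup>2) * theta (snd q) * d (z + (T * fst q) *\<^sub>R snd q)" if "q \<in> prism" for q
        using that dpos[OF that] by (auto simp: prism_iff theta_nonneg power_le_one intro!: mult_nonneg_nonneg)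
    qed (auto intro!: avg_integrand_continuous weight_continuous kernel_continuous d)
    moreover have h: "(1/2, 0) \<in> prism" by (simp add: prism_iff in_cbox_complex_iff)
    ultimately have "fst (1/2 :: real, 0 :: complex) * (1 - (fst (1/2 :: real, 0 :: complex))\<^sup>2) *
        theta (snd (1/2 :: real, 0 :: complex)) *
        d (z + (T * fst (1/2 :: real, 0 :: complex)) *\<^sub>R snd (1/2 :: real, 0 :: complex)) = 0"
      by blast
    then have "theta 0 = 0" using pos by (simp add: power2_eq_square)
    then show False using bump_mass_pos by (simp add: theta_def bump_def)
  qed
  with T that show ?thesis by blast
qed

text \<open>Compactness and elliptic regularity in one. In the applications \<open>\<rho>\<close> is
  the nonlinearity evaluated at \<open>U\<close>, so \<open>reg\<close> says that it inherits the
  smoothness of \<open>U\<close>; this feeds the bootstrap.\<close>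

lemma limit_solution:
  assumes u: "\<And>n. smooth (u n)"
    and lim: "\<And>z. (\<lambda>n. u n z) \<longlonglongrightarrow> U z" "\<And>z. (\<lambda>n. lap (u n) z) \<longlonglongrightarrow> \<rho> z"
    and bd: "\<And>R. \<exists>B. \<forall>n z. cmod z \<le> R \<longrightarrow> \<bar>u n z\<bar> \<le> B \<and> \<bar>lap (u n) z\<bar> \<le> B"
    and reg: "\<And>n. tcd n U \<Longrightarrow> tcd n \<rho>"
  shows "smooth U" "lap U z = \<rho> z"
proof -
  note c = weight_continuous kernel_continuous
  have cu: "continuous_on S (u n)" "continuous_on S (lap (u n))" for n S
    using u lap_smooth by (auto intro: smooth_continuous)
  obtain C1 where C1: "C1 \<ge> 0" "\<And>f \<rho> z B. continuous_on UNIV f \<Longrightarrow> continuous_on UNIV \<rho> \<Longrightarrow>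
      (\<And>x. x \<in> cball z 2 \<Longrightarrow> \<bar>f x\<bar> \<le> B \<and> \<bar>\<rho> x\<bar> \<le> B) \<Longrightarrow> \<bar>grad_kernel 1 f \<rho> z\<bar> \<le> C1 * B"
    using grad_kernel_bound[of 1] by metis
  obtain C2 where C2: "C2 \<ge> 0" "\<And>f \<rho> z B. continuous_on UNIV f \<Longrightarrow> continuous_on UNIV \<rho> \<Longrightarrow>
      (\<And>x. x \<in> cball z 2 \<Longrightarrow> \<bar>f x\<bar> \<le> B \<and> \<bar>\<rho> x\<bar> \<le> B) \<Longrightarrow> \<bar>grad_kernel \<i> f \<rho> z\<bar> \<le> C2 * B"
    using grad_kernel_bound[of \<i>] by metis
  \<comment> \<open>Uniform local bounds on \<open>u n\<close> and its Laplacian give uniform local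
    gradient bounds; the radius grows by 2, the reach of averages at scale 1.\<close>
  have grad: "\<exists>L. \<forall>n x h. cmod x \<le> R \<longrightarrow> \<bar>dird h (u n) x\<bar> \<le> L * norm h" for R
  proof -
    obtain B where B: "\<And>n z. cmod z \<le> R + 2 \<Longrightarrow> \<bar>u n z\<bar> \<le> B \<and> \<bar>lap (u n) z\<bar> \<le> B"
      using bd[of "R + 2"] by blast
    have "\<bar>dird h (u n) x\<bar> \<le> (C1 * B + C2 * B) * norm h" if x: "cmod x \<le> R" for n x h
    proof -
      have b: "\<bar>u n y\<bar> \<le> B \<and> \<bar>lap (u n) y\<bar> \<le> B" if "y \<in> cball x 2" for y
      proof -
        have "cmod y \<le> cmod x + cmod (x - y)" by (metis norm_minus_commute norm_triangle_sub)
        then show ?thesis using that x by (intro B) (simp add: dist_norm)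
      qed
      have "\<bar>dird 1 (u n) x\<bar> \<le> C1 * B" "\<bar>dird \<i> (u n) x\<bar> \<le> C2 * B"
        using C1(2)[OF cu b] C2(2)[OF cu b] by (simp_all add: dird_representation u)
      then have "\<bar>Re h\<bar> * \<bar>dird 1 (u n) x\<bar> + \<bar>Im h\<bar> * \<bar>dird \<i> (u n) x\<bar> \<le> norm h * (C1 * B) + norm h * (C2 * B)"
        by (intro add_mono mult_mono abs_Re_le_cmod abs_Im_le_cmod) auto
      moreover have "\<bar>dird h (u n) x\<bar> \<le> \<bar>Re h\<bar> * \<bar>dird 1 (u n) x\<bar> + \<bar>Im h\<bar> * \<bar>dird \<i> (u n) x\<bar>"
        unfolding dird_linear[OF smooth_differentiable[OF u], of h] abs_mult[symmetric] by (rule abs_triangle_ineq)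
      ultimately show ?thesis by (simp add: algebra_simps)
    qed
    then show ?thesis by blast
  qed
  \<comment> \<open>The gradient bounds make the \<open>u n\<close> locally Lipschitz uniformly in
    \<open>n\<close>, and this passes to the pointwise limit.\<close>
  have contU: "continuous_on UNIV U"
  proof -
    have "continuous_on (ball (0::complex) R) U" for R
    proof -
      obtain L where L: "\<And>n x h. cmod x \<le> R \<Longrightarrow> \<bar>dird h (u n) x\<bar> \<le> L * norm h"
        using grad[of R] by blast
      have "\<bar>U x - U y\<bar> \<le> L * norm (x - y)" if "x \<in> ball (0::complex) R" "y \<in> ball (0::complex) R" for x y
      proof (rule LIMSEQ_le_const2)
        show "(\<lambda>n. \<bar>u n x - u n y\<bar>) \<longlonglongrightarrow> \<bar>U x - U y\<bar>" by (intro tendsto_intros lim)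
        have "norm (u n x - u n y) \<le> L * norm (x - y)" for n
        proof (rule differentiable_bound[where S = "ball 0 R" and f = "u n" and f' = "\<lambda>x h. dird h (u n) x"])
          fix x assume "x \<in> ball (0::complex) R"
          then show "onorm (\<lambda>h. dird h (u n) x) \<le> L"
            by (intro onorm_le) (use L in auto)
        next
          show "(u n has_derivative (\<lambda>h. dird h (u n) x)) (at x within ball 0 R)" for x
            by (rule has_derivative_at_withinI[OF has_derivative_dird[OF smooth_differentiable[OF u]]])
        qed (rule convex_ball that)+
        then show "\<exists>N. \<forall>n\<ge>N. \<bar>u n x - u n y\<bar> \<le> L * norm (x - y)" by simp
      qed
      \<comment> \<open>A Lipschitz constant is required to be nonnegative, hence
        \<open>max L 0\<close>.\<close>
      moreover have "L * norm (x - y) \<le> max L 0 * norm (x - y)" for x y :: complex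
        by (rule mult_right_mono) auto
      ultimately have "(max L 0)-lipschitz_on (ball 0 R) U"
        unfolding lipschitz_on_def dist_norm real_norm_def by (metis max.cobounded2 order_trans)
      then show ?thesis by (rule lipschitz_on_continuous_on)
    qed
    then have "continuous_on (\<Union>n. ball (0::complex) (real n)) U"
      by (intro continuous_on_open_UN) auto
    moreover have "(\<Union>n. ball 0 (real n)) = (UNIV :: complex set)"
      using reals_Archimedean2 by fastforce
    ultimately show ?thesis by simp
  qed
  have cont\<rho>: "continuous_on UNIV \<rho>" using reg[of 0] contU by simp
  have bcb: "\<exists>B. \<forall>n. \<forall>x \<in> cball z r. \<bar>u n x\<bar> \<le> B \<and> \<bar>lap (u n) x\<bar> \<le> B" for z r
  proof -
    obtain B where B: "\<And>n x. cmod x \<le> cmod z + r \<Longrightarrow> \<bar>u n x\<bar> \<le> B \<and> \<bar>lap (u n) x\<bar> \<le> B"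
      using bd[of "cmod z + r"] by blast
    have "cmod x \<le> cmod z + r" if "x \<in> cball z r" for x
      using that norm_triangle_sub[of x z] by (simp add: dist_norm norm_minus_commute)
    then show ?thesis using B by blast
  qed
  have avg_lim: "(\<lambda>n. avg T p \<kappa> (u n) z) \<longlonglongrightarrow> avg T p \<kappa> U z"
      "(\<lambda>n. avg T p \<kappa> (lap (u n)) z) \<longlonglongrightarrow> avg T p \<kappa> \<rho> z"
    if "continuous_on UNIV p" "continuous_on UNIV \<kappa>" for p \<kappa> T z
  proof -
    obtain B where "\<And>n x. x \<in> cball z (2 * \<bar>T\<bar>) \<Longrightarrow> \<bar>u n x\<bar> \<le> B \<and> \<bar>lap (u n) x\<bar> \<le> B"
      using bcb[of z "2 * \<bar>T\<bar>"] by blast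
    then show "(\<lambda>n. avg T p \<kappa> (u n) z) \<longlonglongrightarrow> avg T p \<kappa> U z"
      "(\<lambda>n. avg T p \<kappa> (lap (u n)) z) \<longlonglongrightarrow> avg T p \<kappa> \<rho> z"
      using that cu lim by (auto intro!: avg_tendsto[where B = B])
  qed
  have repr: "U z = mollify T U z - T\<^sup>2 * potential T \<rho> z" for T z
  proof (rule LIMSEQ_unique)
    show "(\<lambda>n. u n z) \<longlonglongrightarrow> U z" by (rule lim)
    show "(\<lambda>n. u n z) \<longlonglongrightarrow> mollify T U z - T\<^sup>2 * potential T \<rho> z"
      unfolding representation[OF smooth_tcd[OF u], of _ z T] mollify_def potential_def
      by (intro tendsto_intros avg_lim c)
  qed
  \<comment> \<open>The candidate gradient of \<open>U\<close>: the limit of the gradients of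
    \<open>u n\<close>, read off from the kernel formula.\<close>
  define G where "G h x = Re h * grad_kernel 1 U \<rho> x + Im h * grad_kernel \<i> U \<rho> x" for h x
  have contG: "continuous_on S (G h)" for h S
    unfolding G_def[abs_def] by (intro continuous_intros grad_kernel_continuous contU cont\<rho>)
  have dlim: "(\<lambda>n. dird h (u n) x) \<longlonglongrightarrow> G h x" for h x
    unfolding dird_linear[OF smooth_differentiable[OF u], of h]
    by (simp add: dird_representation u G_def) (unfold grad_kernel_def, intro tendsto_intros avg_lim c)
  have line: "((\<lambda>t. U (z + t *\<^sub>R h)) has_real_derivative G h (z + t *\<^sub>R h)) (at t)" for z h t
  proof -
    let ?g = "\<lambda>r. G h (z + r *\<^sub>R h)"
    have cg: "continuous_on S ?g" for S
      by (intro continuous_on_compose_UNIV[OF contG] continuous_intros)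
    \<comment> \<open>The fundamental theorem for \<open>u n\<close> passes to the limit by
      dominated convergence. Starting at \<open>t - 1\<close> makes \<open>t\<close> interior to the
      interval, so the derivative found is two-sided.\<close>
    have eq: "U (z + (t - 1) *\<^sub>R h) + integral {t - 1..s} ?g = U (z + s *\<^sub>R h)" if s: "s \<in> {t - 1..t + 1}" for s
    proof -
      define R where "R = cmod z + (\<bar>t\<bar> + 1) * cmod h"
      obtain L where L: "\<And>n x h. cmod x \<le> R \<Longrightarrow> \<bar>dird h (u n) x\<bar> \<le> L * norm h"
        using grad[of R] by blast
      have int: "((\<lambda>r. dird h (u n) (z + r *\<^sub>R h)) has_integral (u n (z + s *\<^sub>R h) - u n (z + (t - 1) *\<^sub>R h))) {t - 1..s}" for n
        using s line_derivative[OF smooth_differentiable[OF u]]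
        by (intro fundamental_theorem_of_calculus)
          (auto simp: has_real_derivative_iff_has_vector_derivative[symmetric])
      have "(\<lambda>n. integral {t - 1..s} (\<lambda>r. dird h (u n) (z + r *\<^sub>R h))) \<longlonglongrightarrow> integral {t - 1..s} ?g"
      proof (rule dominated_convergence(2))
        show "norm (dird h (u n) (z + r *\<^sub>R h)) \<le> L * norm h" if "r \<in> {t - 1..s}" for n r
        proof -
          have "\<bar>r\<bar> \<le> \<bar>t\<bar> + 1" using that s by auto
          then have "cmod (z + r *\<^sub>R h) \<le> R"
            unfolding R_def using norm_triangle_ineq[of z "r *\<^sub>R h"] mult_right_mono[of "\<bar>r\<bar>" "\<bar>t\<bar> + 1" "cmod h"] by simp
          then show ?thesis using L by simp
        qed
      qed (use int dlim in \<open>auto intro: has_integral_integrable\<close>)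
      moreover have "(\<lambda>n. integral {t - 1..s} (\<lambda>r. dird h (u n) (z + r *\<^sub>R h))) \<longlonglongrightarrow> U (z + s *\<^sub>R h) - U (z + (t - 1) *\<^sub>R h)"
        unfolding integral_unique[OF int] by (intro tendsto_intros lim)
      ultimately show ?thesis using LIMSEQ_unique by fastforce
    qed
    have "((\<lambda>s. integral {t - 1..s} ?g) has_real_derivative ?g t) (at t within {t - 1..t + 1})"
      by (rule integral_has_real_derivative[OF cg]) auto
    then have "((\<lambda>s. U (z + (t - 1) *\<^sub>R h) + integral {t - 1..s} ?g) has_real_derivative ?g t) (at t within {t - 1..t + 1})"
      by (auto intro!: derivative_eq_intros)
    then have "((\<lambda>s. U (z + s *\<^sub>R h)) has_real_derivative ?g t) (at t within {t - 1..t + 1})"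
      by (rule has_field_derivative_transform_within[where d = 1]) (use eq in auto)
    then show ?thesis by (simp add: at_within_Icc_at)
  qed
  have derU: "(U has_derivative (\<lambda>h. G h z)) (at z)" for z
    by (rule has_derivative_from_line[OF line _ contG contG]) (simp add: G_def)
  \<comment> \<open>The induction starts at one derivative because the gain lemmas need it; each
    round applies the identity at scale 1.\<close>
  have "tcd (Suc n) U" for n
  proof (induction n)
    case 0
    have "dird v U = G v" for v by (rule ext, rule dird_eq[OF derU])
    then show ?case using derU contG by (auto simp: tcd_Suc differentiable_def)
  next
    case (Suc n)
    have "tcd (Suc (Suc n)) (\<lambda>z. mollify 1 U z - potential 1 \<rho> z)"
      by (intro tcd_diff tcd_mollify_gain tcd_potential_gain Suc reg) auto
    moreover have "(\<lambda>z. mollify 1 U z - potential 1 \<rho> z) = U" using repr[of _ 1] by (simp add: fun_eq_iff)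
    ultimately show ?case by simp
  qed
  then show smU: "smooth U" by (meson smoothI tcd_Suc_imp)
  \<comment> \<open>\<open>U\<close> satisfies the identity with \<open>\<rho>\<close> by passage to
    the limit and with \<open>lap U\<close> by smoothness; at every scale the two potentials
    agree.\<close>
  have pot: "potential T (\<lambda>z. lap U z - \<rho> z) z = 0" "potential T (\<lambda>z. \<rho> z - lap U z) z = 0" if "T > 0" for T
  proof -
    have cl: "continuous_on UNIV (lap U)" by (rule smooth_continuous[OF lap_smooth[OF smU]])
    have "potential T (lap U) z = potential T \<rho> z"
      using repr[of z T] representation[OF smooth_tcd[OF smU], of z T] that by simp
    then show "potential T (\<lambda>z. lap U z - \<rho> z) z = 0" "potential T (\<lambda>z. \<rho> z - lap U z) z = 0"
      unfolding potential_def by (simp_all add: avg_diff c cl cont\<rho>)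
  qed
  have cd: "continuous_on UNIV (\<lambda>z. lap U z - \<rho> z)" "continuous_on UNIV (\<lambda>z. \<rho> z - lap U z)"
    by (intro continuous_intros smooth_continuous[OF lap_smooth[OF smU]] cont\<rho>)+
  show "lap U z = \<rho> z"
  proof (rule ccontr)
    assume "lap U z \<noteq> \<rho> z"
    then consider "lap U z - \<rho> z > 0" | "\<rho> z - lap U z > 0" by linarith
    then show False
      by cases (use pot potential_detects_positive[OF cd(1), of z] potential_detects_positive[OF cd(2), of z] in metis)+
  qed
qed

section \<open>The Keller-Osserman estimate\<close>

text \<open>The first derivative vanishes at the maximum; a positive \<open>l\<close> would make it
  positive just to the right, and \<open>f\<close> would increase there.\<close>

lemma second_derivative_nonpos_at_max:
  fixes f :: "real \<Rightarrow> real"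
  assumes d: "d > 0" and f: "\<And>t. \<bar>t\<bar> < d \<Longrightarrow> (f has_real_derivative f' t) (at t)"
    and f': "(f' has_real_derivative l) (at 0)" and mx: "\<And>t. \<bar>t\<bar> < d \<Longrightarrow> f t \<le> f 0"
  shows "l \<le> 0"
proof (rule ccontr)
  assume "\<not> l \<le> 0"
  then obtain e where e: "e > 0" "\<And>h. 0 < h \<Longrightarrow> h < e \<Longrightarrow> f' 0 < f' (0 + h)"
    using DERIV_pos_inc_right[OF f'] by force
  have f0: "f' 0 = 0"
    by (rule DERIV_local_max[OF f d]) (use d mx in auto)
  define h where "h = min d e / 2"
  have h: "0 < h" "h < d" "h < e" using d e by (auto simp: h_def)
  obtain x where x: "0 < x" "x < h" "f h - f 0 = (h - 0) * f' x"
    using MVT2[of 0 h f f'] h f by force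
  have "f' x > 0" using e(2)[of x] x h f0 by simp
  then have "f h > f 0" using x h by (metis diff_gt_0_iff_gt diff_zero mult_pos_pos)
  with mx[of h] h show False by simp
qed

text \<open>The barrier \<open>V\<close> satisfies \<open>lap V \<le> c * V^2\<close> and blows up
  at the boundary. If \<open>w p > V p\<close>, then \<open>w - V\<close> has a positive interior
  maximum, where \<open>lap w \<le> lap V \<le> c * V^2 < c * w^2 \<le> lap w\<close>.\<close>

lemma keller_osserman:
  fixes w :: "complex \<Rightarrow> real"
  assumes w: "tcd 2 w" and R: "R > 0" and c: "c > 0"
    and sub: "\<And>z. z \<in> ball p R \<Longrightarrow> w z > 0 \<Longrightarrow> c * (w z)\<^sup>2 \<le> lap w z"
  shows "w p \<le> 32 / (c * R\<^sup>2)"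
proof (rule ccontr)
  assume contra: "\<not> w p \<le> 32 / (c * R\<^sup>2)"
  have w2: "tcd (Suc (Suc 0)) w" using w by (simp add: numeral_2_eq_2)
  have cw: "continuous_on S w" for S by (rule tcd_continuous[OF w])
  \<comment> \<open>With \<open>s = R^2 - |z - p|^2\<close>, the Laplacian of \<open>A / s^2\<close>
    is \<open>(8 A s + 24 A |z - p|^2) / s^4\<close>, at most \<open>32 A R^2 / s^4\<close>. This
    equals \<open>c * A^2 / s^4\<close> for this \<open>A\<close>.\<close>
  define A where "A = 32 * R\<^sup>2 / c"
  have A: "A > 0" using R c by (simp add: A_def)
  obtain B where B: "B > 0" "\<And>z. z \<in> cball p R \<Longrightarrow> w z \<le> B"
  proof -
    obtain y where "\<And>z. z \<in> cball p R \<Longrightarrow> w z \<le> w y"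
      using continuous_attains_sup[OF compact_cball _ cw, of p R] R by fastforce
    then show ?thesis by (intro that[of "max 1 (w y)"]) (auto intro: max.coboundedI2)
  qed
  \<comment> \<open>On the circle where \<open>s = e\<close> the barrier \<open>A / e^2\<close> is
    at least \<open>2 * B\<close> and so exceeds \<open>w\<close>; the maximum over the smaller
    closed disc is then interior.\<close>
  define e where "e = min (R\<^sup>2 / 2) (sqrt (A / (2 * B)))"
  have "e \<le> R\<^sup>2 / 2" by (simp add: e_def)
  moreover have "0 < R\<^sup>2" using R by simp
  ultimately have "e < R\<^sup>2" by linarith
  moreover have "0 < e" using R A B(1) by (simp add: e_def)
  ultimately have e: "0 < e" "e < R\<^sup>2" by simp_all
  have "e\<^sup>2 \<le> (sqrt (A / (2 * B)))\<^sup>2" using e(1) by (intro power_mono) (auto simp: e_def)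
  also have "\<dots> = A / (2 * B)" using A B by simp
  finally have eB: "e\<^sup>2 * B < A" using A B(1) by (simp add: field_simps)
  define r where "r = sqrt (R\<^sup>2 - e)"
  have r: "0 < r" "r\<^sup>2 = R\<^sup>2 - e" using e by (auto simp: r_def)
  have rR: "r < R" using r e R by (metis diff_less_eq less_add_same_cancel1 power2_less_imp_less less_imp_le)
  define s where "s z = R\<^sup>2 - (norm (z - p))\<^sup>2" for z
  have s: "s z \<ge> e" if "z \<in> cball p r" for z
  proof -
    have "norm (z - p) \<le> r" using that by (simp add: dist_norm norm_minus_commute)
    then have "(norm (z - p))\<^sup>2 \<le> r\<^sup>2" by (intro power_mono) auto
    then show ?thesis using r by (simp add: s_def)
  qed
  define V where "V z = A / (s z)\<^sup>2" for z
  have "continuous_on (cball p r) (\<lambda>z. w z - V z)"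
    unfolding V_def s_def by (intro continuous_intros cw) (use s e in \<open>force simp: s_def\<close>)
  then obtain q where q: "q \<in> cball p r" "\<And>z. z \<in> cball p r \<Longrightarrow> w z - V z \<le> w q - V q"
    using continuous_attains_sup[OF compact_cball, of p r "\<lambda>z. w z - V z"] r by fastforce
  have "V p = 32 / (c * R\<^sup>2)" using R c by (simp add: V_def s_def A_def power2_eq_square field_simps)
  then have "w p - V p > 0" using contra by simp
  then have wq: "w q > V q" using q(2)[of p] r by simp
  have sq: "s q > 0" using s[OF q(1)] e by linarith
  have Vq: "V q > 0" using A sq by (simp add: V_def)
  have inner: "norm (q - p) < r"
  proof (rule ccontr)
    assume "\<not> norm (q - p) < r"
    then have "norm (q - p) = r" using q(1) by (simp add: dist_norm norm_minus_commute)
    then have "s q = e" using r by (simp add: s_def)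
    then have "V q > B" using eB e by (simp add: V_def field_simps)
    moreover have "w q \<le> B" using B q(1) rR by simp
    ultimately show False using wq by linarith
  qed
  let ?a = "q - p"
  have dd: "dird v (dird v w) q \<le> 4 * A / (s q)^3 + 24 * A * (?a \<bullet> v)\<^sup>2 / (s q)^4" if v: "norm v = 1" for v
  proof -
    let ?d = "r - norm ?a"
    have sv: "s (q + t *\<^sub>R v) = R\<^sup>2 - ((norm ?a)\<^sup>2 + 2 * t * (?a \<bullet> v) + t\<^sup>2)" for t
    proof -
      have "v \<bullet> v = 1" using v by (simp add: dot_square_norm)
      then have "(norm (q + t *\<^sub>R v - p))\<^sup>2 = (norm ?a)\<^sup>2 + 2 * t * (?a \<bullet> v) + t\<^sup>2"
        unfolding power2_norm_eq_inner
        by (simp add: inner_simps inner_commute power2_eq_square algebra_simps)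
      then show ?thesis by (simp add: s_def)
    qed
    have ins: "q + t *\<^sub>R v \<in> cball p r" if "\<bar>t\<bar> < ?d" for t
    proof -
      have "norm (?a + t *\<^sub>R v) \<le> norm ?a + \<bar>t\<bar>" using norm_triangle_ineq[of ?a "t *\<^sub>R v"] v by simp
      then show ?thesis using that by (simp add: dist_norm norm_minus_commute algebra_simps)
    qed
    have spos: "s (q + t *\<^sub>R v) > 0" if "\<bar>t\<bar> < ?d" for t
      using s[OF ins[OF that]] e by linarith
    have sder: "((\<lambda>t. s (q + t *\<^sub>R v)) has_real_derivative - (2 * (?a \<bullet> v) + 2 * t)) (at t)" for t
      unfolding sv by (auto intro!: derivative_eq_intros)
    have Vder: "((\<lambda>t. V (q + t *\<^sub>R v)) has_real_derivative 4 * A * (?a \<bullet> v + t) / (s (q + t *\<^sub>R v))^3) (at t)"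
      if "\<bar>t\<bar> < ?d" for t
      unfolding V_def using spos[OF that]
      by (auto intro!: derivative_eq_intros sder simp: field_simps power2_eq_square power3_eq_cube)
    have V2: "((\<lambda>t. 4 * A * (?a \<bullet> v + t) / (s (q + t *\<^sub>R v))^3) has_real_derivative
        4 * A / (s q)^3 + 24 * A * (?a \<bullet> v)\<^sup>2 / (s q)^4) (at 0)"
      using sq
      by (auto intro!: derivative_eq_intros sder simp: field_simps power2_eq_square power3_eq_cube power4_eq_xxxx)
    have "dird v (dird v w) (q + 0 *\<^sub>R v) - (4 * A / (s q)^3 + 24 * A * (?a \<bullet> v)\<^sup>2 / (s q)^4) \<le> 0"
    proof (rule second_derivative_nonpos_at_max[of ?d])
      show "((\<lambda>t. w (q + t *\<^sub>R v) - V (q + t *\<^sub>R v)) has_real_derivative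
         dird v w (q + t *\<^sub>R v) - 4 * A * (?a \<bullet> v + t) / (s (q + t *\<^sub>R v))^3) (at t)" if "\<bar>t\<bar> < ?d" for t
        by (intro DERIV_diff Vder[OF that] line_derivative tcd_differentiable[OF w2])
      show "((\<lambda>t. dird v w (q + t *\<^sub>R v) - 4 * A * (?a \<bullet> v + t) / (s (q + t *\<^sub>R v))^3) has_real_derivative
         dird v (dird v w) (q + 0 *\<^sub>R v) - (4 * A / (s q)^3 + 24 * A * (?a \<bullet> v)\<^sup>2 / (s q)^4)) (at 0)"
        by (intro DERIV_diff V2 line_derivative tcd_differentiable[OF tcd_dird[OF w2]])
      show "w (q + t *\<^sub>R v) - V (q + t *\<^sub>R v) \<le> w (q + 0 *\<^sub>R v) - V (q + 0 *\<^sub>R v)" if "\<bar>t\<bar> < ?d" for t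
        using q(2)[OF ins[OF that]] by simp
    qed (use inner in simp)
    then show ?thesis by simp
  qed
  have "lap w q \<le> (4 * A / (s q)^3 + 24 * A * (?a \<bullet> 1)\<^sup>2 / (s q)^4) + (4 * A / (s q)^3 + 24 * A * (?a \<bullet> \<i>)\<^sup>2 / (s q)^4)"
    unfolding lap_def by (intro add_mono dd) auto
  also have "\<dots> = (8 * A * s q + 24 * A * (norm ?a)\<^sup>2) / (s q)^4"
    using sq by (simp add: cmod_power2 inner_complex_def field_simps power3_eq_cube power4_eq_xxxx)
  also have "\<dots> \<le> (8 * A * R\<^sup>2 + 24 * A * R\<^sup>2) / (s q)^4"
    using A sq by (intro divide_right_mono add_mono mult_left_mono) (auto simp: s_def)
  also have "\<dots> = c * (V q)\<^sup>2"
    using c sq by (simp add: V_def A_def field_simps power2_eq_square power4_eq_xxxx)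
  also have "\<dots> < c * (w q)\<^sup>2" using c wq Vq by (intro mult_strict_left_mono power_strict_mono) auto
  also have "\<dots> \<le> lap w q" using sub[of q] wq Vq inner rR by (simp add: dist_norm norm_minus_commute)
  finally show False by simp
qed

text \<open>The local bound tends to 0 as the radius grows; the chosen radius makes it half of the
  supposed positive value.\<close>

lemma entire_keller_osserman:
  assumes w: "tcd 2 w" and c: "c > 0" and sub: "\<And>z. w z > 0 \<Longrightarrow> c * (w z)\<^sup>2 \<le> lap w z"
  shows "w p \<le> 0"
proof (rule ccontr)
  assume "\<not> w p \<le> 0"
  then have pos: "w p > 0" by simp
  define R where "R = sqrt (64 / (c * w p))"
  have R: "R > 0" "R\<^sup>2 = 64 / (c * w p)" using pos c by (auto simp: R_def)
  have "w p \<le> 32 / (c * R\<^sup>2)" by (rule keller_osserman[OF w R(1) c sub])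
  also have "\<dots> = w p / 2" using R c pos by simp
  finally show False using pos by simp
qed

section \<open>The vortex equation with bounded coefficient\<close>

lemma mollify_const: "mollify T (\<lambda>_. c) z = c"
  using representation[of "\<lambda>_. c" z T] avg_cmult[of T _ _ 0 "\<lambda>_. 0" z]
  by (simp add: potential_def)

definition potential_mass :: real
  where "potential_mass = integral prism (\<lambda>q. fst q * (1 - (fst q)\<^sup>2) * theta (snd q))"

lemma potential_const: "potential T (\<lambda>_. c) z = c * potential_mass"
  unfolding potential_def potential_mass_def avg_def by (simp add: mult.commute)

lemma weight_nonneg: "q \<in> prism \<Longrightarrow> 0 \<le> fst q * (1 - (fst q)\<^sup>2) * theta (snd q)"
  by (auto simp: prism_iff theta_nonneg power_le_one intro!: mult_nonneg_nonneg)

lemma potential_mass_pos: "potential_mass > 0"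
proof -
  obtain T where "T > 0" "potential T (\<lambda>_. 1) 0 \<noteq> 0"
    using potential_detects_positive[of "\<lambda>_. 1" 0] by auto
  then have "potential_mass \<noteq> 0" by (simp add: potential_const)
  moreover have "potential_mass \<ge> 0"
    unfolding potential_mass_def
    by (intro integral_nonneg weight_nonneg integrable_continuous continuous_intros
        kernel_continuous[THEN continuous_on_compose_UNIV])
  ultimately show ?thesis by simp
qed

lemma potential_mono:
  assumes "continuous_on UNIV f" "continuous_on UNIV g" "\<And>z. f z \<le> g z"
  shows "potential T f z \<le> potential T g z"
  unfolding potential_def avg_def
  by (intro integral_le avg_integrable weight_continuous kernel_continuous assms mult_left_mono weight_nonneg)

text \<open>The constant 12 is the largest for which the kernel of this averaging operator is nonnegative.\<close>

definition smear :: "real \<Rightarrow> (complex \<Rightarrow> real) \<Rightarrow> complex \<Rightarrow> real"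
  where "smear T g z = mollify T g z - 12 * potential T g z"

lemma smear_const: "smear T (\<lambda>_. c) z = c * (1 - 12 * potential_mass)"
  by (simp add: smear_def mollify_const potential_const algebra_simps)

text \<open>The combined kernel \<open>2 t eta - 12 t (1 - t^2) theta\<close> is nonnegative, by
  \<open>theta_le_eta\<close> and \<open>1 - t^2 \<le> 1\<close>.\<close>

lemma smear_mono:
  assumes "continuous_on UNIV f" "continuous_on UNIV g" "\<And>z. f z \<le> g z"
  shows "smear T f z \<le> smear T g z"
proof -
  note c = weight_continuous kernel_continuous
  have eq: "smear T h z = integral prism (\<lambda>q. (fst q * 2 * eta (snd q) - 12 * (fst q * (1 - (fst q)\<^sup>2) * theta (snd q)))
      * h (z + (T * fst q) *\<^sub>R snd q))" (is "_ = integral prism (?I h)")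
    if h: "continuous_on UNIV h" for h
  proof -
    have "smear T h z = integral prism (\<lambda>q. fst q * 2 * eta (snd q) * h (z + (T * fst q) *\<^sub>R snd q))
       - integral prism (\<lambda>q. 12 * (fst q * (1 - (fst q)\<^sup>2) * theta (snd q) * h (z + (T * fst q) *\<^sub>R snd q)))"
      by (simp add: smear_def mollify_def potential_def avg_def)
    also have "\<dots> = integral prism (\<lambda>q. fst q * 2 * eta (snd q) * h (z + (T * fst q) *\<^sub>R snd q)
       - 12 * (fst q * (1 - (fst q)\<^sup>2) * theta (snd q) * h (z + (T * fst q) *\<^sub>R snd q)))"
      by (subst integral_diff) (intro integrable_continuous continuous_intros c[THEN continuous_on_compose_UNIV]
          h[THEN continuous_on_compose_UNIV] | rule refl)+
    finally show ?thesis by (simp only: left_diff_distrib mult.assoc)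
  qed
  have pos: "0 \<le> fst q * 2 * eta (snd q) - 12 * (fst q * (1 - (fst q)\<^sup>2) * theta (snd q))" if "q \<in> prism" for q
  proof -
    have "(1 - (fst q)\<^sup>2) * theta (snd q) \<le> 1 * theta (snd q)"
      by (intro mult_right_mono theta_nonneg) simp
    then have "12 * ((1 - (fst q)\<^sup>2) * theta (snd q)) \<le> 2 * eta (snd q)"
      using theta_le_eta[of "snd q"] by linarith
    then have "fst q * (12 * ((1 - (fst q)\<^sup>2) * theta (snd q))) \<le> fst q * (2 * eta (snd q))"
      using that by (intro mult_left_mono) (auto simp: prism_iff)
    then show ?thesis by (simp add: algebra_simps)
  qed
  show ?thesis
    unfolding eq[OF assms(1)] eq[OF assms(2)]
    by (intro integral_le integrable_continuous continuous_intros c[THEN continuous_on_compose_UNIV]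
        assms(1,2)[THEN continuous_on_compose_UNIV] mult_left_mono assms(3) pos)
qed

lemma smear_bound:
  assumes "continuous_on UNIV g" "\<And>z. \<bar>g z\<bar> \<le> B"
  shows "\<bar>smear T g z\<bar> \<le> (1 - 12 * potential_mass) * B"
proof -
  have "g z \<le> B" "- B \<le> g z" for z using assms(2)[of z] by auto
  then have "smear T g z \<le> smear T (\<lambda>_. B) z" "smear T (\<lambda>_. - B) z \<le> smear T g z"
    using assms(1) by (auto intro!: smear_mono)
  then show ?thesis by (simp add: smear_const abs_le_iff algebra_simps)
qed

lemma smear_mass_nonneg: "0 \<le> 1 - 12 * potential_mass"
  using smear_mono[of "\<lambda>_. 0" "\<lambda>_. 1" 0 0] by (simp add: smear_const)

lemma tcd_smear: "tcd n g \<Longrightarrow> tcd n (smear T g)"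
  unfolding smear_def[abs_def] by (intro tcd_diff tcd_mult tcd_const tcd_mollify tcd_potential)

lemma smear_add:
  assumes "continuous_on UNIV f" "continuous_on UNIV g"
  shows "smear T (\<lambda>z. f z + g z) z = smear T f z + smear T g z"
  unfolding smear_def mollify_def potential_def
  by (simp add: avg_add weight_continuous kernel_continuous assms)

lemma smear_diff:
  assumes "continuous_on UNIV f" "continuous_on UNIV g"
  shows "smear T (\<lambda>z. f z - g z) z = smear T f z - smear T g z"
  unfolding smear_def mollify_def potential_def
  by (simp add: avg_diff weight_continuous kernel_continuous assms)

lemma smear_cmult: "smear T (\<lambda>z. c * g z) z = c * smear T g z"
  unfolding smear_def mollify_def potential_def by (simp add: avg_cmult algebra_simps)

lemma lap_potential: "tcd 2 g \<Longrightarrow> lap (potential T g) z = potential T (lap g) z"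
  and lap_mollify: "tcd 2 g \<Longrightarrow> lap (mollify T g) z = mollify T (lap g) z"
  unfolding potential_def mollify_def by (simp_all add: lap_avg weight_continuous kernel_continuous)

lemma lap_smear: "tcd 2 g \<Longrightarrow> lap (smear T g) z = smear T (lap g) z"
  unfolding smear_def[abs_def]
  by (simp add: lap_diff lap_cmult lap_mollify lap_potential tcd_mollify tcd_potential tcd_mult)

text \<open>\<open>12 * potential T g\<close> is subtracted inside \<open>smear\<close> and added
  back as \<open>T^2 * lam * potential T g\<close>. Both resulting operators preserve order.\<close>

lemma representation_smear:
  assumes g: "tcd 2 g" and T: "T\<^sup>2 * lam = 12"
  shows "g z = smear T g z + T\<^sup>2 * potential T (\<lambda>z. lam * g z - lap g z) z"
proof -
  have c: "continuous_on UNIV g" "continuous_on UNIV (\<lambda>z. lam * g z)" "continuous_on UNIV (lap g)"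
    using tcd_continuous[OF g] lap_continuous[OF g] by (auto intro: continuous_intros)
  have "potential T (\<lambda>z. lam * g z - lap g z) z = lam * potential T g z - potential T (lap g) z"
    unfolding potential_def by (simp add: avg_diff avg_cmult weight_continuous kernel_continuous c)
  then have "T\<^sup>2 * potential T (\<lambda>z. lam * g z - lap g z) z = 12 * potential T g z - T\<^sup>2 * potential T (lap g) z"
    by (simp add: right_diff_distrib mult.assoc[symmetric] T)
  then show ?thesis using representation[OF g, of z T] by (simp add: smear_def)
qed

text \<open>In the application \<open>\<kappa> = k - 1\<close> and \<open>a\<close> is the squared
  modulus of the polynomial or a bounded replacement for it.\<close>

definition vortex :: "real \<Rightarrow> (complex \<Rightarrow> real) \<Rightarrow> complex \<Rightarrow> real \<Rightarrow> real"
  where "vortex \<kappa> a z x = 2 * exp x - 2 * a z * exp (- \<kappa> * x)"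

lemma exp_diff_bounds:
  fixes x y :: real assumes "x \<le> y"
  shows "exp x * (y - x) \<le> exp y - exp x" "exp y - exp x \<le> exp y * (y - x)"
proof -
  have "exp x * (1 + (y - x)) \<le> exp x * exp (y - x)" by (intro mult_left_mono exp_ge_add_one_self) simp
  then show "exp x * (y - x) \<le> exp y - exp x" by (simp add: exp_add[symmetric] algebra_simps)
  have "exp y * (1 + (x - y)) \<le> exp y * exp (x - y)" by (intro mult_left_mono exp_ge_add_one_self) simp
  then show "exp y - exp x \<le> exp y * (y - x)" by (simp add: exp_add[symmetric] algebra_simps)
qed

text \<open>The term containing \<open>a\<close> is nondecreasing in \<open>x\<close>, so the
  exponential alone gives the lower bound.\<close>

lemma vortex_diff_lower:
  assumes "\<kappa> \<ge> 0" "a z \<ge> 0" "x \<le> y"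
  shows "2 * (exp y - exp x) \<le> vortex \<kappa> a z y - vortex \<kappa> a z x"
proof -
  have "a z * exp (- \<kappa> * y) \<le> a z * exp (- \<kappa> * x)"
    using assms by (intro mult_left_mono) (auto intro: mult_left_mono)
  then show ?thesis by (simp add: vortex_def)
qed

lemma vortex_diff_upper:
  assumes "\<kappa> \<ge> 0" "0 \<le> a z" "a z \<le> A" "m \<le> x" "x \<le> y" "y \<le> M"
  shows "vortex \<kappa> a z y - vortex \<kappa> a z x \<le> (2 * exp M + 2 * \<kappa> * A * exp (- \<kappa> * m)) * (y - x)"
proof -
  have "exp y * (y - x) \<le> exp M * (y - x)" using assms by (intro mult_right_mono) auto
  then have 1: "exp y - exp x \<le> exp M * (y - x)" using exp_diff_bounds(2)[OF \<open>x \<le> y\<close>] by linarith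
  have "exp (- \<kappa> * x) - exp (- \<kappa> * y) \<le> exp (- \<kappa> * x) * (\<kappa> * (y - x))"
    using exp_diff_bounds(2)[of "- \<kappa> * y" "- \<kappa> * x"] assms by (simp add: mult_left_mono algebra_simps)
  also have "\<dots> \<le> exp (- \<kappa> * m) * (\<kappa> * (y - x))"
    using assms by (intro mult_right_mono) (auto intro: mult_left_mono)
  finally have "a z * (exp (- \<kappa> * x) - exp (- \<kappa> * y)) \<le> a z * (exp (- \<kappa> * m) * (\<kappa> * (y - x)))"
    using assms by (intro mult_left_mono)
  also have "\<dots> \<le> A * (exp (- \<kappa> * m) * (\<kappa> * (y - x)))"
    using assms by (intro mult_right_mono mult_nonneg_nonneg) auto
  finally show ?thesis using 1 by (simp add: vortex_def algebra_simps)
qed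

lemma tcd_vortex: "tcd n a \<Longrightarrow> tcd n u \<Longrightarrow> tcd n (\<lambda>z. vortex \<kappa> a z (u z))"
  unfolding vortex_def by (intro tcd_intros)

text \<open>Monotone iteration from the subsolution \<open>s\<close> below the constant
  supersolution \<open>M\<close>. On \<open>[m, M]\<close> the nonlinearity has slope between
  \<open>\<delta>\<close> and \<open>lam\<close>, which gives both monotonicity and
  contraction.\<close>

lemma bounded_solution:
  fixes a s :: "complex \<Rightarrow> real"
  assumes \<kappa>: "\<kappa> \<ge> 0" and a: "smooth a" "\<And>z. 0 \<le> a z" "\<And>z. a z \<le> A"
    and s: "smooth s" "\<And>z. m \<le> s z" "\<And>z. s z \<le> M" "\<And>z. \<bar>lap s z\<bar> \<le> L"
    and sub: "\<And>z. vortex \<kappa> a z (s z) \<le> lap s z" and super: "\<And>z. 0 \<le> vortex \<kappa> a z M"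
  obtains u where "smooth u" "\<And>z. s z \<le> u z" "\<And>z. u z \<le> M" "\<And>z. lap u z = vortex \<kappa> a z (u z)"
proof -
  have mM: "m \<le> M" using s(2)[of 0] s(3)[of 0] by simp
  have A: "A \<ge> 0" using a(2)[of 0] a(3)[of 0] by simp
  define lam where "lam = 2 * exp M + 2 * \<kappa> * A * exp (- \<kappa> * m)"
  define \<delta> where "\<delta> = 2 * exp m"
  have "2 * exp m \<le> 2 * exp M" using mM by simp
  moreover have "0 \<le> 2 * \<kappa> * A * exp (- \<kappa> * m)" using \<kappa> A by simp
  ultimately have "\<delta> \<le> lam" unfolding lam_def \<delta>_def by linarith
  then have \<delta>: "0 < \<delta>" "\<delta> \<le> lam" by (simp_all add: \<delta>_def)
  define T where "T = sqrt (12 / lam)"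
  have lam: "lam > 0" and T: "T\<^sup>2 * lam = 12" using \<delta> by (auto simp: T_def)
  define \<Phi> where "\<Phi> z x = lam * x - vortex \<kappa> a z x" for z x
  have \<Phi>: "0 \<le> \<Phi> z y - \<Phi> z x" "\<Phi> z y - \<Phi> z x \<le> (lam - \<delta>) * (y - x)" if "m \<le> x" "x \<le> y" "y \<le> M" for z x y
  proof -
    show "0 \<le> \<Phi> z y - \<Phi> z x"
      using vortex_diff_upper[of \<kappa> a z A m x y M, OF \<kappa> a(2,3) that] by (simp add: \<Phi>_def lam_def algebra_simps)
    have "exp m * (y - x) \<le> exp x * (y - x)" using that by (intro mult_right_mono) auto
    then have "exp m * (y - x) \<le> exp y - exp x" using exp_diff_bounds(1)[OF that(2)] by linarith
    then show "\<Phi> z y - \<Phi> z x \<le> (lam - \<delta>) * (y - x)"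
      using vortex_diff_lower[of \<kappa> a z x y, OF \<kappa> a(2) that(2)] by (simp add: \<Phi>_def \<delta>_def algebra_simps)
  qed
  \<comment> \<open>By \<open>representation_smear\<close>, every solution between \<open>s\<close>
    and \<open>M\<close> is a fixed point of \<open>step\<close>.\<close>
  define step where "step u z = smear T u z + T\<^sup>2 * potential T (\<lambda>z. \<Phi> z (u z)) z" for u z
  \<comment> \<open>The contraction factor: \<open>smear\<close> contributes
    \<open>1 - 12 \<mu>\<close> and the potential \<open>T^2 (lam - \<delta>) \<mu>\<close>, where
    \<open>\<mu>\<close> is \<open>potential_mass\<close>; the terms with 12 cancel by the choice of
    \<open>T\<close>.\<close>
  define q where "q = 1 - \<delta> * T\<^sup>2 * potential_mass"
  have sm\<Phi>: "smooth (\<lambda>z. \<Phi> z (u z))" if "smooth u" for u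
    unfolding \<Phi>_def
    by (rule smoothI) (intro tcd_diff tcd_mult tcd_const tcd_vortex smooth_tcd a that)
  have sm_step: "smooth (step u)" if "smooth u" for u
    unfolding step_def[abs_def]
    by (rule smoothI) (intro tcd_add tcd_mult tcd_const tcd_smear tcd_potential smooth_tcd[OF sm\<Phi>] smooth_tcd that)
  have step_mono: "step u z \<le> step v z"
    if "smooth u" "smooth v" "\<And>z. m \<le> u z" "\<And>z. u z \<le> v z" "\<And>z. v z \<le> M" for u v z
  proof -
    have "\<Phi> z (u z) \<le> \<Phi> z (v z)" for z using \<Phi>(1)[of "u z" "v z" z] that by simp
    then show ?thesis unfolding step_def using that
      by (intro add_mono mult_left_mono smear_mono potential_mono smooth_continuous sm\<Phi>) auto
  qed
  have step_contract: "step v z - step u z \<le> q * D"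
    if uv: "smooth u" "smooth v" "\<And>z. m \<le> u z" "\<And>z. u z \<le> v z" "\<And>z. v z \<le> M" "\<And>z. v z - u z \<le> D" for u v z D
  proof -
    note c = smooth_continuous[OF uv(1)] smooth_continuous[OF uv(2)]
      smooth_continuous[OF sm\<Phi>[OF uv(1)]] smooth_continuous[OF sm\<Phi>[OF uv(2)]]
    have "smear T v z - smear T u z = smear T (\<lambda>z. v z - u z) z" by (simp add: smear_diff c)
    also have "\<dots> \<le> smear T (\<lambda>_. D) z" by (intro smear_mono continuous_intros c uv)
    finally have 1: "smear T v z - smear T u z \<le> D * (1 - 12 * potential_mass)" by (simp add: smear_const)
    have "potential T (\<lambda>z. \<Phi> z (v z)) z - potential T (\<lambda>z. \<Phi> z (u z)) z = potential T (\<lambda>z. \<Phi> z (v z) - \<Phi> z (u z)) z"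
      unfolding potential_def by (simp add: avg_diff weight_continuous kernel_continuous c)
    also have "\<dots> \<le> potential T (\<lambda>_. (lam - \<delta>) * D) z"
    proof (intro potential_mono continuous_intros c)
      fix z
      have "\<Phi> z (v z) - \<Phi> z (u z) \<le> (lam - \<delta>) * (v z - u z)" by (intro \<Phi>(2) uv)
      also have "\<dots> \<le> (lam - \<delta>) * D" using \<delta> uv(6) by (intro mult_left_mono) auto
      finally show "\<Phi> z (v z) - \<Phi> z (u z) \<le> (lam - \<delta>) * D" .
    qed
    finally have "T\<^sup>2 * (potential T (\<lambda>z. \<Phi> z (v z)) z - potential T (\<lambda>z. \<Phi> z (u z)) z) \<le> T\<^sup>2 * ((lam - \<delta>) * D * potential_mass)"
      by (intro mult_left_mono) (auto simp: potential_const)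
    also have "\<dots> = D * (12 * potential_mass) - \<delta> * T\<^sup>2 * potential_mass * D"
      using arg_cong[OF T, of "\<lambda>x. x * (D * potential_mass)"] by (simp add: algebra_simps)
    finally show ?thesis using 1 by (simp add: step_def q_def algebra_simps)
  qed
  have q01: "1 - 12 * potential_mass \<le> q" "q < 1"
  proof -
    have "\<delta> * T\<^sup>2 \<le> lam * T\<^sup>2" using \<delta> by (intro mult_right_mono) auto
    then have "\<delta> * T\<^sup>2 \<le> 12" using T by (simp add: mult.commute)
    then show "1 - 12 * potential_mass \<le> q"
      using mult_right_mono[of "\<delta> * T\<^sup>2" 12 potential_mass] potential_mass_pos by (simp add: q_def)
    have "T\<^sup>2 > 0" using lam by (simp add: T_def)
    then show "q < 1" using \<delta> potential_mass_pos by (simp add: q_def)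
  qed
  have q0: "q \<ge> 0" using q01 smear_mass_nonneg by linarith
  have s_step: "s z \<le> step s z" for z
  proof -
    have "s z = smear T s z + T\<^sup>2 * potential T (\<lambda>z. lam * s z - lap s z) z"
      by (rule representation_smear[OF smooth_tcd[OF s(1)] T])
    also have "\<dots> \<le> step s z"
      unfolding step_def using sub
      by (intro add_mono mult_left_mono potential_mono smooth_continuous sm\<Phi> s continuous_intros lap_smooth)
        (auto simp: \<Phi>_def)
    finally show ?thesis .
  qed
  have step_M: "step u z \<le> M" if "smooth u" "\<And>z. m \<le> u z" "\<And>z. u z \<le> M" for u z
  proof -
    have smM: "smooth (\<lambda>_ :: complex. M)" by (rule smoothI) simp
    have "potential T (\<lambda>z. \<Phi> z M) z \<le> potential T (\<lambda>_. lam * M) z"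
      by (intro potential_mono smooth_continuous[OF sm\<Phi>[OF smM]] continuous_on_const) (use super in \<open>simp add: \<Phi>_def\<close>)
    then have P: "T\<^sup>2 * potential T (\<lambda>z. \<Phi> z M) z \<le> T\<^sup>2 * (lam * M * potential_mass)"
      by (intro mult_left_mono) (simp_all add: potential_const)
    have "step u z \<le> step (\<lambda>_. M) z" by (intro step_mono that smM) simp
    also have "\<dots> \<le> M * (1 - 12 * potential_mass) + T\<^sup>2 * (lam * M * potential_mass)"
      using P by (simp add: step_def smear_const)
    also have "\<dots> = M"
      using arg_cong[OF T, of "\<lambda>x. x * (M * potential_mass)"] by (simp add: algebra_simps)
    finally show ?thesis .
  qed
  define u where "u n = (step ^^ n) s" for n
  have u0: "u 0 = s" and uS: "u (Suc n) = step (u n)" for n by (auto simp: u_def)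
  have smu: "smooth (u n)" for n by (induction n) (auto simp: u0 uS s sm_step)
  \<comment> \<open>Proved jointly, because monotonicity and contraction of \<open>step\<close> hold
    only for values in \<open>[m, M]\<close>.\<close>
  have inv: "(\<forall>z. s z \<le> u n z) \<and> (\<forall>z. u n z \<le> M) \<and> (\<forall>z. u n z \<le> u (Suc n) z)
      \<and> (\<forall>z. u (Suc n) z - u n z \<le> q ^ n * (M - m))" for n
  proof (induction n)
    case 0
    have "u (Suc 0) z \<le> M" for z unfolding uS u0 by (rule step_M) (use s in auto)
    then have "u (Suc 0) z - s z \<le> M - m" for z using s(2)[of z] by (meson diff_mono)
    then show ?case using s s_step by (simp add: u0 uS)
  next
    case (Suc n)
    then have b: "s z \<le> u n z" "u n z \<le> M" "u n z \<le> u (Suc n) z" "u (Suc n) z - u n z \<le> q ^ n * (M - m)" for z by auto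
    have mu: "m \<le> u n z" for z using b(1)[of z] s(2)[of z] by linarith
    have 1: "s z \<le> u (Suc n) z" for z using b(1,3)[of z] by linarith
    have mu1: "m \<le> u (Suc n) z" for z using 1[of z] s(2)[of z] by linarith
    have 2: "u (Suc n) z \<le> M" for z unfolding uS[of n] by (rule step_M[OF smu mu b(2)])
    have 3: "u (Suc n) z \<le> u (Suc (Suc n)) z" for z
      unfolding uS[of "Suc n"] by (subst uS) (rule step_mono[OF smu smu mu b(3) 2])
    have 4: "u (Suc (Suc n)) z - u (Suc n) z \<le> q * (q ^ n * (M - m))" for z
      using step_contract[OF smu smu mu b(3) 2 b(4), of z] by (simp add: uS)
    from 1 2 3 4 show ?case by (simp add: mult.assoc)
  qed
  then have us: "s z \<le> u n z" and uM: "u n z \<le> M" and uinc: "u n z \<le> u (Suc n) z"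
    and udiff: "u (Suc n) z - u n z \<le> q ^ n * (M - m)" for n z by auto
  have mu: "m \<le> u n z" for n z using us[where n = n and z = z] s(2)[of z] by linarith
  \<comment> \<open>The residual of the equation. Its convergence to 0 identifies the limit of the
    Laplacians, which convergence of \<open>u n\<close> alone does not give.\<close>
  define g where "g n z = lap (u n) z - vortex \<kappa> a z (u n z)" for n z
  have smg: "smooth (g n)" for n
    unfolding g_def[abs_def] by (rule smoothI) (intro tcd_diff tcd_vortex smooth_tcd lap_smooth smu a)
  have gS: "g (Suc n) z = smear T (g n) z + (\<Phi> z (u (Suc n) z) - \<Phi> z (u n z))" for n z
  proof -
    let ?\<Phi> = "\<lambda>z. \<Phi> z (u n z)"
    note t = smooth_tcd[OF smu[of n]] smooth_tcd[OF sm\<Phi>[OF smu[of n]]]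
    note c = smooth_continuous[OF smu[of n]] smooth_continuous[OF sm\<Phi>[OF smu[of n]]] smooth_continuous[OF lap_smooth[OF smu[of n]]]
    have "lap (step (u n)) z = lap (smear T (u n)) z + T\<^sup>2 * lap (potential T ?\<Phi>) z"
      unfolding step_def[abs_def] by (simp add: lap_add lap_cmult tcd_smear tcd_potential tcd_mult t)
    also have "\<dots> = smear T (lap (u n)) z + T\<^sup>2 * potential T (lap ?\<Phi>) z"
      by (simp add: lap_smear lap_potential t)
    \<comment> \<open>Applying the representation to \<open>?\<Phi>\<close> itself removes the
      Laplacian from under the potential.\<close>
    also have "T\<^sup>2 * potential T (lap ?\<Phi>) z = smear T ?\<Phi> z + lam * (T\<^sup>2 * potential T ?\<Phi> z) - ?\<Phi> z"
      using representation[OF t(2), of z T] T by (simp add: smear_def mult.assoc[symmetric] mult.commute)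
    also have "T\<^sup>2 * potential T ?\<Phi> z = u (Suc n) z - smear T (u n) z" by (simp add: uS step_def)
    finally have "lap (u (Suc n)) z = smear T (lap (u n)) z + smear T ?\<Phi> z - lam * smear T (u n) z + lam * u (Suc n) z - ?\<Phi> z"
      by (simp add: uS algebra_simps)
    moreover have "smear T (g n) z = smear T (lap (u n)) z + smear T ?\<Phi> z - lam * smear T (u n) z"
    proof -
      have "g n = (\<lambda>z. (lap (u n) z + ?\<Phi> z) - lam * u n z)" by (auto simp: g_def \<Phi>_def)
      moreover have "continuous_on UNIV (\<lambda>z. lap (u n) z + ?\<Phi> z)" "continuous_on UNIV (\<lambda>z. lam * u n z)"
        by (intro continuous_intros c)+
      ultimately show ?thesis by (simp add: smear_diff smear_add smear_cmult c)
    qed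
    ultimately show ?thesis by (simp add: g_def \<Phi>_def)
  qed
  define F0 where "F0 = 2 * exp M + 2 * A * exp (- \<kappa> * m)"
  have F0: "\<bar>vortex \<kappa> a z x\<bar> \<le> F0" if "m \<le> x" "x \<le> M" for z x
  proof -
    have "\<bar>vortex \<kappa> a z x\<bar> \<le> 2 * exp x + 2 * (a z * exp (- \<kappa> * x))"
      unfolding vortex_def using a(2)[of z] by (simp add: abs_le_iff)
    also have "\<dots> \<le> 2 * exp M + 2 * (A * exp (- \<kappa> * m))"
      using that a(2,3)[of z] \<kappa> by (intro add_mono mult_left_mono mult_mono) (auto intro: mult_left_mono)
    finally show ?thesis by (simp add: F0_def)
  qed
  \<comment> \<open>The recursion has factor \<open>q\<close> and a forcing term of order
    \<open>q^n\<close>; a rate strictly between \<open>q\<close> and 1 absorbs the resonance. The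
    constant \<open>D\<close> below covers the initial residual and the forcing.\<close>
  define r where "r = (1 + q) / 2"
  have r: "q < r" "0 < r" "r < 1" using q0 q01 by (auto simp: r_def)
  define D where "D = max (L + F0) (lam * (M - m) / (r - q))"
  have gb: "\<bar>g n z\<bar> \<le> D * r ^ n" for n z
  proof (induction n arbitrary: z)
    case 0
    have "\<bar>g 0 z\<bar> \<le> L + F0" using s(4)[of z] F0[of "s z" z, OF s(2,3)] by (simp add: g_def u0)
    then show ?case by (simp add: D_def)
  next
    case (Suc n)
    have D0: "0 \<le> D * r ^ n" using Suc[of 0] by linarith
    have "\<bar>smear T (g n) z\<bar> \<le> (1 - 12 * potential_mass) * (D * r ^ n)"
      by (rule smear_bound[OF smooth_continuous[OF smg] Suc])
    also have "\<dots> \<le> q * (D * r ^ n)" using q01 D0 by (intro mult_right_mono)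
    finally have 1: "\<bar>smear T (g n) z\<bar> \<le> q * (D * r ^ n)" .
    have "\<bar>\<Phi> z (u (Suc n) z) - \<Phi> z (u n z)\<bar> \<le> (lam - \<delta>) * (u (Suc n) z - u n z)"
      using \<Phi>[of "u n z" "u (Suc n) z" z, OF mu uinc uM] by simp
    also have "\<dots> \<le> lam * (q ^ n * (M - m))"
      using \<delta> udiff[of n z] uinc[of n z] by (intro mult_mono) auto
    also have "\<dots> \<le> lam * (r ^ n * (M - m))"
      using lam q0 r mM by (intro mult_left_mono mult_right_mono power_mono) auto
    also have "\<dots> = (lam * (M - m) / (r - q)) * ((r - q) * r ^ n)"
      using r by (simp add: field_simps)
    also have "\<dots> \<le> D * ((r - q) * r ^ n)"
      using r by (intro mult_right_mono) (auto simp: D_def)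
    finally show ?case using 1 gS[of n z] by (simp add: algebra_simps)
  qed
  have glim: "(\<lambda>n. g n z) \<longlonglongrightarrow> 0" for z
  proof (rule Lim_null_comparison[of _ "\<lambda>n. D * r ^ n"])
    show "(\<lambda>n. D * r ^ n) \<longlonglongrightarrow> 0" using r by (intro tendsto_mult_right_zero LIMSEQ_realpow_zero) auto
  qed (use gb in auto)
  define U where "U z = lim (\<lambda>n. u n z)" for z
  have ulim: "(\<lambda>n. u n z) \<longlonglongrightarrow> U z" for z
  proof -
    have "incseq (\<lambda>n. u n z)" by (rule incseq_SucI) (rule uinc)
    moreover have "bdd_above (range (\<lambda>n. u n z))" using uM by (intro bdd_aboveI[of _ M]) auto
    ultimately have "convergent (\<lambda>n. u n z)" using LIMSEQ_incseq_SUP[of "\<lambda>n. u n z"] unfolding convergent_def by blast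
    then show ?thesis by (simp add: U_def convergent_LIMSEQ_iff)
  qed
  have lapu: "lap (u n) z = vortex \<kappa> a z (u n z) + g n z" for n z by (simp add: g_def)
  have lim2: "(\<lambda>n. lap (u n) z) \<longlonglongrightarrow> vortex \<kappa> a z (U z)" for z
  proof -
    have "(\<lambda>n. vortex \<kappa> a z (u n z) + g n z) \<longlonglongrightarrow> vortex \<kappa> a z (U z) + 0"
      unfolding vortex_def by (intro tendsto_intros ulim glim)
    then show ?thesis by (simp add: lapu)
  qed
  have bd: "\<exists>B. \<forall>n z. cmod z \<le> R \<longrightarrow> \<bar>u n z\<bar> \<le> B \<and> \<bar>lap (u n) z\<bar> \<le> B" for R
  proof -
    have "\<bar>lap (u n) z\<bar> \<le> F0 + \<bar>D\<bar>" for n z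
    proof -
      have "\<bar>D\<bar> * r ^ n \<le> \<bar>D\<bar> * 1" using r by (intro mult_left_mono power_le_one) auto
      moreover have "D * r ^ n \<le> \<bar>D\<bar> * r ^ n" using r by (intro mult_right_mono) auto
      ultimately have "\<bar>g n z\<bar> \<le> \<bar>D\<bar>" using gb[of n z] by linarith
      then show ?thesis using F0[of "u n z" z, OF mu uM] unfolding lapu by linarith
    qed
    moreover have "\<bar>u n z\<bar> \<le> \<bar>m\<bar> + \<bar>M\<bar>" for n z
      using mu[of n z] uM[of n z] by linarith
    ultimately show ?thesis
      by (intro exI[of _ "max (F0 + \<bar>D\<bar>) (\<bar>m\<bar> + \<bar>M\<bar>)"]) (auto intro: max.coboundedI1 max.coboundedI2)
  qed
  have reg: "tcd n U \<Longrightarrow> tcd n (\<lambda>z. vortex \<kappa> a z (U z))" for n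
    by (rule tcd_vortex[OF smooth_tcd[OF a(1)]])
  note sol = limit_solution[OF smu ulim lim2 bd reg]
  show ?thesis
  proof (rule that)
    show "smooth U" by (rule sol(1))
    show "lap U z = vortex \<kappa> a z (U z)" for z by (rule sol(2))
    show "s z \<le> U z" for z by (rule LIMSEQ_le_const[OF ulim]) (use us in auto)
    show "U z \<le> M" for z by (rule LIMSEQ_le_const2[OF ulim]) (use uM in auto)
  qed
qed

section \<open>The vortex equation with polynomial coefficient\<close>

text \<open>The quadratic Taylor bound for \<open>exp (y - x)\<close>, multiplied by
  \<open>exp x\<close>; it supplies the square in the Keller-Osserman hypothesis.\<close>

lemma exp_gap:
  fixes x y m :: real
  assumes "m \<le> x" "x \<le> y"
  shows "exp m * (y - x)\<^sup>2 \<le> 2 * (exp y - exp x)"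
proof -
  have "1 + (y - x) + (y - x)\<^sup>2 / 2 \<le> exp (y - x)" using assms by (intro exp_lower_Taylor_quadratic) simp
  moreover have "0 \<le> y - x" using assms by simp
  ultimately have "(y - x)\<^sup>2 \<le> 2 * (exp (y - x) - 1)" by argo
  then have "exp m * (y - x)\<^sup>2 \<le> exp x * (2 * (exp (y - x) - 1))"
    using assms by (intro mult_mono) auto
  also have "\<dots> = 2 * (exp y - exp x)" by (simp add: algebra_simps flip: exp_add)
  finally show ?thesis .
qed

lemma vortex_antimono: "a z \<le> b z \<Longrightarrow> vortex \<kappa> b z x \<le> vortex \<kappa> a z x"
  by (simp add: vortex_def mult_right_mono)

text \<open>Where \<open>u > v\<close>, the difference satisfies the quadratic inequality with
  constant \<open>exp m\<close>. With \<open>a = b\<close> it yields uniqueness, with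
  \<open>a \<le> b\<close> monotone dependence on the coefficient.\<close>

lemma vortex_comparison:
  assumes \<kappa>: "\<kappa> \<ge> 0" and ab: "\<And>z. 0 \<le> a z" "\<And>z. a z \<le> b z"
    and u: "smooth u" "\<And>z. lap u z = vortex \<kappa> a z (u z)"
    and v: "smooth v" "\<And>z. lap v z = vortex \<kappa> b z (v z)" "\<And>z. m \<le> v z"
  shows "u z \<le> v z"
proof -
  have "u z - v z \<le> 0"
  proof (rule entire_keller_osserman[where w = "\<lambda>z. u z - v z" and c = "exp m"])
    show "tcd 2 (\<lambda>z. u z - v z)" by (intro tcd_diff smooth_tcd u v)
    fix z assume pos: "u z - v z > 0"
    have "exp m * (u z - v z)\<^sup>2 \<le> 2 * (exp (u z) - exp (v z))"
      using pos v(3) by (intro exp_gap) auto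
    also have "\<dots> \<le> vortex \<kappa> a z (u z) - vortex \<kappa> a z (v z)"
      using pos by (intro vortex_diff_lower \<kappa> ab) simp
    also have "\<dots> \<le> vortex \<kappa> a z (u z) - vortex \<kappa> b z (v z)"
      using vortex_antimono[of a z b, OF ab(2)] by simp
    also have "\<dots> = lap (\<lambda>z. u z - v z) z"
      by (simp add: lap_diff smooth_tcd u v)
    finally show "exp m * (u z - v z)\<^sup>2 \<le> lap (\<lambda>z. u z - v z) z" .
  qed simp
  then show ?thesis by simp
qed

section \<open>Nonpositive curvature of solutions bounded below\<close>

lemma lap_mult:
  assumes "tcd 2 f" "tcd 2 g"
  shows "lap (\<lambda>z. f z * g z) z = f z * lap g z + 2 * (dird 1 f z * dird 1 g z + dird \<i> f z * dird \<i> g z) + lap f z * g z"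
proof -
  have t: "tcd (Suc (Suc 0)) f" "tcd (Suc (Suc 0)) g" using assms by (simp_all add: numeral_2_eq_2)
  have d: "f differentiable (at z)" "g differentiable (at z)" "dird v f differentiable (at z)" "dird v g differentiable (at z)" for z v
    using tcd_differentiable[OF t(1)] tcd_differentiable[OF t(2)] tcd_differentiable[OF tcd_dird[OF t(1)]]
      tcd_differentiable[OF tcd_dird[OF t(2)]] by auto
  have 1: "dird v (\<lambda>z. f z * g z) = (\<lambda>z. f z * dird v g z + dird v f z * g z)" for v
    by (rule ext) (simp add: dird_mult d)
  have "dird v (\<lambda>z. f z * dird v g z + dird v f z * g z) z = dird v (\<lambda>z. f z * dird v g z) z + dird v (\<lambda>z. dird v f z * g z) z" for v
    by (intro dird_add differentiable_mult d)
  then show ?thesis unfolding lap_def 1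
    by (simp add: dird_mult d algebra_simps)
qed

lemma dird_exp:
  assumes "f differentiable (at z)" shows "dird v (\<lambda>z. exp (f z)) z = exp (f z) * dird v f z"
  by (rule dird_real_compose(1)[OF assms]) (rule DERIV_exp)

lemma lap_exp:
  assumes "tcd 2 f"
  shows "lap (\<lambda>z. exp (f z)) z = exp (f z) * (lap f z + (dird 1 f z)\<^sup>2 + (dird \<i> f z)\<^sup>2)"
proof -
  have t: "tcd (Suc (Suc 0)) f" using assms by (simp add: numeral_2_eq_2)
  have d: "f differentiable (at z)" "dird v f differentiable (at z)" "(\<lambda>z. exp (f z)) differentiable (at z)" for z v
    using tcd_differentiable[OF t] tcd_differentiable[OF tcd_dird[OF t]] tcd_differentiable[OF tcd_exp[OF t]] by auto
  have "dird v (\<lambda>z. exp (f z)) = (\<lambda>z. exp (f z) * dird v f z)" for v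
    by (rule ext) (simp add: dird_exp d)
  then show ?thesis unfolding lap_def
    by (simp add: dird_mult dird_exp d algebra_simps power2_eq_square)
qed

lemma lap_harmonic_poly: "lap (\<lambda>z. Re (poly p z)) z = 0" "lap (\<lambda>z. Im (poly p z)) z = 0"
  unfolding lap_def dird_Re_poly dird_Im_poly by (simp_all add: pderiv_smult)

lemma dird_cmod_poly:
  "dird v (\<lambda>z. (cmod (poly p z))\<^sup>2) z = 2 * (poly p z \<bullet> (v * poly (pderiv p) z))"
proof -
  have d: "(\<lambda>z. Re (poly p z)) differentiable (at z)" "(\<lambda>z. Im (poly p z)) differentiable (at z)" for z
    by (rule tcd_differentiable[OF tcd_poly(1)[of "Suc 0"]], rule tcd_differentiable[OF tcd_poly(2)[of "Suc 0"]])
  show ?thesis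
    unfolding cmod_power2 unfolding power2_eq_square
    by (simp add: dird_add dird_mult d dird_Re_poly dird_Im_poly inner_complex_def algebra_simps)
qed

lemma lap_cmod_poly: "lap (\<lambda>z. (cmod (poly p z))\<^sup>2) z = 4 * (cmod (poly (pderiv p) z))\<^sup>2"
  unfolding cmod_power2 unfolding power2_eq_square
  by (simp add: lap_add lap_mult lap_harmonic_poly tcd_poly tcd_mult dird_Re_poly dird_Im_poly algebra_simps)

text \<open>The function \<open>w\<close> is the squared norm of the differential minus 1. The
  equation reads \<open>lap u = - 2 exp u * w\<close>, and \<open>lap w\<close> is at least
  \<open>2 k exp u * w (w + 1)\<close>; where \<open>w > 0\<close> this dominates a multiple of
  \<open>w^2\<close>.\<close>

lemma vortex_curvature_bound:
  assumes k: "k \<ge> 1" and u: "smooth u" "\<And>z. m \<le> u z"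
    and eq: "\<And>z. lap u z = vortex (real k - 1) (\<lambda>z. (cmod (poly \<phi> z))\<^sup>2) z (u z)"
  shows "(cmod (poly \<phi> z))\<^sup>2 \<le> exp (real k * u z)"
proof -
  define E where "E z = exp (- real k * u z)" for z
  define P where "P z = (cmod (poly \<phi> z))\<^sup>2" for z
  define w where "w z = P z * E z - 1" for z
  have tu: "tcd n u" for n by (rule smooth_tcd[OF u(1)])
  have tE: "tcd n E" for n unfolding E_def by (intro tcd_exp tcd_mult tcd_const tu)
  have tP: "tcd n P" for n unfolding P_def by (rule tcd_cmod_poly)
  have tw: "tcd n w" for n unfolding w_def by (intro tcd_diff tcd_mult tcd_const tP tE)
  have ud: "u differentiable (at z)" for z by (rule smooth_differentiable[OF u(1)])
  have kud: "(\<lambda>z. - real k * u z) differentiable (at z)" for z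
    by (rule tcd_differentiable[of 0]) (intro tcd_mult tcd_const tu)
  have dE: "dird v E z = - real k * (dird v u z * E z)" for v z
    unfolding E_def using dird_exp[OF kud, of v z] dird_cmult[OF ud, of v "- real k" z] by simp
  have lE: "lap E z = E z * (- real k * lap u z + (real k)\<^sup>2 * ((dird 1 u z)\<^sup>2 + (dird \<i> u z)\<^sup>2))" for z
    unfolding E_def using lap_exp[of "\<lambda>z. - real k * u z" z] tcd_mult[OF tcd_const tu, of 2 "- real k"]
      lap_cmult[OF tu, of "- real k" z] dird_cmult[OF ud, of _ "- real k" z]
    by (simp add: algebra_simps power2_eq_square)
  have lap_ge: "- real k * P z * E z * lap u z \<le> lap w z" for z
  proof -
    let ?X = "Re (poly \<phi> z)" and ?Y = "Im (poly \<phi> z)" and ?A = "Re (poly (pderiv \<phi>) z)" and ?B = "Im (poly (pderiv \<phi>) z)"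
    let ?u1 = "dird 1 u z" and ?u2 = "dird \<i> u z" and ?k = "real k"
    have "lap w z = lap (\<lambda>z. P z * E z) z"
      unfolding w_def by (subst lap_diff) (auto intro: tcd_mult tP tE)
    also have "\<dots> = P z * lap E z + 2 * (dird 1 P z * dird 1 E z + dird \<i> P z * dird \<i> E z) + lap P z * E z"
      by (rule lap_mult[OF tP tE])
    \<comment> \<open>The two squares are the real and imaginary parts of
      \<open>2 \<phi>' - k \<phi> (u_x - \<i> u_y)\<close>. Completing the square in this form also
      works at zeros of \<open>\<phi>\<close>.\<close>
    also have "\<dots> = - ?k * P z * E z * lap u z
      + E z * ((2 * ?A - ?k * (?X * ?u1 + ?Y * ?u2))\<^sup>2 + (2 * ?B - ?k * (?Y * ?u1 - ?X * ?u2))\<^sup>2)"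
      unfolding lE dE unfolding P_def lap_cmod_poly dird_cmod_poly unfolding cmod_power2 inner_complex_def
      by (simp add: algebra_simps power2_eq_square)
    finally show ?thesis by (simp add: E_def)
  qed
  have "w z \<le> 0"
  proof (rule entire_keller_osserman[OF tw, where c = "2 * real k * exp m"])
    show "2 * real k * exp m > 0" using k by simp
    fix z assume pos: "w z > 0"
    have e: "lap u z = - 2 * exp (u z) * w z"
    proof -
      have "exp (- (real k - 1) * u z) = exp (u z) * E z"
        by (simp add: E_def algebra_simps flip: exp_add)
      then show ?thesis unfolding eq vortex_def P_def[symmetric] w_def by (simp add: algebra_simps)
    qed
    have "2 * real k * exp m * (w z)\<^sup>2 \<le> 2 * real k * exp (u z) * (w z * (w z + 1))"
      using pos u(2) by (intro mult_mono) (auto simp: power2_eq_square)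
    also have "\<dots> = - real k * P z * E z * lap u z"
      unfolding e by (simp add: w_def algebra_simps)
    also have "\<dots> \<le> lap w z" by (rule lap_ge)
    finally show "2 * real k * exp m * (w z)\<^sup>2 \<le> lap w z" .
  qed
  then show ?thesis by (simp add: w_def P_def E_def exp_minus field_simps)
qed

section \<open>Existence for a polynomial coefficient\<close>

lemma poly_lower_bound:
  fixes \<phi> :: "complex poly" assumes "\<phi> \<noteq> 0"
  obtains c R where "c > 0" "R > 0" "\<And>z. R \<le> cmod z \<Longrightarrow> c \<le> (cmod (poly \<phi> z))\<^sup>2"
proof (cases \<phi>)
  case (pCons a p)
  show ?thesis
  proof (cases "p = 0")
    case True
    with assms pCons have "a \<noteq> 0" by auto
    then show ?thesis using True pCons by (intro that[of "(cmod a)\<^sup>2" 1]) auto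
  next
    case False
    obtain r where r: "\<And>z. r \<le> cmod z \<Longrightarrow> 1 \<le> cmod (poly (pCons a p) z)"
      using poly_infinity[OF False, of 1 a] by blast
    show ?thesis
      by (rule that[of 1 "max r 1"]) (use r pCons in \<open>auto simp: one_le_power\<close>)
  qed
qed

lemma gaussian_laplacian:
  defines "E \<equiv> \<lambda>\<epsilon> z. exp (- \<epsilon> * (cmod z)\<^sup>2)"
  shows "smooth (E \<epsilon>)" "lap (E \<epsilon>) z = - 4 * \<epsilon> * (1 - \<epsilon> * (cmod z)\<^sup>2) * E \<epsilon> z"
proof -
  have eq: "(\<lambda>z. (cmod z)\<^sup>2) = (\<lambda>z. (cmod (poly [:0, 1:] z))\<^sup>2)" by simp
  have t: "tcd n (\<lambda>z. (cmod z)\<^sup>2)" for n unfolding eq by (rule tcd_cmod_poly)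
  show "smooth (E \<epsilon>)" unfolding E_def by (rule smoothI) (intro tcd_exp tcd_mult tcd_const t)
  have d: "(\<lambda>z. (cmod z)\<^sup>2) differentiable (at z)" by (rule tcd_differentiable[OF t])
  have l: "lap (\<lambda>z. (cmod z)\<^sup>2) z = 4" unfolding eq lap_cmod_poly by (simp add: pderiv_pCons)
  have d1: "dird v (\<lambda>z. (cmod z)\<^sup>2) z = 2 * (z \<bullet> v)" for v
    unfolding eq dird_cmod_poly by (simp add: pderiv_pCons)
  have n: "(cmod z)\<^sup>2 = (z \<bullet> 1)\<^sup>2 + (z \<bullet> \<i>)\<^sup>2" by (simp add: cmod_power2 inner_complex_def)
  show "lap (E \<epsilon>) z = - 4 * \<epsilon> * (1 - \<epsilon> * (cmod z)\<^sup>2) * E \<epsilon> z"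
    unfolding E_def
    apply (subst lap_exp, intro tcd_mult tcd_const t)
    unfolding dird_cmult[OF d] lap_cmult[OF t] l d1 n
    by (simp add: algebra_simps power2_eq_square)
qed

text \<open>Where \<open>a\<close> vanishes the nonlinearity is positive, so a constant fails;
  \<open>s\<close> needs a positive Laplacian on the disc where \<open>a\<close> may vanish. A
  negative Gaussian has it there, and far out the term with \<open>a\<close> compensates its
  negative Laplacian.\<close>

lemma vortex_subsolution:
  assumes c: "c > 0" and R: "R > 0" and a: "\<And>z. 0 \<le> a z" "\<And>z. R \<le> cmod z \<Longrightarrow> c \<le> a z" and \<kappa>: "\<kappa> \<ge> 0"
  obtains s m L where "smooth s" "\<And>z. m \<le> s z" "\<And>z. s z \<le> 0" "\<And>z. \<bar>lap s z\<bar> \<le> L"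
    "\<And>z. vortex \<kappa> a z (s z) \<le> lap s z"
proof -
  \<comment> \<open>The second bound puts the region where \<open>\<epsilon> |z|^2 > 1/2\<close>
    outside the disc of radius \<open>R\<close>; the first gives
    \<open>\<epsilon> - 2 c \<le> - 4 \<epsilon>\<close> there. \<open>N\<close> makes
    \<open>2 exp s \<le> \<epsilon>\<close> everywhere.\<close>
  define \<epsilon> where "\<epsilon> = min (2 * c / 5) (1 / (2 * R\<^sup>2))"
  have \<epsilon>: "\<epsilon> > 0" "5 * \<epsilon> \<le> 2 * c" "\<epsilon> \<le> 1 / (2 * R\<^sup>2)" using c R by (auto simp: \<epsilon>_def min_def)
  define N where "N = max 0 (- ln (\<epsilon> / 2))"
  have N: "N \<ge> 0" "2 * exp (- N) \<le> \<epsilon>"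
  proof -
    have "exp (- N) \<le> exp (ln (\<epsilon> / 2))" unfolding exp_le_cancel_iff by (auto simp: N_def)
    then show "2 * exp (- N) \<le> \<epsilon>" using \<epsilon> by simp
  qed (simp add: N_def)
  define E where "E z = exp (- \<epsilon> * (cmod z)\<^sup>2)" for z
  define s where "s z = - N - E z" for z
  have E01: "0 < E z" "E z \<le> 1" for z using \<epsilon> by (auto simp: E_def)
  have smE: "smooth E" unfolding E_def by (rule gaussian_laplacian(1))
  have lE: "lap E z = - 4 * \<epsilon> * (1 - \<epsilon> * (cmod z)\<^sup>2) * E z" for z
    unfolding E_def[abs_def] by (rule gaussian_laplacian(2))
  have ls: "lap s z = 4 * \<epsilon> * ((1 - \<epsilon> * (cmod z)\<^sup>2) * E z)" for z
    unfolding s_def using lap_diff[OF tcd_const smooth_tcd[OF smE], of "- N" z] by (simp add: lE)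
  have b: "\<bar>(1 - x) * exp (- x)\<bar> \<le> 1" if "x \<ge> 0" for x :: real
  proof -
    have "\<bar>1 - x\<bar> \<le> exp x" using exp_ge_add_one_self[of x] that by linarith
    then have "\<bar>1 - x\<bar> * exp (- x) \<le> exp x * exp (- x)" by (intro mult_right_mono) auto
    then show ?thesis by (simp add: abs_mult flip: exp_add)
  qed
  have lb: "\<bar>(1 - \<epsilon> * (cmod z)\<^sup>2) * E z\<bar> \<le> 1" for z
    unfolding E_def using b[of "\<epsilon> * (cmod z)\<^sup>2"] \<epsilon> by simp
  show ?thesis
  proof (rule that[of s "- N - 1" "4 * \<epsilon>"])
    show "smooth s" unfolding s_def by (rule smoothI) (intro tcd_diff tcd_const smooth_tcd smE)
    show s0: "s z \<le> 0" for z using N E01(1)[of z] by (simp add: s_def)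
    show "- N - 1 \<le> s z" for z using E01[of z] by (simp add: s_def)
    show "\<bar>lap s z\<bar> \<le> 4 * \<epsilon>" for z
      unfolding ls abs_mult[of "4 * \<epsilon>"] using mult_left_mono[OF lb, of "4 * \<epsilon>" z] \<epsilon> by simp
    have es: "2 * exp (s z) \<le> \<epsilon>" for z
    proof -
      have "exp (s z) \<le> exp (- N)" using E01[of z] by (simp add: s_def)
      with N show ?thesis by linarith
    qed
    show "vortex \<kappa> a z (s z) \<le> lap s z" for z
    proof (cases "\<epsilon> * (cmod z)\<^sup>2 \<le> 1 / 2")
      case True
      have "vortex \<kappa> a z (s z) \<le> \<epsilon>"
        using es[of z] mult_nonneg_nonneg[OF a(1)[of z] exp_ge_zero, of "- \<kappa> * s z"] unfolding vortex_def by linarith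
      moreover have "1/2 \<le> E z" using True exp_ge_add_one_self[of "- \<epsilon> * (cmod z)\<^sup>2"] unfolding E_def by linarith
      \<comment> \<open>Each factor is at least one half, so \<open>lap s \<ge> \<epsilon>\<close>,
        which already dominates \<open>2 exp s\<close>.\<close>
      then have "(1/2) * (1/2) \<le> (1 - \<epsilon> * (cmod z)\<^sup>2) * E z" using True by (intro mult_mono) auto
      then have "4 * \<epsilon> * (1/4) \<le> lap s z" unfolding ls using \<epsilon> by (intro mult_left_mono) auto
      ultimately show ?thesis by simp
    next
      case False
      have "R \<le> cmod z"
      proof (rule ccontr)
        assume "\<not> R \<le> cmod z"
        then have "(cmod z)\<^sup>2 \<le> R\<^sup>2" by (intro power_mono) auto
        then have "\<epsilon> * (cmod z)\<^sup>2 \<le> 1 / (2 * R\<^sup>2) * R\<^sup>2" using \<epsilon> by (intro mult_mono) auto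
        then show False using False R by simp
      qed
      then have "c * 1 \<le> a z * exp (- \<kappa> * s z)"
        using a s0[of z] \<kappa> c by (intro mult_mono) (auto simp: mult_nonneg_nonpos)
      then have "vortex \<kappa> a z (s z) \<le> - 4 * \<epsilon>" using es[of z] \<epsilon>(2) by (simp add: vortex_def)
      also have "\<dots> \<le> lap s z"
        using lb[of z] \<epsilon>(1) mult_left_mono[of "-1" "(1 - \<epsilon> * (cmod z)\<^sup>2) * E z" "4 * \<epsilon>"] unfolding ls by simp
      finally show ?thesis .
    qed
  qed
qed

text \<open>One subsolution for the smallest coefficient \<open>a 0\<close> serves all
  \<open>a n\<close>, giving a lower bound uniform in \<open>n\<close>. The suprema may grow with
  \<open>n\<close>, so the upper bound has to be local.\<close>

lemma vortex_solution:
  fixes \<phi> :: "complex poly"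
  assumes \<phi>: "\<phi> \<noteq> 0" and \<kappa>: "\<kappa> \<ge> 0"
  shows "\<exists>u m. smooth u \<and> (\<forall>z. m \<le> u z) \<and> (\<forall>z. lap u z = vortex \<kappa> (\<lambda>z. (cmod (poly \<phi> z))\<^sup>2) z (u z))"
proof -
  define P where "P z = (cmod (poly \<phi> z))\<^sup>2" for z
  have P0: "P z \<ge> 0" for z by (simp add: P_def)
  \<comment> \<open>Smooth and increasing in \<open>n\<close> to \<open>P\<close>, bounded by
    \<open>n + 1\<close>; the form in \<open>aeq\<close> makes monotonicity and the limit
    visible.\<close>
  define a where "a n z = real (Suc n) * P z * inverse (real (Suc n) + P z)" for n z
  have Jp: "real (Suc n) + P z > 0" for n z using P0[of z] by (simp add: add_pos_nonneg)
  have sma: "smooth (a n)" for n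
    unfolding a_def
  proof (rule smoothI, intro tcd_mult tcd_const tcd_inverse tcd_add)
    show "real (Suc n) + P z \<noteq> 0" for z using Jp[of n z] by simp
  qed (auto simp: P_def tcd_cmod_poly)
  have a0: "0 \<le> a n z" for n z unfolding a_def using P0 Jp[of n z] by (intro mult_nonneg_nonneg) auto
  have aJ: "a n z \<le> real (Suc n)" for n z
    unfolding a_def inverse_eq_divide using Jp[of n z] P0[of z] by (simp add: divide_le_eq mult_left_mono)
  have aeq: "a n z = P z - (P z)\<^sup>2 / (real (Suc n) + P z)" for n z
    using Jp[of n z] by (simp add: a_def field_simps power2_eq_square)
  have aP: "a n z \<le> P z" for n z
    unfolding aeq using Jp[of n z] by (simp add: less_imp_le)
  have amono: "a n z \<le> a (Suc n) z" for n z
    unfolding aeq using Jp[of n z] Jp[of "Suc n" z]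
    by (intro diff_left_mono divide_left_mono mult_pos_pos) auto
  have alim: "(\<lambda>n. a n z) \<longlonglongrightarrow> P z" for z
  proof -
    have "filterlim (\<lambda>n. real (Suc n) + P z) at_top sequentially"
      by (rule filterlim_at_top_mono[OF filterlim_real_sequentially]) (use P0[of z] in simp)
    then have "(\<lambda>n. P z - (P z)\<^sup>2 / (real (Suc n) + P z)) \<longlonglongrightarrow> P z - 0"
      by (intro tendsto_diff tendsto_const real_tendsto_divide_at_top[OF tendsto_const])
    then show ?thesis by (simp add: aeq)
  qed
  obtain c R where cR: "c > 0" "R > 0" "\<And>z. R \<le> cmod z \<Longrightarrow> c \<le> P z"
    unfolding P_def using poly_lower_bound[OF \<phi>] by metis
  have "\<exists>c'>0. \<forall>z. R \<le> cmod z \<longrightarrow> c' \<le> a 0 z"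
  proof (intro exI[of _ "c / (1 + c)"] conjI allI impI)
    show "c / (1 + c) \<le> a 0 z" if "R \<le> cmod z" for z
      unfolding a_def inverse_eq_divide using cR(1) cR(3)[OF that] P0[of z] by (simp add: divide_simps algebra_simps)
  qed (use cR in simp)
  then obtain c' where c': "c' > 0" "\<And>z. R \<le> cmod z \<Longrightarrow> c' \<le> a 0 z" by blast
  obtain s m L where s: "smooth s" "\<And>z. m \<le> s z" "\<And>z. s z \<le> 0" "\<And>z. \<bar>lap s z\<bar> \<le> L"
    "\<And>z. vortex \<kappa> (a 0) z (s z) \<le> lap s z"
    using vortex_subsolution[of c' R "a 0" \<kappa>, OF c'(1) cR(2) a0 c'(2) \<kappa>] by blast
  have amono0: "a 0 z \<le> a n z" for n z
    by (rule lift_Suc_mono_le[of "\<lambda>n. a n z", OF amono]) simp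
  have "\<exists>u. smooth u \<and> (\<forall>z. m \<le> u z) \<and> (\<forall>z. lap u z = vortex \<kappa> (a n) z (u z))" for n
  proof -
    \<comment> \<open>\<open>exp M = n + 1\<close> dominates \<open>a n\<close>, so the constant
      \<open>M\<close> is a supersolution, and \<open>M \<ge> 0\<close> places it above
      \<open>s\<close>.\<close>
    define M where "M = ln (real (Suc n))"
    have M: "M \<ge> 0" "exp M = real (Suc n)" by (auto simp: M_def)
    show ?thesis
    proof (rule bounded_solution[OF \<kappa> sma a0 aJ s(1) s(2) _ s(4)])
      show "s z \<le> M" for z using s(3)[of z] M by linarith
      show "vortex \<kappa> (a n) z (s z) \<le> lap s z" for z
        using vortex_antimono[of "a 0" z "a n" \<kappa> "s z", OF amono0] s(5)[of z] by linarith
      show "0 \<le> vortex \<kappa> (a n) z M" for z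
      proof -
        have "a n z * exp (- \<kappa> * M) \<le> real (Suc n) * 1"
          using aJ[of n z] a0[of n z] \<kappa> M by (intro mult_mono) auto
        then show ?thesis by (simp add: vortex_def M)
      qed
      fix u assume u: "smooth u" "\<And>z. s z \<le> u z" "\<And>z. lap u z = vortex \<kappa> (a n) z (u z)"
      have "m \<le> u z" for z using s(2)[of z] u(2)[of z] by linarith
      with u show ?thesis by blast
    qed
  qed
  then obtain u where smu: "\<And>n. smooth (u n)" and mu: "\<And>n z. m \<le> u n z"
    and eq: "\<And>n z. lap (u n) z = vortex \<kappa> (a n) z (u n z)" by metis
  have uinc: "u n z \<le> u (Suc n) z" for n z
    by (rule vortex_comparison[OF \<kappa> a0 amono smu eq smu eq mu])
  \<comment> \<open>Where \<open>u n\<close> exceeds \<open>b\<close>, with \<open>exp b\<close> at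
    least 1 and at least \<open>P\<close> nearby, its Laplacian is at least
    \<open>(u n - b)^2\<close>. The unit-disc estimate then gives \<open>b + 32\<close> for every
    \<open>n\<close>.\<close>
  have ub: "\<exists>B. \<forall>n z. cmod z \<le> R \<longrightarrow> u n z \<le> B \<and> P z \<le> B" for R
  proof -
    have cP: "continuous_on S P" for S unfolding P_def by (rule tcd_continuous[OF tcd_cmod_poly])
    have "bounded (P ` cball 0 (R + 1))"
      by (intro compact_imp_bounded compact_continuous_image cP compact_cball)
    then obtain B0 where B0: "\<And>z. z \<in> cball 0 (R + 1) \<Longrightarrow> \<bar>P z\<bar> \<le> B0"
      unfolding bounded_iff by (metis imageI real_norm_def)
    define B where "B = max 1 B0"
    have B: "B \<ge> 1" "\<And>z. cmod z \<le> R + 1 \<Longrightarrow> P z \<le> B" using B0 by (fastforce simp: B_def)+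
    define b where "b = ln B"
    have b: "b \<ge> 0" "exp b = B" using B by (auto simp: b_def)
    have "u n z \<le> b + 32" if z: "cmod z \<le> R" for n z
    proof -
      have "u n z - b \<le> 32 / (1 * 1\<^sup>2)"
      proof (rule keller_osserman[where w = "\<lambda>z. u n z - b"])
        show "tcd 2 (\<lambda>z. u n z - b)" by (intro tcd_diff tcd_const smooth_tcd smu)
        fix y assume y: "y \<in> ball z 1" and pos: "0 < u n y - b"
        have "cmod y \<le> cmod z + cmod (z - y)" by (metis norm_minus_commute norm_triangle_sub)
        then have "P y \<le> B" using y z by (intro B) (simp add: dist_norm)
        then have "a n y * exp (- \<kappa> * u n y) \<le> B * 1"
          using aP[of n y] a0[of n y] pos b \<kappa> B(1) by (intro mult_mono) auto
        then have 1: "2 * (exp (u n y) - exp b) \<le> lap (u n) y" unfolding eq vortex_def b by simp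
        have "1 * (u n y - b)\<^sup>2 \<le> exp b * (u n y - b)\<^sup>2" using B b by (intro mult_right_mono) auto
        also have "\<dots> \<le> 2 * (exp (u n y) - exp b)" using pos by (intro exp_gap) auto
        finally show "1 * (u n y - b)\<^sup>2 \<le> lap (\<lambda>z. u n z - b) y"
          using 1 by (simp add: lap_diff smooth_tcd smu)
      qed auto
      then show ?thesis by simp
    qed
    moreover have "P z \<le> B" if "cmod z \<le> R" for z using B that by simp
    ultimately show ?thesis by (intro exI[of _ "max (b + 32) B"]) (auto intro: max.coboundedI1 max.coboundedI2)
  qed
  define U where "U z = lim (\<lambda>n. u n z)" for z
  have ulim: "(\<lambda>n. u n z) \<longlonglongrightarrow> U z" for z
  proof -
    have "incseq (\<lambda>n. u n z)" by (rule incseq_SucI) (rule uinc)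
    moreover have "bdd_above (range (\<lambda>n. u n z))"
      using ub[of "cmod z"] unfolding bdd_above_def by auto
    ultimately have "convergent (\<lambda>n. u n z)"
      using LIMSEQ_incseq_SUP[of "\<lambda>n. u n z"] unfolding convergent_def by blast
    then show ?thesis by (simp add: U_def convergent_LIMSEQ_iff)
  qed
  have lim2: "(\<lambda>n. lap (u n) z) \<longlonglongrightarrow> vortex \<kappa> P z (U z)" for z
    unfolding eq unfolding vortex_def by (intro tendsto_intros ulim alim)
  have bd: "\<exists>B. \<forall>n z. cmod z \<le> R \<longrightarrow> \<bar>u n z\<bar> \<le> B \<and> \<bar>lap (u n) z\<bar> \<le> B" for R
  proof -
    obtain B where B: "\<And>n z. cmod z \<le> R \<Longrightarrow> u n z \<le> B \<and> P z \<le> B" using ub[of R] by blast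
    have "\<bar>lap (u n) z\<bar> \<le> 2 * exp B + 2 * (B * exp (- \<kappa> * m))" if z: "cmod z \<le> R" for n z
    proof -
      have "0 \<le> B" using B[OF z, of n] P0[of z] by linarith
      have "\<bar>lap (u n) z\<bar> \<le> 2 * exp (u n z) + 2 * (a n z * exp (- \<kappa> * u n z))"
        unfolding eq vortex_def using a0[of n z] by (simp add: abs_le_iff)
      also have "\<dots> \<le> 2 * exp B + 2 * (B * exp (- \<kappa> * m))"
        using B[OF z, of n] aP[of n z] a0[of n z] \<kappa> mu[of n z] \<open>0 \<le> B\<close>
        by (intro add_mono mult_left_mono mult_mono) (auto intro: mult_left_mono)
      finally show ?thesis .
    qed
    moreover have "\<bar>u n z\<bar> \<le> \<bar>m\<bar> + \<bar>B\<bar>" if "cmod z \<le> R" for n z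
      using mu[of n z] B[OF that, of n] by linarith
    ultimately show ?thesis
      by (intro exI[of _ "max (2 * exp B + 2 * (B * exp (- \<kappa> * m))) (\<bar>m\<bar> + \<bar>B\<bar>)"])
        (auto intro: max.coboundedI1 max.coboundedI2)
  qed
  have reg: "tcd n U \<Longrightarrow> tcd n (\<lambda>z. vortex \<kappa> P z (U z))" for n
    unfolding P_def by (rule tcd_vortex[OF tcd_cmod_poly])
  note sol = limit_solution[OF smu ulim lim2 bd reg]
  show ?thesis
  proof (intro exI conjI allI)
    show "smooth U" by (rule sol(1))
    show "lap U z = vortex \<kappa> (\<lambda>z. (cmod (poly \<phi> z))\<^sup>2) z (U z)" for z
      using sol(2)[of z] by (simp only: P_def[abs_def])
    show "m \<le> U z" for z by (rule LIMSEQ_le_const[OF ulim]) (use mu in auto)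
  qed
qed

section \<open>The conformal metric\<close>

text \<open>With \<open>\<sigma> = exp u\<close>, multiplying the curvature equation by
  \<open>- 2 exp u\<close> gives the vortex equation; the exponent \<open>- k u\<close> becomes
  \<open>- (k - 1) u\<close>.\<close>

lemma vortex_metric_iff:
  assumes k: "k \<ge> 1" and u: "smooth u"
  shows "gauss_curvature (\<lambda>z. exp (u z)) z = - 1 + (differential_norm k f (\<lambda>z. exp (u z)) z)\<^sup>2 \<longleftrightarrow>
    lap u z = vortex (real k - 1) (\<lambda>z. (cmod (f z))\<^sup>2) z (u z)"
    and "(differential_norm k f (\<lambda>z. exp (u z)) z)\<^sup>2 = exp (- real k * u z) * (cmod (f z))\<^sup>2"
proof -
  have "(exp (u z) powr (- real k / 2))\<^sup>2 = exp (- real k * u z)"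
    by (simp add: powr_def power2_eq_square flip: exp_add)
  then show d: "(differential_norm k f (\<lambda>z. exp (u z)) z)\<^sup>2 = exp (- real k * u z) * (cmod (f z))\<^sup>2"
    by (simp add: differential_norm_def power_mult_distrib)
  have g: "gauss_curvature (\<lambda>z. exp (u z)) z = - lap u z / (2 * exp (u z))"
    using Re_laplacian[OF smooth_tcd[OF u], of z] by (simp add: gauss_curvature_def)
  have "exp (- (real k - 1) * u z) = exp (u z) * exp (- real k * u z)"
    by (simp add: algebra_simps flip: exp_add)
  then have v: "vortex (real k - 1) (\<lambda>z. (cmod (f z))\<^sup>2) z (u z) = 2 * exp (u z) * (1 - exp (- real k * u z) * (cmod (f z))\<^sup>2)"
    by (simp add: vortex_def algebra_simps)
  show "gauss_curvature (\<lambda>z. exp (u z)) z = - 1 + (differential_norm k f (\<lambda>z. exp (u z)) z)\<^sup>2 \<longleftrightarrow>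
    lap u z = vortex (real k - 1) (\<lambda>z. (cmod (f z))\<^sup>2) z (u z)"
    unfolding g d v by (simp add: field_simps) argo
qed

section \<open>Completeness and lower bounds\<close>

lemma conformal_dist_ge:
  assumes \<sigma>: "conformal_metric \<sigma>" and c: "c > 0" "\<And>z. c \<le> \<sigma> z"
  shows "sqrt c * dist x y \<le> conformal_dist \<sigma> x y"
  unfolding conformal_dist_def
  by (intro cINF_greatest connecting_curves_nonempty \<sigma> curve_length_lower_bound c)

lemma conformal_dist_le_segment:
  assumes \<sigma>: "conformal_metric \<sigma>" and C: "\<And>z. z \<in> closed_segment x y \<Longrightarrow> \<sigma> z \<le> C"
  shows "conformal_dist \<sigma> x y \<le> sqrt C * dist x y"
proof -
  have l: "linepath x y \<in> connecting_curves \<sigma> x y" by (rule linepath_in_connecting_curves[OF \<sigma>])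
  have "conformal_dist \<sigma> x y \<le> curve_length \<sigma> (linepath x y)" by (rule conformal_dist_le[OF \<sigma> l])
  also have "\<dots> \<le> integral {0..1} (\<lambda>t::real. sqrt C * dist x y)"
    unfolding curve_length_def
  proof (rule integral_le)
    show "speed \<sigma> (linepath x y) integrable_on {0..1}" using l by (simp add: connecting_curves_def)
    fix t :: real assume "t \<in> {0..1}"
    then have "linepath x y t \<in> closed_segment x y" by (metis linepath_in_path)
    then show "speed \<sigma> (linepath x y) t \<le> sqrt C * dist x y"
      using C by (auto simp: speed_def dist_norm norm_minus_commute intro!: mult_right_mono)
  qed auto
  finally show ?thesis by simp
qed

text \<open>The lower bound makes Cauchy sequences Euclidean Cauchy. Near the Euclidean limit
  \<open>\<sigma>\<close> is bounded above, and segments then show convergence in the conformal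
  distance.\<close>

lemma complete_metric_if_bounded_below:
  assumes \<sigma>: "conformal_metric \<sigma>" and c: "c > 0" "\<And>z. c \<le> \<sigma> z"
  shows "complete_metric \<sigma>"
proof -
  interpret Metric_space UNIV "conformal_dist \<sigma>" by (rule Metric_space_conformal_dist[OF \<sigma>])
  have "\<exists>l. limitin mtopology x l sequentially" if x: "MCauchy x" for x
  proof -
    have "Cauchy x"
      unfolding Cauchy_def
    proof (intro allI impI)
      fix e :: real assume "e > 0"
      then have "sqrt c * e > 0" using c by simp
      then obtain N where N: "\<And>m n. N \<le> m \<Longrightarrow> N \<le> n \<Longrightarrow> conformal_dist \<sigma> (x m) (x n) < sqrt c * e"
        using x unfolding MCauchy_def by blast
      have "dist (x m) (x n) < e" if "m \<ge> N" "n \<ge> N" for m n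
      proof -
        have "sqrt c * dist (x m) (x n) < sqrt c * e"
          using N[OF that] conformal_dist_ge[OF \<sigma> c, of "x m" "x n"] by linarith
        then show ?thesis using c by simp
      qed
      then show "\<exists>M. \<forall>m\<ge>M. \<forall>n\<ge>M. dist (x m) (x n) < e" by blast
    qed
    then obtain l where l: "x \<longlonglongrightarrow> l" using Cauchy_convergent_iff convergent_def by blast
    obtain y where y: "\<And>z. z \<in> cball l 1 \<Longrightarrow> \<sigma> z \<le> \<sigma> y"
      using continuous_attains_sup[OF compact_cball _ conformal_metric_continuous[OF \<sigma>], of l 1] by fastforce
    have d0: "(\<lambda>n. dist (x n) l) \<longlonglongrightarrow> 0" by (rule tendsto_dist_iff[THEN iffD1, OF l])
    have "(\<lambda>n. conformal_dist \<sigma> (x n) l) \<longlonglongrightarrow> 0"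
    proof (rule Lim_null_comparison)
      show "(\<lambda>n. sqrt (\<sigma> y) * dist (x n) l) \<longlonglongrightarrow> 0" by (rule tendsto_mult_right_zero[OF d0])
      have "\<forall>\<^sub>F n in sequentially. dist (x n) l < 1" using l by (simp add: tendsto_iff)
      then show "\<forall>\<^sub>F n in sequentially. norm (conformal_dist \<sigma> (x n) l) \<le> sqrt (\<sigma> y) * dist (x n) l"
      proof eventually_elim
        case (elim n)
        then have "closed_segment (x n) l \<subseteq> cball l 1"
          by (intro closed_segment_subset convex_cball) (auto simp: dist_commute)
        then have "\<sigma> z \<le> \<sigma> y" if "z \<in> closed_segment (x n) l" for z using y that by blast
        from conformal_dist_le_segment[OF \<sigma> this] show ?case by simp
      qed
    qed
    then show ?thesis unfolding limitin_metric_dist_null by auto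
  qed
  then show ?thesis unfolding complete_metric_def mcomplete_def by blast
qed

text \<open>Far out the polynomial is bounded away from 0, so \<open>exp (k * u)\<close> is at least
  some \<open>c > 0\<close>; the remaining disc is compact.\<close>

lemma nonpositively_curved_bounded_below:
  fixes \<phi> :: "complex poly"
  assumes k: "k \<ge> 1" and \<phi>: "\<phi> \<noteq> 0" and u: "smooth u"
    and le: "\<And>z. (cmod (poly \<phi> z))\<^sup>2 \<le> exp (real k * u z)"
  obtains m where "\<And>z. m \<le> u z"
proof -
  obtain c R where cR: "c > 0" "R > 0" "\<And>z. R \<le> cmod z \<Longrightarrow> c \<le> (cmod (poly \<phi> z))\<^sup>2"
    using poly_lower_bound[OF \<phi>] by blast
  obtain y where y: "\<And>z. z \<in> cball 0 R \<Longrightarrow> u y \<le> u z"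
    using continuous_attains_inf[OF compact_cball _ smooth_continuous[OF u], of 0 R] cR(2) by fastforce
  show ?thesis
  proof (rule that)
    show "min (u y) (ln c / real k) \<le> u z" for z
    proof (cases "cmod z \<le> R")
      case True then show ?thesis using y[of z] by simp
    next
      case False
      then have "c \<le> exp (real k * u z)" using cR(3)[of z] le[of z] by simp
      then have "ln c \<le> real k * u z" using cR(1) using ln_le_cancel_iff[of c "exp (real k * u z)"] by simp
      then show ?thesis using k by (simp add: min_le_iff_disj divide_le_eq mult.commute)
    qed
  qed
qed

theorem theorem2:
  fixes k :: nat and \<phi> :: "complex poly"
  assumes "k \<ge> 1" and "\<phi> \<noteq> 0"
  shows "\<exists>!\<sigma> :: complex \<Rightarrow> real.
    conformal_metric \<sigma> \<and> complete_metric \<sigma> \<and> nonpositively_curved \<sigma> \<and>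
    (\<forall>z. gauss_curvature \<sigma> z = - 1 + (differential_norm k (poly \<phi>) \<sigma> z)\<^sup>2)"
proof -
  let ?P = "\<lambda>z. (cmod (poly \<phi> z))\<^sup>2"
  have k0: "real k - 1 \<ge> 0" using assms(1) by simp
  obtain u m where u: "smooth u" "\<And>z. m \<le> u z" "\<And>z. lap u z = vortex (real k - 1) ?P z (u z)"
    using vortex_solution[OF assms(2) k0] by blast
  let ?\<sigma> = "\<lambda>z. exp (u z)"
  have conf: "conformal_metric ?\<sigma>"
    unfolding conformal_metric_def by (simp, rule smoothI, rule tcd_exp[OF smooth_tcd[OF u(1)]])
  have curv: "gauss_curvature ?\<sigma> z = - 1 + (differential_norm k (poly \<phi>) ?\<sigma> z)\<^sup>2" for z
    using vortex_metric_iff(1)[OF assms(1) u(1)] u(3) by blast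
  show ?thesis
  proof (rule ex1I[of _ ?\<sigma>], intro conjI allI)
    show "conformal_metric ?\<sigma>" by (rule conf)
    show "complete_metric ?\<sigma>"
      by (rule complete_metric_if_bounded_below[OF conf, of "exp m"]) (use u in auto)
    show "nonpositively_curved ?\<sigma>"
      unfolding nonpositively_curved_def
    proof
      fix z
      have "?P z \<le> exp (real k * u z)" by (rule vortex_curvature_bound[OF assms(1) u])
      then show "gauss_curvature ?\<sigma> z \<le> 0"
        unfolding curv vortex_metric_iff(2)[OF assms(1) u(1)] by (simp add: exp_minus field_simps)
    qed
    show "gauss_curvature ?\<sigma> z = - 1 + (differential_norm k (poly \<phi>) ?\<sigma> z)\<^sup>2" for z by (rule curv)
  next
    fix \<tau> assume \<tau>: "conformal_metric \<tau> \<and> complete_metric \<tau> \<and> nonpositively_curved \<tau> \<and>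
      (\<forall>z. gauss_curvature \<tau> z = - 1 + (differential_norm k (poly \<phi>) \<tau> z)\<^sup>2)"
    define v where "v z = ln (\<tau> z)" for z
    have pos: "\<tau> z > 0" for z using \<tau> conformal_metric_pos by blast
    have v: "smooth v" unfolding v_def
      by (rule smoothI, rule tcd_ln[OF pos smooth_tcd]) (use \<tau> in \<open>simp add: conformal_metric_def\<close>)
    have \<tau>v: "\<tau> = (\<lambda>z. exp (v z))" using pos by (simp add: v_def)
    have lv: "lap v z = vortex (real k - 1) ?P z (v z)" for z
      using \<tau> vortex_metric_iff(1)[OF assms(1) v] unfolding \<tau>v by blast
    have "?P z \<le> exp (real k * v z)" for z
    proof -
      have "- 1 + exp (- real k * v z) * ?P z \<le> 0"
        using \<tau> unfolding nonpositively_curved_def \<tau>v by (metis vortex_metric_iff(2)[OF assms(1) v])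
      then show ?thesis by (simp add: exp_minus field_simps)
    qed
    then obtain m' where m': "\<And>z. m' \<le> v z"
      using nonpositively_curved_bounded_below[OF assms v] by blast
    \<comment> \<open>Both solutions are bounded below, so comparison applies in either
      order.\<close>
    have "u z = v z" for z
    proof (rule antisym)
      show "u z \<le> v z" by (rule vortex_comparison[OF k0 _ _ u(1) u(3) v lv m']) auto
      show "v z \<le> u z" by (rule vortex_comparison[OF k0 _ _ v lv u(1) u(3) u(2)]) auto
    qed
    then show "\<tau> = ?\<sigma>" unfolding \<tau>v by simp
  qed
qed

end
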